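(* Let $X$ be a separable metrizable space. Then either $\mathrm{basic}(X)$ is finite, which occurs if and only if $X$ is locally compact and finite dimensional, or $\mathrm{basic}(X)=\mathfrak{c}$.
   Context: All topological spaces are Tychonoff. $C(X)$ is the set of all continuous functions $X\to\mathbb{R}$. A family $\Phi\subseteq C(X)$ is called basic for $X$ if every $f\in C(X)$ can be represented as $f=\sum_{i=1}^n g_i\circ\phi_i$ for some $n$, some $\phi_1,\ldots,\phi_n\in\Phi$ and some $g_1,\ldots,g_n\in C(\mathbb{R})$ (here $n$ may depend on $f$). Define $\mathrm{basic}(X)=\min\{|\Phi| : \Phi \text{ is a basic family for } X\}$. $\mathfrak{c}=2^{\aleph_0}$. Dimension means covering dimension. *)

theory Defs
  imports "HOL-Analysis.Analysis"
begin

unbundle cardinal_syntax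

(* Functions are extensional, so that elements of cont_real X that agree on the space
   are equal and cardinalities of subsets of cont_real X are the intended ones. *)
definition cont_real :: "'a topology \<Rightarrow> ('a \<Rightarrow> real) set" where
  "cont_real X = {f \<in> extensional (topspace X). continuous_map X euclideanreal f}"

definition basic_family :: "'a topology \<Rightarrow> ('a \<Rightarrow> real) set \<Rightarrow> bool" where
  "basic_family X \<Phi> \<longleftrightarrow> \<Phi> \<subseteq> cont_real X \<and>
     (\<forall>f\<in>cont_real X. \<exists>n::nat. \<exists>\<phi> g. (\<forall>i\<in>{1..n}. \<phi> i \<in> \<Phi> \<and> g i \<in> cont_real euclideanreal) \<and>
        (\<forall>x\<in>topspace X. f x = (\<Sum>i=1..n. g i (\<phi> i x))))"

(* Cardinals are represented by well-order relations, with \<le>o comparing them;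
   the minimum is unique up to =o. *)
definition basic :: "'a topology \<Rightarrow> ('a \<Rightarrow> real) rel" where
  "basic X = (SOME \<kappa>. \<kappa> \<in> {|\<Phi>| | \<Phi>. basic_family X \<Phi>} \<and>
                      (\<forall>\<mu>\<in>{|\<Phi>| | \<Phi>. basic_family X \<Phi>}. \<kappa> \<le>o \<mu>))"

lemma basic_family_cont_real: "basic_family X (cont_real X)"
  unfolding basic_family_def
proof (intro conjI ballI)
  fix f assume f: "f \<in> cont_real X"
  show "\<exists>n::nat. \<exists>\<phi> g. (\<forall>i\<in>{1..n}. \<phi> i \<in> cont_real X \<and> g i \<in> cont_real euclideanreal) \<and>
          (\<forall>x\<in>topspace X. f x = (\<Sum>i=1..n. g i (\<phi> i x)))"
    by (intro exI[of _ "1::nat"] exI[of _ "\<lambda>_. f"] exI[of _ "\<lambda>_ x. x"])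
      (use f in \<open>auto simp: cont_real_def\<close>)
qed simp

lemma basic_is_minimum:
  shows "\<exists>\<Phi>. basic_family X \<Phi> \<and> basic X = |\<Phi>|"
    and "basic_family X \<Psi> \<Longrightarrow> basic X \<le>o |\<Psi>|"
proof -
  let ?R = "{|\<Phi>| | \<Phi>. basic_family X \<Phi>}"
  have "?R \<noteq> {}" "\<forall>r\<in>?R. Card_order r"
    using basic_family_cont_real[of X] by (auto intro: card_of_Card_order)
  from someI_ex[OF exists_minim_Card_order[OF this, unfolded Bex_def]]
  have *: "basic X \<in> ?R \<and> (\<forall>\<mu>\<in>?R. basic X \<le>o \<mu>)"
    unfolding basic_def .
  then show "\<exists>\<Phi>. basic_family X \<Phi> \<and> basic X = |\<Phi>|" by blast
  show "basic_family X \<Psi> \<Longrightarrow> basic X \<le>o |\<Psi>|" using * by blast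
qed

abbreviation continuum :: "(nat \<Rightarrow> bool) rel" where
  "continuum \<equiv> ctwo ^c natLeq"

definition open_cover :: "'a topology \<Rightarrow> 'a set set \<Rightarrow> bool" where
  "open_cover X \<U> \<longleftrightarrow> (\<forall>U\<in>\<U>. openin X U) \<and> \<Union>\<U> = topspace X"

(* Lebesgue covering dimension at most n, via finite open covers, as is usual for
   normal spaces. *)
definition covering_dim_le :: "'a topology \<Rightarrow> nat \<Rightarrow> bool" where
  "covering_dim_le X n \<longleftrightarrow>
     (\<forall>\<U>. finite \<U> \<and> open_cover X \<U> \<longrightarrow>
        (\<exists>\<V>. finite \<V> \<and> open_cover X \<V> \<and> (\<forall>V\<in>\<V>. \<exists>U\<in>\<U>. V \<subseteq> U) \<and>
             (\<forall>x\<in>topspace X. card {V\<in>\<V>. x \<in> V} \<le> n + 1)))"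

definition finite_dimensional :: "'a topology \<Rightarrow> bool" where
  "finite_dimensional X \<longleftrightarrow> (\<exists>n. covering_dim_le X n)"

end

theory Submission
  imports Defs "HOL-Complex_Analysis.Complex_Analysis" "HOL-Library.Countable_Set_Type"
    "HOL-Real_Asymp.Real_Asymp"
begin

text \<open>
  Finiteness for a locally compact space of finite dimension \<open>n\<close> is a superposition theorem in the
  style of Kolmogorov and Ostrand.  On a compact piece, let \<open>m = 2n + 3\<close>.  A fine open cover of order
  at most \<open>n + 1\<close> gives \<open>m\<close> finite families of pairwise disjoint small closed sets such that every
  point is missed by at most \<open>n + 1\<close> of the \<open>m\<close> families, hence by fewer than half of them
  (\<open>coloured_families\<close>).  Any \<open>m\<close> functions can be perturbed so that the \<open>q\<close>-th one separates the members of
  the \<open>q\<close>-th family; repeating this with finer and finer families gives in the limit functions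
  \<open>\<phi>\<^sub>1, \<dots>, \<phi>\<^sub>m\<close> that do so at every scale (\<open>exists_resolving_functions\<close>).  For such functions, let
  \<open>g\<^sub>q\<close> copy \<open>f / m\<close> from the members of the \<open>q\<close>-th family, with \<open>\<bar>g\<^sub>q\<bar> \<le> \<parallel>f\<parallel> / m\<close>.  At each point the
  families that contain it reproduce their share of \<open>f\<close> and the others do bounded
  damage, so the sum of the \<open>g\<^sub>q \<circ> \<phi>\<^sub>q\<close> approximates \<open>f\<close> up to a fixed factor below 1 of its norm.
  Iteration represents \<open>f\<close> exactly (\<open>superposition_on_compact_slice\<close>).

  The noncompact case is reduced to compact slices \<open>j \<le> \<rho> \<le> j + 1\<close> of a proper function \<open>\<rho>\<close>.  If every \<open>\<phi>\<^sub>q\<close>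
  maps each slice to the interval from \<open>j\<close> to \<open>j + 1\<close> and agrees with \<open>\<rho>\<close> at its two ends, then functions that vanish
  on the integer levels of \<open>\<rho>\<close> can be represented slice by slice with no interaction.  An arbitrary
  \<open>f\<close> equals \<open>f sin\<^sup>2(\<pi> \<rho>) + f cos\<^sup>2(\<pi> \<rho>)\<close>, where the first summand vanishes on the integer levels of \<open>\<rho>\<close>
  and the second on those of \<open>\<rho> + 1/2\<close>; so \<open>2m\<close> functions suffice (\<open>finite_basic_family_exists\<close>).

  For the converse, let \<open>\<Phi>\<close> be a basic family with fewer than continuum many members.  Given continuum many
  functions, uncountably many of them are represented with one and the same finite tuple from \<open>\<Phi>\<close>
  (\<open>representation_sharing_inner_functions\<close>), because there are fewer than continuum many tuples.  This is applied to two
  families of functions.  If \<open>x\<^sub>0\<close> has no compact neighbourhood, there are continuum many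
  continuous functions that are pairwise uniformly apart on every neighbourhood of \<open>x\<^sub>0\<close>; but a
  finite tuple is bounded near \<open>x\<^sub>0\<close>, and the functions represented through it depend there on finitely many members
  of the separable space of continuous functions on a compact interval.  So the space is locally compact.
  Next, if \<open>e\<^sub>0, e\<^sub>1, \<dots>\<close> separate points, any infinitely many of the functions \<open>\<Sum>\<^sub>k a\<^sup>k e\<^sub>k\<close>,
  \<open>0 < a < 1/2\<close>, still separate points, since a power series has isolated zeros.  So some finite tuple from \<open>\<Phi>\<close>
  is injective, and together with a proper function it bounds the dimension
  (\<open>finite_dimensional_if_jointly_injective\<close>).

  Thus a basic family is either of size at least the continuum or can be replaced by a finite one, and a separable
  space has at most continuum many continuous functions.
\<close>

section \<open>Coloured families of closed sets\<close>

text \<open>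
  Take a finite refinement \<open>\<V>\<close> of \<open>\<U>\<close> of order at most \<open>n + 1\<close> and let \<open>h V\<close> be the distance to the
  complement of \<open>V\<close>.  For a threshold \<open>t\<close>, the sets of points where the values above \<open>t\<close> are exactly those
  of the members of a fixed \<open>A \<subseteq> \<V>\<close>, with a margin around \<open>t\<close>, are disjoint for different \<open>A\<close>.  If \<open>t\<close> is below a positive lower bound
  of the maximum of all \<open>h V\<close>, only nonempty \<open>A\<close> occur, and these sets miss a point only if some \<open>h V\<close> is close to \<open>t\<close> there.  For \<open>m\<close> thresholds with disjoint margins, each \<open>V\<close> spoils at most one
  threshold at a given point, and only the at most \<open>n + 1\<close> sets \<open>V\<close> containing the point can spoil any.
  This is a cheap substitute for Ostrand's covering theorem.
\<close>
lemma coloured_families: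
  fixes K :: "'b::metric_space set" and \<U> :: "'b set set"
  assumes K: "compact K" and dim: "covering_dim_le (top_of_set K) n"
    and fin: "finite \<U>" and cov: "open_cover (top_of_set K) \<U>"
  obtains \<S> :: "nat \<Rightarrow> 'b set set" where
    "\<And>q. finite (\<S> q)" "\<And>q. disjoint (\<S> q)"
    "\<And>q S. S \<in> \<S> q \<Longrightarrow> compact S \<and> S \<subseteq> K \<and> (\<exists>U\<in>\<U>. S \<subseteq> U)"
    "\<And>x. x \<in> K \<Longrightarrow> card {q. q < m \<and> x \<notin> \<Union>(\<S> q)} \<le> n + 1"
proof -
  obtain \<V> where \<V>: "finite \<V>" "open_cover (top_of_set K) \<V>"
      "\<And>V. V \<in> \<V> \<Longrightarrow> \<exists>U\<in>\<U>. V \<subseteq> U"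
      "\<And>x. x \<in> K \<Longrightarrow> card {V\<in>\<V>. x \<in> V} \<le> n + 1"
    using dim fin cov unfolding covering_dim_le_def by auto
  have opV: "openin (top_of_set K) V" if "V \<in> \<V>" for V
    using \<V>(2) that by (auto simp: open_cover_def)
  have UV: "\<Union>\<V> = K"
    using \<V>(2) by (auto simp: open_cover_def)
  \<comment> \<open>\<open>infdist\<close> from the empty set is 0 by convention, so the case \<open>K \<subseteq> V\<close> is treated apart\<close>
  define h where "h V x = (if K \<subseteq> V then 1 else infdist x (K - V))" for V x
  have h_cont: "continuous_on K (h V)" for V
    unfolding h_def by (cases "K \<subseteq> V") (auto intro!: continuous_intros)
  have h_nonneg: "h V x \<ge> 0" for V x
    by (auto simp: h_def infdist_nonneg)
  have h_pos: "h V x > 0 \<longleftrightarrow> x \<in> V" if "V \<in> \<V>" "x \<in> K" for V x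
  proof (cases "K \<subseteq> V")
    case False
    have "closed (K - V)"
      using opV[OF that(1)] K
      by (metis Diff_Diff_Int closedin_closed_eq closedin_def compact_imp_closed Diff_subset topspace_euclidean_subtopology inf.absorb_iff2 openin_imp_subset)
    then have "x \<in> K - V \<longleftrightarrow> infdist x (K - V) = 0"
      using False by (intro in_closed_iff_infdist_zero) auto
    then show ?thesis
      using False that infdist_nonneg[of x "K - V"] by (auto simp: h_def less_le)
  qed (use that in \<open>auto simp: h_def\<close>)
  obtain c where c: "c > 0" "\<And>x. x \<in> K \<Longrightarrow> \<exists>V\<in>\<V>. h V x \<ge> c"
  proof (cases "K = {}")
    case False
    then have ne: "\<V> \<noteq> {}" using UV by auto
    have "continuous_on K (\<lambda>x. \<Sum>V\<in>\<V>. h V x)"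
      by (intro continuous_intros h_cont)
    then obtain z where z: "z \<in> K" "\<And>x. x \<in> K \<Longrightarrow> (\<Sum>V\<in>\<V>. h V z) \<le> (\<Sum>V\<in>\<V>. h V x)"
      using continuous_attains_inf[OF K False] by blast
    let ?c0 = "\<Sum>V\<in>\<V>. h V z"
    obtain W where W: "W \<in> \<V>" "z \<in> W" using UV z(1) by auto
    have c0: "?c0 > 0"
      by (rule sum_pos2[OF \<V>(1) W(1)]) (use h_pos[OF W(1) z(1)] W h_nonneg in auto)
    have cV: "real (card \<V>) > 0" using ne \<V>(1) by (simp add: card_gt_0_iff)
    show thesis
    proof (rule that[of "?c0 / card \<V>"])
      show "?c0 / card \<V> > 0" using c0 cV by simp
      fix x assume x: "x \<in> K"
      show "\<exists>V\<in>\<V>. h V x \<ge> ?c0 / card \<V>"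
      proof (rule ccontr)
        assume "\<not> ?thesis"
        then have "\<And>V. V \<in> \<V> \<Longrightarrow> h V x < ?c0 / card \<V>" by force
        then have "(\<Sum>V\<in>\<V>. h V x) < (\<Sum>V\<in>\<V>. ?c0 / card \<V>)"
          using ne \<V>(1) by (intro sum_strict_mono) auto
        also have "\<dots> = ?c0" using cV by simp
        finally show False using z(2)[OF x] by simp
      qed
    qed
  qed (use that[of 1] in auto)
  define s where "s = c / (m + 1)"
  have s: "s > 0" using c by (simp add: s_def)
  have sc: "c = (real m + 1) * s" by (simp add: s_def field_simps)
  define t where "t q = (real q + 1) * s" for q :: nat
  define S where "S q A = {x\<in>K. (\<forall>V\<in>A. h V x \<ge> t q + s/3) \<and> (\<forall>V\<in>\<V> - A. h V x \<le> t q - s/3)}" for q A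
  define \<S> where "\<S> q = S q ` (Pow \<V> - {{}})" for q
  show thesis
  proof (rule that[of \<S>])
    fix q
    show "finite (\<S> q)" using \<V>(1) by (simp add: \<S>_def)
    show "disjoint (\<S> q)"
    proof (rule disjointI)
      fix P Q assume "P \<in> \<S> q" "Q \<in> \<S> q" "P \<noteq> Q"
      then obtain A B where AB: "A \<subseteq> \<V>" "B \<subseteq> \<V>" "P = S q A" "Q = S q B" "A \<noteq> B"
        by (auto simp: \<S>_def)
      have *: "False" if "x \<in> S q A" "x \<in> S q B" "V \<in> A" "V \<notin> B" "A \<subseteq> \<V>" for A B V x
        using that s unfolding S_def by (smt (verit, ccfv_SIG) DiffI divide_pos_pos mem_Collect_eq subsetD)
      from AB(5) obtain V where "V \<in> A \<and> V \<notin> B \<or> V \<in> B \<and> V \<notin> A" by auto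
      then show "P \<inter> Q = {}" using *[of _ A B V] *[of _ B A V] AB by auto
    qed
    fix R assume "R \<in> \<S> q"
    then obtain A where A: "A \<subseteq> \<V>" "A \<noteq> {}" "R = S q A" by (auto simp: \<S>_def)
    have "R = K \<inter> (\<Inter>V\<in>A. {x\<in>K. t q + s/3 \<le> h V x}) \<inter> (\<Inter>V\<in>\<V>-A. {x\<in>K. h V x \<le> t q - s/3})"
      using A by (auto simp: S_def)
    moreover have "closed {x\<in>K. t q + s/3 \<le> h V x}" "closed {x\<in>K. h V x \<le> t q - s/3}" for V
      by (intro continuous_on_closed_Collect_le continuous_intros h_cont compact_imp_closed K)+
    ultimately have "compact R"
      using K by (auto intro!: compact_Int_closed closed_INT)
    obtain V where V: "V \<in> A" using A by auto
    have "R \<subseteq> V"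
    proof
      fix x assume "x \<in> R"
      then have "x \<in> K" "h V x \<ge> t q + s/3" using A V by (auto simp: S_def)
      moreover have "t q + s/3 > 0" using s by (simp add: t_def add_pos_pos)
      ultimately show "x \<in> V" using h_pos[of V x] V A by force
    qed
    moreover obtain U where "U \<in> \<U>" "V \<subseteq> U" using \<V>(3)[of V] V A by auto
    moreover have "R \<subseteq> K" using A by (auto simp: S_def)
    ultimately show "compact R \<and> R \<subseteq> K \<and> (\<exists>U\<in>\<U>. R \<subseteq> U)"
      using \<open>compact R\<close> by blast
  next
    fix x assume x: "x \<in> K"
    define bad where "bad = {q. q < m \<and> x \<notin> \<Union>(\<S> q)}"
    have ex: "\<exists>V\<in>\<V>. \<bar>h V x - t q\<bar> < s/3" if "q \<in> bad" for q
    proof (rule ccontr)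
      assume none: "\<not> ?thesis"
      have qm: "q < m" using that by (simp add: bad_def)
      let ?A = "{V\<in>\<V>. h V x \<ge> t q + s/3}"
      have "h V x \<ge> t q + s/3 \<or> h V x \<le> t q - s/3" if "V \<in> \<V>" for V
        using none that by (smt (verit))
      then have inS: "x \<in> S q ?A"
        using x unfolding S_def by auto
      obtain V where V: "V \<in> \<V>" "h V x \<ge> c" using c(2)[OF x] by auto
      have "t q + s/3 \<le> (real m + 1/3) * s"
      proof -
        have "(real q + 1) * s \<le> real m * s" using qm s by (intro mult_right_mono) auto
        then show ?thesis by (simp add: t_def algebra_simps)
      qed
      also have "\<dots> \<le> c" using s by (simp add: sc algebra_simps)
      finally have "V \<in> ?A" using V by auto
      then have "S q ?A \<in> \<S> q" unfolding \<S>_def by blast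
      then show False using inS that by (auto simp: bad_def)
    qed
    then obtain v where v: "\<And>q. q \<in> bad \<Longrightarrow> v q \<in> \<V> \<and> \<bar>h (v q) x - t q\<bar> < s/3" by metis
    have "inj_on v bad"
    proof (rule inj_onI)
      fix p q assume pq: "p \<in> bad" "q \<in> bad" "v p = v q"
      then have "\<bar>t p - t q\<bar> < s" using v[OF pq(1), THEN conjunct2] v[OF pq(2), THEN conjunct2] s unfolding pq(3) by linarith
      then have "\<bar>real p - real q\<bar> * s < 1 * s"
        using s by (simp add: t_def left_diff_distrib abs_mult flip: left_diff_distrib)
      then show "p = q" using s by (simp only: mult_less_cancel_right_pos)
    qed
    moreover have "v ` bad \<subseteq> {V\<in>\<V>. x \<in> V}"
    proof
      fix V assume "V \<in> v ` bad"
      then obtain q where q: "q \<in> bad" "V = v q" by auto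
      have "t q \<ge> s" using s by (simp add: t_def algebra_simps)
      then have "h V x > 0" using v[OF q(1)] q(2) s by (simp add: abs_if split: if_splits)
      then show "V \<in> {V\<in>\<V>. x \<in> V}" using h_pos x v q by auto
    qed
    ultimately have "card bad \<le> card {V\<in>\<V>. x \<in> V}"
      using \<V>(1) by (intro card_inj_on_le) auto
    then show "card {q. q < m \<and> x \<notin> \<Union>(\<S> q)} \<le> n + 1"
      using \<V>(4)[OF x] by (simp add: bad_def)
  qed
qed

section \<open>Functions resolving a compact space\<close>

lemma small_near_zero_set:
  fixes K :: "'b::metric_space set" and \<rho> f :: "'b \<Rightarrow> real"
  assumes K: "compact K" and r: "continuous_on K \<rho>" and f: "continuous_on K f"
    and nonneg: "\<And>x. x \<in> K \<Longrightarrow> \<rho> x \<ge> 0"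
    and zero: "\<And>x. x \<in> K \<Longrightarrow> \<rho> x = 0 \<Longrightarrow> f x = 0" and "\<delta> > 0"
  shows "\<exists>\<epsilon>>0. \<forall>x\<in>K. \<rho> x < \<epsilon> \<longrightarrow> \<bar>f x\<bar> < \<delta>"
proof -
  let ?L = "{x\<in>K. \<delta> \<le> \<bar>f x\<bar>}"
  have "closed ?L"
    by (intro continuous_on_closed_Collect_le continuous_intros f compact_imp_closed K)
  with K have "compact (K \<inter> ?L)" by (rule compact_Int_closed)
  moreover have "K \<inter> ?L = ?L" by auto
  ultimately have L: "compact ?L" by (simp only:)
  show ?thesis
  proof (cases "?L = {}")
    case True
    then show ?thesis by (intro exI[of _ 1]) (auto simp: not_le)
  next
    case False
    have "continuous_on ?L \<rho>" using r by (rule continuous_on_subset) auto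
    then obtain z where z: "z \<in> ?L" "\<And>x. x \<in> ?L \<Longrightarrow> \<rho> z \<le> \<rho> x"
      using continuous_attains_inf[OF L False] by blast
    have "\<rho> z > 0" using z(1) zero[of z] nonneg[of z] \<open>\<delta> > 0\<close> by force
    then show ?thesis using z(2) by (intro exI[of _ "\<rho> z"]) (force simp: not_le)
  qed
qed

lemma distinct_choice_from_infinite_sets:
  assumes "finite J" "\<And>a. a \<in> J \<Longrightarrow> infinite (W a)"
  shows "\<exists>v. inj_on v J \<and> (\<forall>a\<in>J. v a \<in> W a)"
  using assms
proof (induction J rule: finite_induct)
  case (insert a J)
  then obtain v where v: "inj_on v J" "\<forall>a\<in>J. v a \<in> W a" by auto
  have "infinite (W a - v ` J)" using insert by simp
  then obtain z where z: "z \<in> W a" "z \<notin> v ` J" by (metis Diff_iff finite.emptyI equals0I)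
  show ?case
    using v z insert(2) by (intro exI[of _ "v(a := z)"]) (auto simp: inj_on_def)
qed auto

lemma finite_real_set_separated:
  fixes Z :: "real set"
  assumes "finite Z"
  shows "\<exists>\<gamma>>0. \<forall>a\<in>Z. \<forall>b\<in>Z. \<bar>a - b\<bar> < \<gamma> \<longrightarrow> a = b"
proof -
  let ?D = "insert 1 ((\<lambda>(a, b). \<bar>a - b\<bar>) ` {(a, b) \<in> Z \<times> Z. a \<noteq> b})"
  have "finite {(a, b) \<in> Z \<times> Z. a \<noteq> b}"
    by (rule finite_subset[of _ "Z \<times> Z"]) (use assms in auto)
  then have D: "finite ?D" "?D \<noteq> {}" by auto
  have "Min ?D > 0" using D by (subst Min_gr_iff) auto
  moreover have "\<bar>a - b\<bar> \<ge> Min ?D" if "a \<in> Z" "b \<in> Z" "a \<noteq> b" for a b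
    using that D by (intro Min_le) auto
  ultimately show ?thesis by (intro exI[of _ "Min ?D"]) (force simp: not_less[symmetric])
qed

text \<open>
  A compact slice is a compact set \<open>K\<close> with a function \<open>\<rho>\<close> into the unit interval.  Its ends are the level sets
  of 0 and 1, along which neighbouring slices are to be glued.
\<close>
definition compatible :: "'b::metric_space set \<Rightarrow> ('b \<Rightarrow> real) \<Rightarrow> ('b \<Rightarrow> real) \<Rightarrow> bool" where
  "compatible K \<rho> \<phi> \<longleftrightarrow> continuous_on K \<phi> \<and>
     (\<forall>x\<in>K. 0 \<le> \<phi> x \<and> \<phi> x \<le> 1 \<and> (\<rho> x = 0 \<longrightarrow> \<phi> x = 0) \<and> (\<rho> x = 1 \<longrightarrow> \<phi> x = 1))"

text \<open>
  Closeness in the space obtained from \<open>K\<close> by collapsing each of the two ends to a point.  This is the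
  right notion of scale for functions that vanish on the ends.
\<close>
definition near :: "('b::metric_space \<Rightarrow> real) \<Rightarrow> real \<Rightarrow> 'b \<Rightarrow> 'b \<Rightarrow> bool" where
  "near \<rho> \<epsilon> x y \<longleftrightarrow> dist x y < \<epsilon> \<or> (\<rho> x < \<epsilon> \<and> \<rho> y < \<epsilon>) \<or> (\<rho> x > 1 - \<epsilon> \<and> \<rho> y > 1 - \<epsilon>)"

text \<open>
  Values close to 0 and 1 are reserved for the ends, because the outer functions will be required to vanish at 0 and 1.
\<close>
definition resolves_on ::
    "'b::metric_space set \<Rightarrow> ('b \<Rightarrow> real) \<Rightarrow> real \<Rightarrow> real \<Rightarrow> ('b \<Rightarrow> real) \<Rightarrow> bool" where
  "resolves_on G \<rho> \<epsilon> \<gamma> \<phi> \<longleftrightarrow>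
     (\<forall>x\<in>G. (\<phi> x < \<gamma> \<longrightarrow> \<rho> x < \<epsilon>) \<and> (\<phi> x > 1 - \<gamma> \<longrightarrow> \<rho> x > 1 - \<epsilon>) \<and>
        (\<forall>y\<in>G. \<bar>\<phi> x - \<phi> y\<bar> < \<gamma> \<longrightarrow> near \<rho> \<epsilon> x y))"

text \<open>
  \<open>G q\<close> plays the role of the union of the \<open>q\<close>-th coloured family.  Speaking of \<open>G q\<close> instead of the
  family leaves a condition on \<open>\<phi> q\<close> alone, stable under small perturbations.
\<close>
definition resolves ::
    "'b::metric_space set \<Rightarrow> ('b \<Rightarrow> real) \<Rightarrow> nat \<Rightarrow> nat \<Rightarrow> real \<Rightarrow> (nat \<Rightarrow> 'b \<Rightarrow> real) \<Rightarrow> real \<Rightarrow> bool" where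
  "resolves K \<rho> m N \<epsilon> \<phi> \<gamma> \<longleftrightarrow>
     (\<exists>G. (\<forall>x\<in>K. card {q. q < m \<and> x \<notin> G q} \<le> N) \<and>
          (\<forall>q<m. G q \<subseteq> K \<and> resolves_on (G q) \<rho> \<epsilon> \<gamma> (\<phi> q)))"

lemma near_mono: "near \<rho> \<epsilon> x y \<Longrightarrow> \<epsilon> \<le> \<epsilon>' \<Longrightarrow> near \<rho> \<epsilon>' x y"
  unfolding near_def by linarith

lemma resolves_mono:
  assumes "resolves K \<rho> m N \<epsilon> \<phi> \<gamma>" "\<epsilon> \<le> \<epsilon>'"
  shows "resolves K \<rho> m N \<epsilon>' \<phi> \<gamma>"
proof -
  have "resolves_on G \<rho> \<epsilon>' \<gamma> \<psi>" if "resolves_on G \<rho> \<epsilon> \<gamma> \<psi>" for G \<psi>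
    using that near_mono[OF _ assms(2)] assms(2) unfolding resolves_on_def by fastforce
  then show ?thesis using assms(1) unfolding resolves_def by blast
qed

lemma resolves_perturb:
  assumes res: "resolves K \<rho> m N \<epsilon> \<phi> \<gamma>"
    and d: "\<And>q x. q < m \<Longrightarrow> x \<in> K \<Longrightarrow> \<bar>\<psi> q x - \<phi> q x\<bar> \<le> \<gamma> / 4"
  shows "resolves K \<rho> m N \<epsilon> \<psi> (\<gamma> / 2)"
proof -
  obtain G where G: "\<And>x. x \<in> K \<Longrightarrow> card {q. q < m \<and> x \<notin> G q} \<le> N"
    "\<And>q. q < m \<Longrightarrow> G q \<subseteq> K \<and> resolves_on (G q) \<rho> \<epsilon> \<gamma> (\<phi> q)"
    using res unfolding resolves_def by blast
  have "resolves_on (G q) \<rho> \<epsilon> (\<gamma>/2) (\<psi> q)" if q: "q < m" for q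
    unfolding resolves_on_def
  proof (intro ballI conjI impI)
    fix x assume x: "x \<in> G q"
    then have xK: "x \<in> K" using G(2)[OF q] by auto
    note r = G(2)[OF q, THEN conjunct2, unfolded resolves_on_def, rule_format, OF x]
    show "\<rho> x < \<epsilon>" if "\<psi> q x < \<gamma> / 2" using r d[OF q xK] that by linarith
    show "\<rho> x > 1 - \<epsilon>" if "\<psi> q x > 1 - \<gamma> / 2" using r d[OF q xK] that by linarith
    fix y assume y: "y \<in> G q" "\<bar>\<psi> q x - \<psi> q y\<bar> < \<gamma> / 2"
    then have yK: "y \<in> K" using G(2)[OF q] by auto
    have "\<bar>\<phi> q x - \<phi> q y\<bar> < \<gamma>" using d[OF q xK] d[OF q yK] y(2) by linarith
    then show "near \<rho> \<epsilon> x y" using r y by blast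
  qed
  then show ?thesis using G unfolding resolves_def by blast
qed

text \<open>
  Tietze's theorem applied to the required correction, followed by truncation to the unit interval.  The ends of the
  slice join the sets with prescribed values, which is consistent because of the hypothesis on \<open>\<rho>\<close> and \<open>v\<close>.
\<close>
lemma prescribe_values:
  fixes K :: "'b::{metric_space,second_countable_topology} set"
  assumes K: "compact K" and comp: "compatible K \<rho> \<phi>" and r: "continuous_on K \<rho>"
    and fin: "finite \<S>" and disj: "disjoint \<S>" and cpt: "\<And>S. S \<in> \<S> \<Longrightarrow> compact S \<and> S \<subseteq> K"
    and v01: "\<And>S. S \<in> \<S> \<Longrightarrow> 0 \<le> v S \<and> v S \<le> 1"
    and v: "\<And>S x. S \<in> \<S> \<Longrightarrow> x \<in> S \<Longrightarrow> \<bar>v S - \<phi> x\<bar> \<le> \<eta>"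
    and vends: "\<And>S x. S \<in> \<S> \<Longrightarrow> x \<in> S \<Longrightarrow> (\<rho> x = 0 \<longrightarrow> v S = 0) \<and> (\<rho> x = 1 \<longrightarrow> v S = 1)"
    and "\<eta> \<ge> 0"
  shows "\<exists>\<psi>. compatible K \<rho> \<psi> \<and> (\<forall>x\<in>K. \<bar>\<psi> x - \<phi> x\<bar> \<le> \<eta>) \<and> (\<forall>S\<in>\<S>. \<forall>x\<in>S. \<psi> x = v S)"
proof -
  define B where "B c = {x\<in>K. \<rho> x = c}" for c :: real
  have Bc: "closed (B c)" for c
    using continuous_closed_preimage[OF r compact_imp_closed[OF K] closed_singleton[of c]]
    by (simp add: B_def vimage_def Int_def conj_commute)
  define w where "w x = (if \<exists>S\<in>\<S>. x \<in> S then v (SOME S. S \<in> \<S> \<and> x \<in> S) else \<rho> x)" for x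
  have w_on: "w x = v S" if "S \<in> \<S>" "x \<in> S" for S x
  proof -
    have "(SOME S. S \<in> \<S> \<and> x \<in> S) = S"
      by (rule some_equality) (use that disj in \<open>auto simp: disjoint_def\<close>)
    then show ?thesis using that by (auto simp: w_def)
  qed
  have w_B: "w x = c" if "x \<in> B c" "c \<in> {0, 1}" for x c
  proof (cases "\<exists>S\<in>\<S>. x \<in> S")
    case True
    then obtain S where "S \<in> \<S>" "x \<in> S" by blast
    then show ?thesis using w_on[of S x] vends[of S x] that by (auto simp: B_def)
  qed (use that in \<open>auto simp: w_def B_def\<close>)
  define T where "T = \<Union>\<S> \<union> B 0 \<union> B 1"
  have clS: "closed (\<Union>\<S>)" using fin cpt by (intro closed_Union) (auto intro: compact_imp_closed)
  have cT: "closed T" unfolding T_def using clS Bc by auto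
  have TK: "T \<subseteq> K" using cpt by (auto simp: T_def B_def)
  have "continuous_on (\<Union>S\<in>\<S>. S) w"
  proof (rule continuous_on_closed_Union[OF fin])
    fix S assume "S \<in> \<S>"
    then show "closed S" "continuous_on S w"
      using cpt w_on by (auto intro: compact_imp_closed simp: continuous_on_cong[of S S w "\<lambda>_. v S"])
  qed
  moreover have "continuous_on (B c) w" if "c \<in> {0, 1}" for c
    using w_B[OF _ that] by (simp add: continuous_on_cong[of "B c" "B c" w "\<lambda>_. c"])
  ultimately have w_cont: "continuous_on T w"
    unfolding T_def using clS Bc by (intro continuous_on_closed_Un) auto
  have phi: "continuous_on K \<phi>" "\<And>x. x \<in> K \<Longrightarrow> 0 \<le> \<phi> x \<and> \<phi> x \<le> 1"
    "\<And>x. x \<in> B 0 \<Longrightarrow> \<phi> x = 0" "\<And>x. x \<in> B 1 \<Longrightarrow> \<phi> x = 1"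
    using comp by (auto simp: compatible_def B_def)
  obtain h where h: "continuous_on K h" "\<And>x. x \<in> T \<Longrightarrow> h x = w x - \<phi> x" "\<And>x. x \<in> K \<Longrightarrow> norm (h x) \<le> \<eta>"
  proof (rule Tietze[of T "\<lambda>x. w x - \<phi> x" K \<eta>])
    show "continuous_on T (\<lambda>x. w x - \<phi> x)"
      using w_cont continuous_on_subset[OF phi(1) TK] by (intro continuous_intros)
    show "closedin (top_of_set K) T" using cT TK by (simp add: closed_subset)
    fix x assume "x \<in> T"
    then consider S where "S \<in> \<S>" "x \<in> S" | "x \<in> B 0" | "x \<in> B 1" by (auto simp: T_def)
    then show "norm (w x - \<phi> x) \<le> \<eta>"
      by cases (use v w_on w_B phi \<open>\<eta> \<ge> 0\<close> in auto)
  qed (use \<open>\<eta> \<ge> 0\<close> in auto)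
  define \<psi> where "\<psi> x = max 0 (min 1 (\<phi> x + h x))" for x
  have w01: "w x \<in> {0..1}" if "x \<in> T" for x
    using that w_B w_on v01 by (auto simp: T_def)
  have psi_T: "\<psi> x = w x" if "x \<in> T" for x
    using that h(2) w01[OF that] by (auto simp: \<psi>_def)
  show ?thesis
  proof (intro exI[of _ \<psi>] conjI ballI)
    have "continuous_on K \<psi>" unfolding \<psi>_def by (intro continuous_intros phi h)
    moreover have "\<psi> x = 0" if "x \<in> B 0" for x using that psi_T w_B by (auto simp: T_def)
    moreover have "\<psi> x = 1" if "x \<in> B 1" for x using that psi_T w_B by (auto simp: T_def)
    ultimately show "compatible K \<rho> \<psi>" by (auto simp: compatible_def B_def \<psi>_def)
    fix x assume "x \<in> K"
    then show "\<bar>\<psi> x - \<phi> x\<bar> \<le> \<eta>" using h(3)[of x] phi(2)[of x] by (auto simp: \<psi>_def abs_if max_def min_def)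
  next
    fix S x assume "S \<in> \<S>" "x \<in> S"
    then show "\<psi> x = v S" using psi_T[of x] w_on by (auto simp: T_def)
  qed
qed

text \<open>
  Resolving tuples are dense.  Cover \<open>K\<close> by neighbourhoods \<open>Z\<close> and \<open>E\<close> of the two ends and by
  small sets that avoid the ends, and take coloured families subordinate to this cover.  On members inside \<open>Z\<close> or \<open>E\<close> the new function gets
  the value 0 or 1; the remaining members get pairwise distinct values strictly between 0 and 1, close to the old ones.
  The least gap between these finitely many values is \<open>\<gamma>\<close>.
\<close>
lemma perturb_to_resolving:
  fixes K :: "'b::{metric_space,second_countable_topology} set"
  assumes K: "compact K" and dim: "covering_dim_le (top_of_set K) n"
    and r: "continuous_on K \<rho>" and r01: "\<And>x. x \<in> K \<Longrightarrow> 0 \<le> \<rho> x \<and> \<rho> x \<le> 1"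
    and comp: "\<And>q. q < m \<Longrightarrow> compatible K \<rho> (\<phi> q)" and "\<epsilon> > 0" "\<eta> > 0"
  shows "\<exists>\<psi> \<gamma>. (\<forall>q<m. compatible K \<rho> (\<psi> q) \<and> (\<forall>x\<in>K. \<bar>\<psi> q x - \<phi> q x\<bar> \<le> \<eta>)) \<and>
           \<gamma> > 0 \<and> resolves K \<rho> m (n + 1) \<epsilon> \<psi> \<gamma>"
proof -
  have phi: "continuous_on K (\<phi> q)" "\<And>x. x \<in> K \<Longrightarrow> 0 \<le> \<phi> q x \<and> \<phi> q x \<le> 1"
    "\<And>x. x \<in> K \<Longrightarrow> \<rho> x = 0 \<Longrightarrow> \<phi> q x = 0" "\<And>x. x \<in> K \<Longrightarrow> \<rho> x = 1 \<Longrightarrow> \<phi> q x = 1" if "q < m" for q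
    using comp[OF that] by (auto simp: compatible_def)
  \<comment> \<open>a scale at which all the given functions vary by less than \<open>\<eta>\<close>\<close>
  have "\<exists>e>0. \<forall>x\<in>K. (\<rho> x < e \<longrightarrow> \<phi> q x < \<eta>) \<and> (\<rho> x > 1 - e \<longrightarrow> \<phi> q x > 1 - \<eta>) \<and>
      (\<forall>y\<in>K. dist x y < e \<longrightarrow> \<bar>\<phi> q x - \<phi> q y\<bar> < \<eta> / 2)" if q: "q < m" for q
  proof -
    obtain e1 where e1: "e1 > 0" "\<And>x. x \<in> K \<Longrightarrow> \<rho> x < e1 \<Longrightarrow> \<bar>\<phi> q x\<bar> < \<eta>"
      using small_near_zero_set[OF K r phi(1)[OF q] _ _ \<open>\<eta> > 0\<close>] r01 phi(3)[OF q] by blast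
    have "\<exists>e>0. \<forall>x\<in>K. 1 - \<rho> x < e \<longrightarrow> \<bar>1 - \<phi> q x\<bar> < \<eta>"
      by (rule small_near_zero_set[OF K _ _ _ _ \<open>\<eta> > 0\<close>])
        (use r01 phi[OF q] in \<open>auto intro!: continuous_intros r\<close>)
    then obtain e2 where e2: "e2 > 0" "\<And>x. x \<in> K \<Longrightarrow> 1 - \<rho> x < e2 \<Longrightarrow> \<bar>1 - \<phi> q x\<bar> < \<eta>" by blast
    have "\<eta> / 2 > 0" using \<open>\<eta> > 0\<close> by simp
    from compact_uniformly_continuous[OF phi(1)[OF q] K, unfolded uniformly_continuous_on_def, rule_format, OF this]
    obtain e3 where e3: "e3 > 0" "\<And>x y. x \<in> K \<Longrightarrow> y \<in> K \<Longrightarrow> dist y x < e3 \<Longrightarrow> dist (\<phi> q y) (\<phi> q x) < \<eta> / 2"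
      by blast
    show ?thesis
    proof (intro exI[of _ "min e1 (min e2 e3)"] conjI ballI impI)
      show "min e1 (min e2 e3) > 0" using e1 e2 e3 by simp
      fix x assume x: "x \<in> K"
      show "\<phi> q x < \<eta>" if "\<rho> x < min e1 (min e2 e3)" using e1(2)[OF x] that by linarith
      show "\<phi> q x > 1 - \<eta>" if "\<rho> x > 1 - min e1 (min e2 e3)" using e2(2)[OF x] that by linarith
      fix y assume "y \<in> K" "dist x y < min e1 (min e2 e3)"
      then show "\<bar>\<phi> q x - \<phi> q y\<bar> < \<eta> / 2" using e3(2)[of y x] x by (simp add: dist_real_def)
    qed
  qed
  then obtain e where "\<And>q. q < m \<Longrightarrow> e q > 0 \<and> (\<forall>x\<in>K. (\<rho> x < e q \<longrightarrow> \<phi> q x < \<eta>) \<and>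
      (\<rho> x > 1 - e q \<longrightarrow> \<phi> q x > 1 - \<eta>) \<and>
      (\<forall>y\<in>K. dist x y < e q \<longrightarrow> \<bar>\<phi> q x - \<phi> q y\<bar> < \<eta> / 2))" by metis
  then have e: "\<And>q. q < m \<Longrightarrow> e q > 0"
    "\<And>q x. q < m \<Longrightarrow> x \<in> K \<Longrightarrow> \<rho> x < e q \<Longrightarrow> \<phi> q x < \<eta>"
    "\<And>q x. q < m \<Longrightarrow> x \<in> K \<Longrightarrow> \<rho> x > 1 - e q \<Longrightarrow> \<phi> q x > 1 - \<eta>"
    "\<And>q x y. q < m \<Longrightarrow> x \<in> K \<Longrightarrow> y \<in> K \<Longrightarrow> dist x y < e q \<Longrightarrow> \<bar>\<phi> q x - \<phi> q y\<bar> < \<eta> / 2"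
    by blast+
  \<comment> \<open>the bound 1/2 keeps the neighbourhoods of the two ends disjoint\<close>
  define \<epsilon>' where "\<epsilon>' = Min (insert \<epsilon> (insert (1/2) (e ` {..<m})))"
  have e'pos: "\<epsilon>' > 0" unfolding \<epsilon>'_def using \<open>\<epsilon> > 0\<close> e(1) by (subst Min_gr_iff) auto
  have e'le: "\<epsilon>' \<le> \<epsilon>" "\<epsilon>' \<le> 1/2" "\<And>q. q < m \<Longrightarrow> \<epsilon>' \<le> e q"
    unfolding \<epsilon>'_def by (rule Min_le; simp)+
  define Z where "Z = {x\<in>K. \<rho> x < \<epsilon>'}"
  define E where "E = {x\<in>K. \<rho> x > 1 - \<epsilon>'}"
  define P where "P a = {x\<in>K. dist a x < \<epsilon>'/2 \<and> 0 < \<rho> x \<and> \<rho> x < 1}" for a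
  have "\<exists>A. finite A \<and> K \<subseteq> (\<Union>a\<in>A. ball a (\<epsilon>'/2))"
    using K half_gt_zero[OF e'pos] unfolding compact_eq_totally_bounded by blast
  then obtain A where A: "finite A" "K \<subseteq> (\<Union>a\<in>A. ball a (\<epsilon>'/2))" by blast
  let ?U = "insert Z (insert E (P ` A))"
  have "open_cover (top_of_set K) ?U"
    unfolding open_cover_def
  proof
    have o: "openin (top_of_set K) {x\<in>K. f x < g x}" if "continuous_on K f" "continuous_on K g" for f g :: "'b \<Rightarrow> real"
    proof -
      have "openin (top_of_set K) (K \<inter> (\<lambda>x. g x - f x) -` {0<..})"
        by (intro continuous_openin_preimage_gen continuous_intros that open_greaterThan)
      then show ?thesis by (simp add: vimage_def Int_def conj_commute)
    qed
    have "P a = {x\<in>K. dist a x < \<epsilon>'/2} \<inter> {x\<in>K. 0 < \<rho> x} \<inter> {x\<in>K. \<rho> x < 1}" for a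
      by (auto simp: P_def)
    then have "openin (top_of_set K) (P a)" for a
      by (auto intro!: openin_Int o continuous_intros r)
    then show "\<forall>U\<in>?U. openin (top_of_set K) U"
      unfolding Z_def E_def by (auto intro!: o continuous_intros r)
    show "\<Union>?U = topspace (top_of_set K)"
    proof (intro equalityI subsetI)
      fix x assume "x \<in> topspace (top_of_set K)"
      then have x: "x \<in> K" by simp
      then obtain a where "a \<in> A" "dist a x < \<epsilon>'/2" using A(2) by auto
      then show "x \<in> \<Union>?U" using x r01[OF x] e'pos by (auto simp: P_def Z_def E_def)
    qed (auto simp: P_def Z_def E_def)
  qed
  then obtain \<S> where \<S>: "\<And>q. finite (\<S> q)" "\<And>q. disjoint (\<S> q)"
    "\<And>q S. S \<in> \<S> q \<Longrightarrow> compact S \<and> S \<subseteq> K \<and> (\<exists>U\<in>?U. S \<subseteq> U)"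
    "\<And>x. x \<in> K \<Longrightarrow> card {q. q < m \<and> x \<notin> \<Union>(\<S> q)} \<le> n + 1"
    using coloured_families[OF K dim, of ?U m] A(1) by (smt (verit) finite.insertI finite_imageI)
  define J where "J q = {S\<in>\<S> q. \<not> S \<subseteq> Z \<and> \<not> S \<subseteq> E}" for q
  define W where "W q S = {max 0 (\<phi> q (SOME x. x \<in> S) - \<eta>/2) <..< min 1 (\<phi> q (SOME x. x \<in> S) + \<eta>/2)}" for q S
  have some_in: "(SOME x. x \<in> S) \<in> S" "S \<subseteq> K" if "S \<in> J q" for S q
    using that \<S>(3)[of S q] by (auto simp: J_def some_in_eq)
  have "\<exists>v. inj_on v (J q) \<and> (\<forall>S\<in>J q. v S \<in> W q S)" if q: "q < m" for q
  proof (rule distinct_choice_from_infinite_sets)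
    show "finite (J q)" using \<S>(1) by (simp add: J_def)
    fix S assume "S \<in> J q"
    then have "(SOME x. x \<in> S) \<in> K" using some_in by blast
    then have "max 0 (\<phi> q (SOME x. x \<in> S) - \<eta>/2) < min 1 (\<phi> q (SOME x. x \<in> S) + \<eta>/2)"
      using phi(2)[OF q, of "SOME x. x \<in> S"] \<open>\<eta> > 0\<close> by (simp add: max_def min_def)
    then show "infinite (W q S)" unfolding W_def by (rule infinite_Ioo)
  qed
  then obtain v where v: "\<And>q. q < m \<Longrightarrow> inj_on (v q) (J q)" "\<And>q S. q < m \<Longrightarrow> S \<in> J q \<Longrightarrow> v q S \<in> W q S"
    by metis
  define u where "u q S = (if S \<subseteq> Z then 0 else if S \<subseteq> E then 1 else v q S)" for q S
  have J_small: "dist x y < \<epsilon>'" "\<rho> x > 0" "\<rho> x < 1" if "S \<in> J q" "x \<in> S" "y \<in> S" for S q x y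
  proof -
    have "S \<in> \<S> q" "\<not> S \<subseteq> Z" "\<not> S \<subseteq> E" using that(1) by (auto simp: J_def)
    then obtain a where "S \<subseteq> P a" using \<S>(3)[of S q] by auto
    then have "dist a x < \<epsilon>'/2" "dist a y < \<epsilon>'/2" "\<rho> x > 0" "\<rho> x < 1" using that by (auto simp: P_def)
    then show "dist x y < \<epsilon>'" "\<rho> x > 0" "\<rho> x < 1" using dist_triangle_half_r[of a x \<epsilon>' y] by auto
  qed
  have vJ: "0 < v q S \<and> v q S < 1" if "q < m" "S \<in> J q" for q S
    using v(2)[OF that] by (auto simp: W_def)
  have ZE: "False" if "x \<in> Z" "x \<in> E" for x
    using that e'le by (auto simp: Z_def E_def)
  have "\<exists>\<psi>. compatible K \<rho> \<psi> \<and> (\<forall>x\<in>K. \<bar>\<psi> x - \<phi> q x\<bar> \<le> \<eta>) \<and> (\<forall>S\<in>\<S> q. \<forall>x\<in>S. \<psi> x = u q S)" if q: "q < m" for q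
  proof (rule prescribe_values[OF K comp[OF q] r \<S>(1) \<S>(2)])
    fix S assume S: "S \<in> \<S> q"
    then show "compact S \<and> S \<subseteq> K" using \<S>(3) by blast
    show "0 \<le> u q S \<and> u q S \<le> 1"
      using vJ[OF q, of S] S by (cases "S \<in> J q") (auto simp: u_def J_def)
    fix x assume x: "x \<in> S"
    then have xK: "x \<in> K" using S \<S>(3) by blast
    consider "S \<subseteq> Z" | "\<not> S \<subseteq> Z" "S \<subseteq> E" | "S \<in> J q" using S by (auto simp: J_def)
    then show "\<bar>u q S - \<phi> q x\<bar> \<le> \<eta>"
    proof cases
      case 1
      then have "\<phi> q x < \<eta>" using x xK e(2)[OF q xK] e'le(3)[OF q] by (force simp: Z_def)
      then show ?thesis using 1 phi(2)[OF q xK] by (simp add: u_def)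
    next
      case 2
      then have "\<phi> q x > 1 - \<eta>" using x xK e(3)[OF q xK] e'le(3)[OF q] by (force simp: E_def)
      then show ?thesis using 2 phi(2)[OF q xK] by (simp add: u_def)
    next
      case 3
      define z where "z = (SOME x. x \<in> S)"
      have z: "z \<in> S" "z \<in> K" using some_in[OF 3] by (auto simp: z_def)
      have "dist z x < e q" using J_small(1)[OF 3 z(1) x] e'le(3)[OF q] by simp
      then have "\<bar>\<phi> q z - \<phi> q x\<bar> < \<eta>/2" using e(4)[OF q z(2) xK] by simp
      moreover have "\<phi> q z - \<eta>/2 < v q S" "v q S < \<phi> q z + \<eta>/2"
        using v(2)[OF q 3] by (simp_all add: W_def flip: z_def)
      moreover have "u q S = v q S" using 3 by (auto simp: u_def J_def)
      ultimately show ?thesis by linarith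
    qed
    show "(\<rho> x = 0 \<longrightarrow> u q S = 0) \<and> (\<rho> x = 1 \<longrightarrow> u q S = 1)"
    proof (cases "S \<in> J q")
      case False
      then have "S \<subseteq> Z \<or> S \<subseteq> E" using S by (auto simp: J_def)
      moreover have "\<rho> x = 0 \<Longrightarrow> x \<in> Z" "\<rho> x = 1 \<Longrightarrow> x \<in> E" using xK e'pos by (auto simp: Z_def E_def)
      ultimately show ?thesis using x ZE[of x] by (auto simp: u_def)
    qed (use J_small[OF _ x x] in force)
  qed (use \<open>\<eta> > 0\<close> in auto)
  then obtain \<psi> where \<psi>: "\<And>q. q < m \<Longrightarrow> compatible K \<rho> (\<psi> q)"
    "\<And>q x. q < m \<Longrightarrow> x \<in> K \<Longrightarrow> \<bar>\<psi> q x - \<phi> q x\<bar> \<le> \<eta>"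
    "\<And>q S x. q < m \<Longrightarrow> S \<in> \<S> q \<Longrightarrow> x \<in> S \<Longrightarrow> \<psi> q x = u q S"
    by metis
  have "finite (insert 0 (insert 1 (\<Union>q<m. u q ` \<S> q)))" using \<S>(1) by auto
  from finite_real_set_separated[OF this] obtain \<gamma> where \<gamma>: "\<gamma> > 0"
    "\<And>a b. a \<in> insert 0 (insert 1 (\<Union>q<m. u q ` \<S> q)) \<Longrightarrow> b \<in> insert 0 (insert 1 (\<Union>q<m. u q ` \<S> q))
        \<Longrightarrow> \<bar>a - b\<bar> < \<gamma> \<Longrightarrow> a = b" by blast
  have u0: "S \<subseteq> Z" if "q < m" "S \<in> \<S> q" "u q S = 0" for q S
    using that vJ[of q S] by (auto simp: u_def J_def split: if_splits)
  have u1: "S \<subseteq> E" if "q < m" "S \<in> \<S> q" "u q S = 1" for q S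
    using that vJ[of q S] by (auto simp: u_def J_def split: if_splits)
  have "resolves_on (\<Union>(\<S> q)) \<rho> \<epsilon>' \<gamma> (\<psi> q)" if q: "q < m" for q
    unfolding resolves_on_def
  proof (intro ballI conjI impI)
    fix x assume "x \<in> \<Union>(\<S> q)"
    then obtain S where S: "S \<in> \<S> q" "x \<in> S" by blast
    have ux: "\<psi> q x = u q S" and uS: "u q S \<in> (\<Union>q<m. u q ` \<S> q)" using \<psi>(3)[OF q S] S q by auto
    have u01: "0 \<le> u q S \<and> u q S \<le> 1"
      using vJ[OF q, of S] S(1) by (cases "S \<in> J q") (auto simp: u_def J_def)
    show "\<rho> x < \<epsilon>'" if "\<psi> q x < \<gamma>"
      using u0[OF q S(1)] \<gamma>(2)[of "u q S" 0] uS u01 that S(2) by (auto simp: ux Z_def)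
    show "\<rho> x > 1 - \<epsilon>'" if "\<psi> q x > 1 - \<gamma>"
      using u1[OF q S(1)] \<gamma>(2)[of "u q S" 1] uS u01 that S(2) by (auto simp: ux E_def)
    fix y assume "y \<in> \<Union>(\<S> q)" and d: "\<bar>\<psi> q x - \<psi> q y\<bar> < \<gamma>"
    then obtain T where T: "T \<in> \<S> q" "y \<in> T" by blast
    have uy: "\<psi> q y = u q T" and uT: "u q T \<in> (\<Union>q<m. u q ` \<S> q)" using \<psi>(3)[OF q T] T q by auto
    have eq: "u q S = u q T" using \<gamma>(2)[of "u q S" "u q T"] uS uT d by (auto simp: ux uy)
    consider "u q S = 0" | "u q S = 1" | "S \<in> J q" "T \<in> J q"
      using S(1) T(1) eq by (auto simp: u_def J_def split: if_splits)
    then show "near \<rho> \<epsilon>' x y"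
    proof cases
      case 1
      then have "S \<subseteq> Z" "T \<subseteq> Z" using u0 q S T eq by auto
      then show ?thesis using S T by (auto simp: near_def Z_def)
    next
      case 2
      then have "S \<subseteq> E" "T \<subseteq> E" using u1 q S T eq by auto
      then show ?thesis using S T by (auto simp: near_def E_def)
    next
      case 3
      then have "v q S = v q T" using eq by (auto simp: u_def J_def)
      then have "S = T" using v(1)[OF q] 3 by (auto simp: inj_on_def)
      then show ?thesis using J_small(1)[OF 3(1)] S T by (auto simp: near_def)
    qed
  qed
  then have "resolves K \<rho> m (n + 1) \<epsilon>' \<psi> \<gamma>"
    unfolding resolves_def using \<S>(3,4) by (intro exI[of _ "\<lambda>q. \<Union>(\<S> q)"]) blast
  then have "resolves K \<rho> m (n + 1) \<epsilon> \<psi> \<gamma>" using resolves_mono e'le(1) by blast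
  then show ?thesis using \<psi> \<gamma>(1) by blast
qed

text \<open>
  Resolving at a given scale survives small perturbations and can be achieved by a small perturbation, so a sequence of
  perturbations whose sizes decrease fast enough converges to functions resolving at all scales.
\<close>
lemma exists_resolving_functions:
  fixes K :: "'b::{metric_space,second_countable_topology} set"
  assumes K: "compact K" and dim: "covering_dim_le (top_of_set K) n"
    and r: "continuous_on K \<rho>" and r01: "\<And>x. x \<in> K \<Longrightarrow> 0 \<le> \<rho> x \<and> \<rho> x \<le> 1"
  obtains \<phi> where "\<And>q. q < m \<Longrightarrow> compatible K \<rho> (\<phi> q)"
    "\<And>\<epsilon>. \<epsilon> > 0 \<Longrightarrow> \<exists>\<gamma>>0. resolves K \<rho> m (n + 1) \<epsilon> \<phi> \<gamma>"
proof -
  \<comment> \<open>all functions within distance \<open>snd p\<close> of \<open>fst p\<close> resolve at scale \<open>1 / (k + 1)\<close>\<close>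
  define good where "good k p \<longleftrightarrow> (\<forall>q<m. compatible K \<rho> (fst p q)) \<and> snd p > 0 \<and>
      (\<forall>\<psi>. (\<forall>q<m. \<forall>x\<in>K. \<bar>\<psi> q x - fst p q x\<bar> \<le> snd p) \<longrightarrow>
           (\<exists>\<gamma>>0. resolves K \<rho> m (n + 1) (1 / (real k + 1)) \<psi> \<gamma>))" for k and p :: "(nat \<Rightarrow> 'b \<Rightarrow> real) \<times> real"
  have step: "\<exists>p'. good k p' \<and> (\<forall>q<m. \<forall>x\<in>K. \<bar>fst p' q x - fst p q x\<bar> \<le> snd p / 2) \<and> snd p' \<le> snd p / 2"
    if p: "\<forall>q<m. compatible K \<rho> (fst p q)" "snd p > 0" for k and p :: "(nat \<Rightarrow> 'b \<Rightarrow> real) \<times> real"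
  proof -
    have "1 / (real k + 1) > 0" "snd p / 2 > 0" using p by auto
    then obtain \<psi> \<gamma> where \<psi>: "\<And>q. q < m \<Longrightarrow> compatible K \<rho> (\<psi> q)"
      "\<And>q x. q < m \<Longrightarrow> x \<in> K \<Longrightarrow> \<bar>\<psi> q x - fst p q x\<bar> \<le> snd p / 2"
      "\<gamma> > 0" "resolves K \<rho> m (n + 1) (1 / (real k + 1)) \<psi> \<gamma>"
      using perturb_to_resolving[OF K dim r r01, where \<phi> = "fst p" and m = m] p(1) by metis
    have "\<exists>\<gamma>'>0. resolves K \<rho> m (n + 1) (1 / (real k + 1)) \<psi>' \<gamma>'"
      if "\<forall>q<m. \<forall>x\<in>K. \<bar>\<psi>' q x - \<psi> q x\<bar> \<le> min (snd p / 2) (\<gamma> / 4)" for \<psi>'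
      by (rule exI[of _ "\<gamma>/2"]) (use \<psi>(3) resolves_perturb[OF \<psi>(4), of \<psi>'] that in auto)
    then have "good k (\<psi>, min (snd p / 2) (\<gamma> / 4))"
      using \<psi> p unfolding good_def by simp
    then show ?thesis using \<psi>(2) by (intro exI[of _ "(\<psi>, min (snd p / 2) (\<gamma> / 4))"]) auto
  qed
  have "compatible K \<rho> \<rho>" using r r01 by (auto simp: compatible_def)
  then have init: "\<exists>p. good 0 p" using step[of "(\<lambda>_. \<rho>, 1)" 0] by auto
  have "\<exists>p. \<forall>k. good k (p k) \<and>
      (\<forall>q<m. \<forall>x\<in>K. \<bar>fst (p (Suc k)) q x - fst (p k) q x\<bar> \<le> snd (p k) / 2) \<and> snd (p (Suc k)) \<le> snd (p k) / 2"
  proof (rule dependent_nat_choice[of good "\<lambda>k p p'. (\<forall>q<m. \<forall>x\<in>K. \<bar>fst p' q x - fst p q x\<bar> \<le> snd p / 2)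
          \<and> snd p' \<le> snd p / 2", OF init])
    fix p :: "(nat \<Rightarrow> 'b \<Rightarrow> real) \<times> real" and k assume "good k p"
    then have "\<forall>q<m. compatible K \<rho> (fst p q)" "snd p > 0" by (auto simp: good_def)
    from step[OF this] show "\<exists>p'. good (Suc k) p' \<and> (\<forall>q<m. \<forall>x\<in>K. \<bar>fst p' q x - fst p q x\<bar> \<le> snd p / 2) \<and> snd p' \<le> snd p / 2" .
  qed
  then obtain p where p: "\<And>k. good k (p k)"
    "\<And>k q x. q < m \<Longrightarrow> x \<in> K \<Longrightarrow> \<bar>fst (p (Suc k)) q x - fst (p k) q x\<bar> \<le> snd (p k) / 2"
    "\<And>k. snd (p (Suc k)) \<le> snd (p k) / 2" by blast
  define \<Phi> where "\<Phi> k = fst (p k)" for k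
  define \<eta> where "\<eta> k = snd (p k)" for k
  have eta_pos: "\<eta> k > 0" for k using p(1)[of k] by (simp add: good_def \<eta>_def)
  have eta_le: "\<eta> (k + i) \<le> \<eta> k / 2 ^ i" for k i
  proof (induction i)
    case (Suc i)
    then show ?case using p(3)[of "k + i"] by (simp add: \<eta>_def)
  qed auto
  \<comment> \<open>halving the radii keeps the tail of the sequence within \<open>\<eta> k\<close> of its \<open>k\<close>-th member\<close>
  have close: "\<bar>\<Phi> (k + i) q x - \<Phi> k q x\<bar> \<le> \<eta> k - \<eta> (k + i)" if "q < m" "x \<in> K" for k i q x
  proof (induction i)
    case (Suc i)
    then show ?case
      using p(2)[OF that, of "k + i"] p(3)[of "k + i"] unfolding \<eta>_def \<Phi>_def add_Suc_right by linarith
  qed auto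
  have eta_lim: "\<eta> \<longlonglongrightarrow> 0"
  proof (rule tendsto_sandwich[of "\<lambda>_. 0" _ _ "\<lambda>i. \<eta> 0 / 2 ^ i"])
    show "\<forall>\<^sub>F i in sequentially. \<eta> i \<le> \<eta> 0 / 2 ^ i"
      using eta_le[of 0] by simp
    show "(\<lambda>i. \<eta> 0 / 2 ^ i) \<longlonglongrightarrow> 0"
      by (rule LIMSEQ_divide_realpow_zero) simp
  qed (use eta_pos in \<open>auto intro!: eventuallyI less_imp_le\<close>)
  have conv: "convergent (\<lambda>k. \<Phi> k q x)" if "q < m" "x \<in> K" for q x
  proof (rule Cauchy_convergent, rule metric_CauchyI)
    fix e :: real assume "e > 0"
    then have "e / 2 > 0" by simp
    then obtain N where N: "\<eta> N < e / 2"
      using eta_lim[THEN order_tendstoD(2)] by (metis eventually_sequentially order_refl)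
    have "\<bar>\<Phi> k q x - \<Phi> N q x\<bar> < e / 2" if "k \<ge> N" for k
      using close[OF \<open>q < m\<close> \<open>x \<in> K\<close>, of N "k - N"] that N eta_pos[of k] by simp
    then have "dist (\<Phi> k q x) (\<Phi> l q x) < e" if "k \<ge> N" "l \<ge> N" for k l
      using that unfolding dist_real_def by (smt (verit, ccfv_threshold) field_sum_of_halves)
    then show "\<exists>N. \<forall>k\<ge>N. \<forall>l\<ge>N. dist (\<Phi> k q x) (\<Phi> l q x) < e" by blast
  qed
  define \<phi> where "\<phi> q x = lim (\<lambda>k. \<Phi> k q x)" for q x
  have lim: "(\<lambda>k. \<Phi> k q x) \<longlonglongrightarrow> \<phi> q x" if "q < m" "x \<in> K" for q x
    using conv[OF that] by (simp add: \<phi>_def convergent_LIMSEQ_iff)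
  have phi_close: "\<bar>\<phi> q x - \<Phi> k q x\<bar> \<le> \<eta> k" if "q < m" "x \<in> K" for q x k
  proof (rule LIMSEQ_le_const2)
    show "(\<lambda>i. \<bar>\<Phi> i q x - \<Phi> k q x\<bar>) \<longlonglongrightarrow> \<bar>\<phi> q x - \<Phi> k q x\<bar>"
      by (intro tendsto_intros lim that)
    show "\<exists>N. \<forall>i\<ge>N. \<bar>\<Phi> i q x - \<Phi> k q x\<bar> \<le> \<eta> k"
    proof (intro exI allI impI)
      fix i assume "i \<ge> k"
      then show "\<bar>\<Phi> i q x - \<Phi> k q x\<bar> \<le> \<eta> k"
        using close[OF that, of k "i - k"] eta_pos[of i] by simp
    qed
  qed
  have compk: "compatible K \<rho> (\<Phi> k q)" if "q < m" for k q
    using p(1)[of k] that by (simp add: good_def \<Phi>_def)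
  show thesis
  proof (rule that[of \<phi>])
    fix q assume q: "q < m"
    have "uniform_limit K (\<lambda>k. \<Phi> k q) (\<phi> q) sequentially"
      unfolding uniform_limit_iff
    proof (intro allI impI)
      fix e :: real assume "e > 0"
      then have "\<forall>\<^sub>F k in sequentially. \<eta> k < e" using eta_lim[THEN order_tendstoD(2)] by simp
      then show "\<forall>\<^sub>F k in sequentially. \<forall>x\<in>K. dist (\<Phi> k q x) (\<phi> q x) < e"
      proof eventually_elim
        case (elim k)
        show ?case using phi_close[OF q, of _ k] elim by (force simp: dist_real_def)
      qed
    qed
    then have "continuous_on K (\<phi> q)"
      using compk[OF q] by (intro uniform_limit_theorem[of _ "\<lambda>k. \<Phi> k q"]) (auto simp: compatible_def)
    moreover have "0 \<le> \<phi> q x \<and> \<phi> q x \<le> 1 \<and> (\<rho> x = 0 \<longrightarrow> \<phi> q x = 0) \<and> (\<rho> x = 1 \<longrightarrow> \<phi> q x = 1)"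
      if x: "x \<in> K" for x
    proof -
      have *: "0 \<le> \<Phi> k q x \<and> \<Phi> k q x \<le> 1 \<and> (\<rho> x = 0 \<longrightarrow> \<Phi> k q x = 0) \<and> (\<rho> x = 1 \<longrightarrow> \<Phi> k q x = 1)" for k
        using compk[OF q, of k] x by (simp add: compatible_def)
      have "0 \<le> \<phi> q x" by (rule LIMSEQ_le_const[OF lim[OF q x]]) (use * in auto)
      moreover have "\<phi> q x \<le> 1" by (rule LIMSEQ_le_const2[OF lim[OF q x]]) (use * in auto)
      moreover have "\<phi> q x = 0" if "\<rho> x = 0"
        using lim[OF q x] * that by (simp add: LIMSEQ_const_iff)
      moreover have "\<phi> q x = 1" if "\<rho> x = 1"
        using lim[OF q x] * that by (simp add: LIMSEQ_const_iff)
      ultimately show ?thesis by blast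
    qed
    ultimately show "compatible K \<rho> (\<phi> q)" by (simp add: compatible_def)
  next
    fix \<epsilon> :: real assume "\<epsilon> > 0"
    then obtain k where k: "1 / (real k + 1) < \<epsilon>"
      using nat_approx_posE[of \<epsilon>] by (metis of_nat_Suc add.commute)
    have "\<forall>q<m. \<forall>x\<in>K. \<bar>\<phi> q x - fst (p k) q x\<bar> \<le> snd (p k)"
      using phi_close[of _ _ k] by (simp add: \<Phi>_def \<eta>_def)
    then obtain \<gamma> where "\<gamma> > 0" "resolves K \<rho> m (n + 1) (1 / (real k + 1)) \<phi> \<gamma>"
      using p(1)[of k] unfolding good_def by blast
    then show "\<exists>\<gamma>>0. resolves K \<rho> m (n + 1) \<epsilon> \<phi> \<gamma>" using resolves_mono k by (metis less_imp_le)
  qed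
qed

section \<open>Superpositions on a compact slice\<close>

text \<open>
  The function \<open>g\<close> is a weighted mean of sampled values of \<open>f\<close>, with hat functions on a grid of the unit interval as
  weights.  If \<open>\<phi> x\<close> is in the support of a hat, then the sample point of that hat has a coordinate
  within \<open>\<gamma>\<close> of \<open>\<phi> x\<close>, so it is near \<open>x\<close>.
\<close>
lemma function_of_resolving_coordinate:
  fixes f \<phi> \<rho> :: "'b::metric_space \<Rightarrow> real"
  assumes res: "resolves_on G \<rho> \<epsilon> \<gamma> \<phi>" and "\<gamma> > 0" and phi: "\<And>x. x \<in> G \<Longrightarrow> 0 \<le> \<phi> x \<and> \<phi> x \<le> 1"
    and near_f: "\<And>x y. x \<in> G \<Longrightarrow> y \<in> G \<Longrightarrow> near \<rho> \<epsilon> x y \<Longrightarrow> \<bar>f x - f y\<bar> \<le> \<delta>"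
    and end_f: "\<And>x. x \<in> G \<Longrightarrow> \<rho> x < \<epsilon> \<or> \<rho> x > 1 - \<epsilon> \<Longrightarrow> \<bar>f x\<bar> \<le> \<delta>"
    and bound: "\<And>x. x \<in> G \<Longrightarrow> \<bar>f x\<bar> \<le> C" and "C \<ge> 0"
  shows "\<exists>g. continuous_on {0..1} g \<and> g 0 = 0 \<and> g 1 = 0 \<and> (\<forall>t\<in>{0..1}. \<bar>g t\<bar> \<le> C) \<and>
           (\<forall>x\<in>G. \<bar>g (\<phi> x) - f x\<bar> \<le> \<delta>)"
proof -
  obtain N where N: "2 / (real N + 1) < \<gamma>"
  proof -
    obtain n where "1 / real (Suc n) < \<gamma> / 2" using nat_approx_posE[of "\<gamma>/2"] \<open>\<gamma> > 0\<close> by auto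
    then have "2 / (real n + 1) < \<gamma>" by (simp add: field_simps)
    then show thesis by (rule that)
  qed
  define M where "M = Suc N"
  have M: "M > 0" "2 / real M < \<gamma>" using N by (auto simp: M_def add.commute)
  \<comment> \<open>a sample point whose coordinate is close to the node \<open>i / M\<close>\<close>
  define pick where "pick i = (SOME x. x \<in> G \<and> \<bar>\<phi> x - real i / M\<bar> < 1 / M)" for i :: nat
  \<comment> \<open>the first and last nodes get the value 0, which forces \<open>g 0 = g 1 = 0\<close>\<close>
  define has where "has i \<longleftrightarrow> 0 < i \<and> i < M \<and> (\<exists>x\<in>G. \<bar>\<phi> x - real i / M\<bar> < 1 / M)" for i
  have pick: "pick i \<in> G" "\<bar>\<phi> (pick i) - real i / M\<bar> < 1 / M" if "has i" for i
    using someI_ex[of "\<lambda>x. x \<in> G \<and> \<bar>\<phi> x - real i / M\<bar> < 1 / M"] that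
    unfolding pick_def has_def by blast+
  define c where "c i = (if has i then f (pick i) else 0)" for i
  define w where "w i t = max 0 (1 / M - \<bar>t - real i / M\<bar>)" for i :: nat and t :: real
  define D where "D t = (\<Sum>i\<le>M. w i t)" for t
  define g where "g t = (\<Sum>i\<le>M. w i t * c i) / D t" for t
  have w_nonneg: "w i t \<ge> 0" for i t by (simp add: w_def)
  have w_pos: "w i t > 0 \<longleftrightarrow> \<bar>t - real i / M\<bar> < 1 / M" for i t by (auto simp: w_def less_max_iff_disj)
  have D_pos: "D t > 0" if "0 \<le> t" "t \<le> 1" for t
  proof -
    let ?i = "nat \<lfloor>t * M\<rfloor>"
    have "real ?i \<le> t * M" "t * M < real ?i + 1" using that by auto
    then have "\<bar>t * M - real ?i\<bar> < 1" by linarith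
    then have "\<bar>t * M - real ?i\<bar> / M < 1 / M" using M by (intro divide_strict_right_mono) auto
    moreover have "t - real ?i / M = (t * M - real ?i) / M" using M by (simp add: diff_divide_distrib)
    ultimately have "\<bar>t - real ?i / M\<bar> < 1 / M" by (simp add: abs_divide)
    moreover have "?i \<le> M"
    proof -
      have "t * real M \<le> 1 * real M" using that by (intro mult_right_mono) auto
      then show ?thesis by linarith
    qed
    ultimately show ?thesis unfolding D_def using w_pos w_nonneg by (intro sum_pos2[of _ ?i]) auto
  qed
  have conv: "\<bar>g t - y\<bar> \<le> B" if t: "0 \<le> t" "t \<le> 1" and B: "\<And>i. i \<le> M \<Longrightarrow> w i t > 0 \<Longrightarrow> \<bar>c i - y\<bar> \<le> B" for t y B
  proof -
    have "g t - y = (\<Sum>i\<le>M. w i t * (c i - y)) / D t"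
      using D_pos[OF t] by (simp add: g_def right_diff_distrib sum_subtractf diff_divide_distrib D_def flip: sum_distrib_right)
    moreover have "\<bar>\<Sum>i\<le>M. w i t * (c i - y)\<bar> \<le> (\<Sum>i\<le>M. w i t * B)"
    proof (rule order_trans[OF sum_abs sum_mono])
      fix i assume "i \<in> {..M}"
      then show "\<bar>w i t * (c i - y)\<bar> \<le> w i t * B"
        using B[of i] w_nonneg[of i t] by (cases "w i t = 0") (auto simp: abs_mult intro!: mult_left_mono)
    qed
    moreover have "(\<Sum>i\<le>M. w i t * B) = B * D t" by (simp add: D_def sum_distrib_left mult.commute)
    ultimately show ?thesis
      using D_pos[OF t] by (simp add: abs_divide divide_le_eq)
  qed
  show ?thesis
  proof (intro exI[of _ g] conjI ballI)
    have "continuous_on {0..1} (w i)" for i unfolding w_def by (intro continuous_intros)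
    moreover from this have "continuous_on {0..1} D" unfolding D_def by (intro continuous_intros)
    ultimately show "continuous_on {0..1} g"
      unfolding g_def using D_pos by (intro continuous_intros) (auto simp: less_le)
    have "\<bar>g 0 - 0\<bar> \<le> 0"
    proof (rule conv)
      fix i :: nat assume "w i 0 > 0"
      then have "real i / M < 1 / M" using w_pos by auto
      then have "i = 0" using M by (simp add: field_simps)
      then show "\<bar>c i - 0\<bar> \<le> 0" by (simp add: c_def has_def)
    qed auto
    then show "g 0 = 0" by simp
    have "\<bar>g 1 - 0\<bar> \<le> 0"
    proof (rule conv)
      fix i :: nat assume "w i 1 > 0" "i \<le> M"
      then have "1 - real i / M < 1 / M" using w_pos[of i 1] by auto
      moreover have "1 - real i / M = (real M - real i) / M" using M by (simp add: diff_divide_distrib)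
      ultimately have "real M - real i < 1" using M by (simp add: divide_less_cancel)
      then have "i = M" using \<open>i \<le> M\<close> by simp
      then show "\<bar>c i - 0\<bar> \<le> 0" by (simp add: c_def has_def)
    qed auto
    then show "g 1 = 0" by simp
    fix t :: real assume t: "t \<in> {0..1}"
    have "\<bar>g t - 0\<bar> \<le> C"
      by (rule conv) (use t pick(1) bound \<open>C \<ge> 0\<close> in \<open>auto simp: c_def\<close>)
    then show "\<bar>g t\<bar> \<le> C" by simp
  next
    fix x assume x: "x \<in> G"
    have r: "\<phi> x < \<gamma> \<Longrightarrow> \<rho> x < \<epsilon>" "\<phi> x > 1 - \<gamma> \<Longrightarrow> \<rho> x > 1 - \<epsilon>"
      "\<And>y. y \<in> G \<Longrightarrow> \<bar>\<phi> x - \<phi> y\<bar> < \<gamma> \<Longrightarrow> near \<rho> \<epsilon> x y"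
      using res x unfolding resolves_on_def by blast+
    show "\<bar>g (\<phi> x) - f x\<bar> \<le> \<delta>"
    proof (rule conv)
      fix i assume i: "i \<le> M" "w i (\<phi> x) > 0"
      then have d: "\<bar>\<phi> x - real i / M\<bar> < 1 / M" using w_pos by simp
      have M1: "1 / real M \<le> 2 / real M" using M by (simp add: divide_right_mono)
      show "\<bar>c i - f x\<bar> \<le> \<delta>"
      proof (cases "has i")
        case True
        have "2 / real M = 1 / M + 1 / M" by simp
        then have "\<bar>\<phi> x - \<phi> (pick i)\<bar> < \<gamma>" using pick(2)[OF True] d M(2) by linarith
        then have "\<bar>f x - f (pick i)\<bar> \<le> \<delta>" using near_f r(3) pick(1)[OF True] x by blast
        then show ?thesis using True by (simp add: c_def abs_minus_commute)
      next
        case False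
        then have "i = 0 \<or> i = M" using x d i by (auto simp: has_def)
        then have "\<phi> x < \<gamma> \<or> \<phi> x > 1 - \<gamma>" using d M M1 by (auto simp: abs_if split: if_splits)
        then show ?thesis using False r end_f[OF x] by (auto simp: c_def)
      qed
    qed (use phi[OF x] in auto)
  qed
qed

text \<open>
  The sum of the \<open>m\<close> differences \<open>f x / m - g q (\<phi> q x)\<close> is estimated term by term: a colour that contains \<open>x\<close> contributes
  at most \<open>\<delta> / m\<close>, and each of the at most \<open>N\<close> others at most \<open>2 * C / m\<close>.
\<close>
lemma approximate_by_superposition:
  fixes K :: "'b::metric_space set" and \<phi> :: "nat \<Rightarrow> 'b \<Rightarrow> real" and f \<rho> :: "'b \<Rightarrow> real"
  assumes K: "compact K" and r: "continuous_on K \<rho>" and r01: "\<And>x. x \<in> K \<Longrightarrow> 0 \<le> \<rho> x \<and> \<rho> x \<le> 1"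
    and comp: "\<And>q. q < m \<Longrightarrow> compatible K \<rho> (\<phi> q)"
    and res: "\<And>\<epsilon>. \<epsilon> > 0 \<Longrightarrow> \<exists>\<gamma>>0. resolves K \<rho> m N \<epsilon> \<phi> \<gamma>"
    and f: "continuous_on K f" and ends: "\<And>x. x \<in> K \<Longrightarrow> \<rho> x = 0 \<or> \<rho> x = 1 \<Longrightarrow> f x = 0"
    and bound: "\<And>x. x \<in> K \<Longrightarrow> \<bar>f x\<bar> \<le> C" and "C \<ge> 0" "\<delta> > 0" "m > 0"
  shows "\<exists>g. (\<forall>q<m. continuous_on {0..1} (g q) \<and> g q 0 = 0 \<and> g q 1 = 0 \<and>
              (\<forall>t\<in>{0..1}. \<bar>g q t\<bar> \<le> C / m)) \<and>
             (\<forall>x\<in>K. \<bar>f x - (\<Sum>q<m. g q (\<phi> q x))\<bar> \<le> \<delta> + 2 * real N * C / m)"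
proof -
  obtain e1 where e1: "e1 > 0" "\<And>x. x \<in> K \<Longrightarrow> \<rho> x < e1 \<Longrightarrow> \<bar>f x\<bar> < \<delta> / 2"
    using small_near_zero_set[OF K r f, of "\<delta>/2"] r01 ends \<open>\<delta> > 0\<close> by auto
  have "\<exists>e>0. \<forall>x\<in>K. 1 - \<rho> x < e \<longrightarrow> \<bar>f x\<bar> < \<delta> / 2"
    by (rule small_near_zero_set[OF K _ f])
      (use r01 ends \<open>\<delta> > 0\<close> in \<open>auto intro!: continuous_intros r\<close>)
  then obtain e2 where e2: "e2 > 0" "\<And>x. x \<in> K \<Longrightarrow> 1 - \<rho> x < e2 \<Longrightarrow> \<bar>f x\<bar> < \<delta> / 2" by blast
  from compact_uniformly_continuous[OF f K, unfolded uniformly_continuous_on_def, rule_format, OF \<open>\<delta> > 0\<close>]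
  obtain e3 where e3: "e3 > 0" "\<And>x y. x \<in> K \<Longrightarrow> y \<in> K \<Longrightarrow> dist y x < e3 \<Longrightarrow> dist (f y) (f x) < \<delta>"
    by blast
  define \<epsilon> where "\<epsilon> = min e1 (min e2 e3)"
  have "\<epsilon> > 0" using e1 e2 e3 by (simp add: \<epsilon>_def)
  then obtain \<gamma> where "\<gamma> > 0" "resolves K \<rho> m N \<epsilon> \<phi> \<gamma>" using res by blast
  then obtain G where G: "\<And>x. x \<in> K \<Longrightarrow> card {q. q < m \<and> x \<notin> G q} \<le> N"
    "\<And>q. q < m \<Longrightarrow> G q \<subseteq> K \<and> resolves_on (G q) \<rho> \<epsilon> \<gamma> (\<phi> q)"
    unfolding resolves_def by blast
  have end_f: "\<bar>f x\<bar> < \<delta> / 2" if "x \<in> K" "\<rho> x < \<epsilon> \<or> \<rho> x > 1 - \<epsilon>" for x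
    using that e1(2)[of x] e2(2)[of x] by (auto simp: \<epsilon>_def)
  have near_f: "\<bar>f x - f y\<bar> \<le> \<delta>" if "x \<in> K" "y \<in> K" "near \<rho> \<epsilon> x y" for x y
  proof -
    from that(3) consider "dist x y < \<epsilon>" | "\<rho> x < \<epsilon>" "\<rho> y < \<epsilon>" | "\<rho> x > 1 - \<epsilon>" "\<rho> y > 1 - \<epsilon>"
      by (auto simp: near_def)
    then show ?thesis
    proof cases
      case 1
      then have "dist x y < e3" by (simp add: \<epsilon>_def)
      then show ?thesis using e3(2)[of y x] that by (simp add: dist_real_def)
    qed (use end_f[of x] end_f[of y] that in linarith)+
  qed
  have "\<exists>g. continuous_on {0..1} g \<and> g 0 = 0 \<and> g 1 = 0 \<and> (\<forall>t\<in>{0..1}. \<bar>g t\<bar> \<le> C / m) \<and>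
         (\<forall>x\<in>G q. \<bar>g (\<phi> q x) - f x / m\<bar> \<le> \<delta> / m)" if q: "q < m" for q
  proof (rule function_of_resolving_coordinate)
    show "resolves_on (G q) \<rho> \<epsilon> \<gamma> (\<phi> q)" using G(2)[OF q] by blast
    show "\<gamma> > 0" by fact
    have GK: "x \<in> K" if "x \<in> G q" for x using that G(2)[OF q] by auto
    show "0 \<le> \<phi> q x \<and> \<phi> q x \<le> 1" if "x \<in> G q" for x
      using comp[OF q] GK[OF that] by (auto simp: compatible_def)
    show "\<bar>f x / m - f y / m\<bar> \<le> \<delta> / m" if "x \<in> G q" "y \<in> G q" "near \<rho> \<epsilon> x y" for x y
    proof -
      have "\<bar>f x / m - f y / m\<bar> = \<bar>f x - f y\<bar> / m" by (simp flip: diff_divide_distrib)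
      then show ?thesis using near_f[OF GK GK] that by (simp add: divide_right_mono)
    qed
    show "\<bar>f x / m\<bar> \<le> \<delta> / m" if "x \<in> G q" "\<rho> x < \<epsilon> \<or> \<rho> x > 1 - \<epsilon>" for x
      using end_f[OF GK] that \<open>\<delta> > 0\<close> by (force intro!: divide_right_mono)
    show "\<bar>f x / m\<bar> \<le> C / m" if "x \<in> G q" for x
      using bound[OF GK[OF that]] by (simp add: divide_right_mono)
    show "C / m \<ge> 0" using \<open>C \<ge> 0\<close> by simp
  qed
  then obtain g where "\<And>q. q < m \<Longrightarrow> continuous_on {0..1} (g q) \<and> g q 0 = 0 \<and> g q 1 = 0 \<and>
        (\<forall>t\<in>{0..1}. \<bar>g q t\<bar> \<le> C / m) \<and> (\<forall>x\<in>G q. \<bar>g q (\<phi> q x) - f x / m\<bar> \<le> \<delta> / m)"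
    by metis
  then have g: "\<And>q. q < m \<Longrightarrow> continuous_on {0..1} (g q) \<and> g q 0 = 0 \<and> g q 1 = 0"
    "\<And>q t. q < m \<Longrightarrow> 0 \<le> t \<Longrightarrow> t \<le> 1 \<Longrightarrow> \<bar>g q t\<bar> \<le> C / m"
    "\<And>q x. q < m \<Longrightarrow> x \<in> G q \<Longrightarrow> \<bar>g q (\<phi> q x) - f x / m\<bar> \<le> \<delta> / m" by auto
  have "\<bar>f x - (\<Sum>q<m. g q (\<phi> q x))\<bar> \<le> \<delta> + 2 * real N * C / m" if x: "x \<in> K" for x
  proof -
    define Bad where "Bad = {q. q < m \<and> x \<notin> G q}"
    have Bad: "Bad \<subseteq> {..<m}" "card Bad \<le> N" using G(1)[OF x] by (auto simp: Bad_def)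
    have "f x - (\<Sum>q<m. g q (\<phi> q x)) = (\<Sum>q<m. f x / m - g q (\<phi> q x))"
      using \<open>m > 0\<close> by (simp add: sum_subtractf)
    also have "\<bar>\<dots>\<bar> \<le> (\<Sum>q<m. \<bar>f x / m - g q (\<phi> q x)\<bar>)" by (rule sum_abs)
    also have "\<dots> \<le> (\<Sum>q<m. \<delta> / m + (if q \<in> Bad then 2 * C / m else 0))"
    proof (rule sum_mono)
      fix q assume "q \<in> {..<m}"
      then have q: "q < m" by simp
      have "0 \<le> \<phi> q x \<and> \<phi> q x \<le> 1" using comp[OF q] x by (auto simp: compatible_def)
      then have 1: "\<bar>g q (\<phi> q x)\<bar> \<le> C / m" using g(2)[OF q] by blast
      have 2: "\<bar>f x / m\<bar> \<le> C / m" using bound[OF x] by (simp add: divide_right_mono)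
      have 3: "2 * C / m = C / m + C / m" "\<delta> / m > 0" using \<open>\<delta> > 0\<close> \<open>m > 0\<close> by simp_all
      show "\<bar>f x / m - g q (\<phi> q x)\<bar> \<le> \<delta> / m + (if q \<in> Bad then 2 * C / m else 0)"
      proof (cases "q \<in> Bad")
        case True
        then show ?thesis using abs_triangle_ineq4[of "f x / m" "g q (\<phi> q x)"] 1 2 3 by simp
      next
        case False
        then have "x \<in> G q" using q by (simp add: Bad_def)
        then show ?thesis using g(3)[OF q] False by (simp add: abs_minus_commute)
      qed
    qed
    also have "\<dots> = \<delta> + (\<Sum>q<m. if q \<in> Bad then 2 * C / m else 0)"
      using \<open>m > 0\<close> by (simp add: sum.distrib)
    also have "(\<Sum>q<m. if q \<in> Bad then 2 * C / m else 0) = (\<Sum>q\<in>{..<m} \<inter> Bad. 2 * C / m)"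
      by (rule sum.inter_restrict[symmetric]) simp
    also have "\<dots> = real (card Bad) * (2 * C / m)" using Bad(1) by (simp add: Int_absorb1)
    also have "\<delta> + \<dots> \<le> \<delta> + real N * (2 * C / m)"
      using Bad(2) \<open>C \<ge> 0\<close> by (intro add_left_mono mult_right_mono) auto
    finally show ?thesis by (simp add: mult_ac)
  qed
  with g show ?thesis by (intro exI[of _ g]) auto
qed

text \<open>
  As \<open>2 * N < m\<close>, the previous lemma with \<open>\<delta> = C / (2 * m)\<close>, where \<open>C\<close> is the current bound, shrinks the error by the factor
  \<open>\<theta> < 1\<close>.  The remainder again vanishes on the ends, so the step can be repeated, and the outer functions
  are summed as a geometrically convergent series.
\<close>
lemma superposition_on_compact_slice:
  fixes K :: "'b::metric_space set" and \<phi> :: "nat \<Rightarrow> 'b \<Rightarrow> real" and f \<rho> :: "'b \<Rightarrow> real"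
  assumes K: "compact K" and r: "continuous_on K \<rho>" and r01: "\<And>x. x \<in> K \<Longrightarrow> 0 \<le> \<rho> x \<and> \<rho> x \<le> 1"
    and comp: "\<And>q. q < m \<Longrightarrow> compatible K \<rho> (\<phi> q)"
    and res: "\<And>\<epsilon>. \<epsilon> > 0 \<Longrightarrow> \<exists>\<gamma>>0. resolves K \<rho> m N \<epsilon> \<phi> \<gamma>" and mN: "2 * N < m"
    and f: "continuous_on K f" and ends: "\<And>x. x \<in> K \<Longrightarrow> \<rho> x = 0 \<or> \<rho> x = 1 \<Longrightarrow> f x = 0"
  shows "\<exists>g. (\<forall>q<m. continuous_on {0..1} (g q) \<and> g q 0 = 0 \<and> g q 1 = 0) \<and>
             (\<forall>x\<in>K. f x = (\<Sum>q<m. g q (\<phi> q x)))"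
proof -
  have m: "m > 0" using mN by simp
  have phi01: "0 \<le> \<phi> q x \<and> \<phi> q x \<le> 1" "\<rho> x = 0 \<Longrightarrow> \<phi> q x = 0" "\<rho> x = 1 \<Longrightarrow> \<phi> q x = 1"
    if "q < m" "x \<in> K" for q x
    using comp[OF that(1)] that(2) by (auto simp: compatible_def)
  have phi_cont: "continuous_on K (\<phi> q)" if "q < m" for q using comp[OF that] by (simp add: compatible_def)
  \<comment> \<open>the summand 1/2 comes from the choice \<open>\<delta> = C / (2 * m)\<close>\<close>
  define \<theta> where "\<theta> = (2 * real N + 1/2) / m"
  have th: "0 < \<theta>" "\<theta> < 1"
  proof -
    have "2 * real N + 1 \<le> m" using mN by linarith
    then show "\<theta> < 1" using m by (simp add: \<theta>_def)
  qed (use m in \<open>simp add: \<theta>_def\<close>)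
  obtain C where C: "C > 0" "\<And>x. x \<in> K \<Longrightarrow> \<bar>f x\<bar> \<le> C"
    using compact_imp_bounded[OF compact_continuous_image[OF f K]] by (auto simp: bounded_pos)
  define ok where "ok k h \<longleftrightarrow> continuous_on K h \<and> (\<forall>x\<in>K. \<rho> x = 0 \<or> \<rho> x = 1 \<longrightarrow> h x = 0) \<and>
      (\<forall>x\<in>K. \<bar>h x\<bar> \<le> \<theta> ^ k * C)" for k and h :: "'b \<Rightarrow> real"
  define ap where "ap k h g \<longleftrightarrow> (\<forall>q<m. continuous_on {0..1} (g q) \<and> g q 0 = 0 \<and> g q 1 = 0 \<and>
      (\<forall>t\<in>{0..1}. \<bar>g q t\<bar> \<le> \<theta> ^ k * C / m)) \<and> ok (Suc k) (\<lambda>x. h x - (\<Sum>q<m. g q (\<phi> q x)))"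
    for k h and g :: "nat \<Rightarrow> real \<Rightarrow> real"
  have step: "\<exists>g. ap k h g" if "ok k h" for k h
  proof -
    have h: "continuous_on K h" "\<And>x. x \<in> K \<Longrightarrow> \<rho> x = 0 \<or> \<rho> x = 1 \<Longrightarrow> h x = 0"
      "\<And>x. x \<in> K \<Longrightarrow> \<bar>h x\<bar> \<le> \<theta> ^ k * C" using that by (auto simp: ok_def)
    have pos: "\<theta> ^ k * C > 0" "(\<theta> ^ k * C) / (2 * real m) > 0" using th C m by simp_all
    have "\<exists>g. (\<forall>q<m. continuous_on {0..1} (g q) \<and> g q 0 = 0 \<and> g q 1 = 0 \<and>
              (\<forall>t\<in>{0..1}. \<bar>g q t\<bar> \<le> \<theta> ^ k * C / m)) \<and>
             (\<forall>x\<in>K. \<bar>h x - (\<Sum>q<m. g q (\<phi> q x))\<bar> \<le> \<theta> ^ k * C / (2 * real m) + 2 * real N * (\<theta> ^ k * C) / m)"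
      by (rule approximate_by_superposition[OF K r r01 comp res h less_imp_le[OF pos(1)] pos(2) m])
    then obtain g where g: "\<And>q. q < m \<Longrightarrow> continuous_on {0..1} (g q) \<and> g q 0 = 0 \<and> g q 1 = 0 \<and>
              (\<forall>t\<in>{0..1}. \<bar>g q t\<bar> \<le> \<theta> ^ k * C / m)"
      "\<And>x. x \<in> K \<Longrightarrow> \<bar>h x - (\<Sum>q<m. g q (\<phi> q x))\<bar> \<le> \<theta> ^ k * C / (2 * real m) + 2 * real N * (\<theta> ^ k * C) / m"
      by blast
    have eq: "\<theta> ^ k * C / (2 * real m) + 2 * real N * (\<theta> ^ k * C) / m = \<theta> ^ Suc k * C"
      using m by (simp add: \<theta>_def field_simps)
    have "continuous_on K (\<lambda>x. g q (\<phi> q x))" if "q < m" for q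
      using g(1)[OF that] phi_cont[OF that] phi01(1)[OF that]
      by (intro continuous_on_compose2[of "{0..1}" "g q" K "\<phi> q"]) auto
    then have "continuous_on K (\<lambda>x. h x - (\<Sum>q<m. g q (\<phi> q x)))" using h(1) by (intro continuous_intros) auto
    moreover have "h x - (\<Sum>q<m. g q (\<phi> q x)) = 0" if "x \<in> K" "\<rho> x = 0 \<or> \<rho> x = 1" for x
    proof -
      have "g q (\<phi> q x) = 0" if "q < m" for q
        using g(1)[OF that] phi01(2,3)[OF that \<open>x \<in> K\<close>] \<open>\<rho> x = 0 \<or> \<rho> x = 1\<close> by auto
      then show ?thesis using h(2)[OF that] by simp
    qed
    ultimately have "ok (Suc k) (\<lambda>x. h x - (\<Sum>q<m. g q (\<phi> q x)))" using g(2) unfolding ok_def eq by blast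
    then show ?thesis using g(1) unfolding ap_def by blast
  qed
  define H where "H = rec_nat f (\<lambda>k h x. h x - (\<Sum>q<m. (SOME g. ap k h g) q (\<phi> q x)))"
  define G where "G k = (SOME g. ap k (H k) g)" for k
  have H0: "H 0 = f" and HS: "H (Suc k) = (\<lambda>x. H k x - (\<Sum>q<m. G k q (\<phi> q x)))" for k
    by (simp_all add: H_def G_def)
  have okH: "ok k (H k)" for k
  proof (induction k)
    case 0
    show ?case using f ends C by (auto simp: ok_def H0)
  next
    case (Suc k)
    then show ?case using someI_ex[OF step[OF Suc]] unfolding ap_def HS G_def by blast
  qed
  have apG: "ap k (H k) (G k)" for k unfolding G_def by (rule someI_ex[OF step[OF okH]])
  have Gb: "\<bar>G k q t\<bar> \<le> \<theta> ^ k * C / m" if "q < m" "t \<in> {0..1}" for k q t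
    using apG[of k] that by (simp add: ap_def)
  have summ: "summable (\<lambda>k. \<theta> ^ k * C / m)"
    by (intro summable_divide summable_mult2 summable_geometric) (use th in auto)
  define g where "g q t = (\<Sum>k. G k q t)" for q t
  have uni: "uniform_limit {0..1} (\<lambda>n t. \<Sum>k<n. G k q t) (g q) sequentially" if "q < m" for q
    unfolding g_def using Gb[OF that] by (intro Weierstrass_m_test[OF _ summ]) auto
  show ?thesis
  proof (intro exI[of _ g] conjI allI impI ballI)
    fix q assume q: "q < m"
    show "continuous_on {0..1} (g q)"
      using apG q by (intro uniform_limit_theorem[OF _ uni[OF q]] always_eventually allI continuous_intros)
        (auto simp: ap_def)
    show "g q 0 = 0" "g q 1 = 0" using apG q by (simp_all add: g_def ap_def)
  next
    fix x assume x: "x \<in> K"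
    have part: "(\<Sum>k<n. \<Sum>q<m. G k q (\<phi> q x)) = f x - H n x" for n
      by (induction n) (simp_all add: H0 HS)
    have sm: "summable (\<lambda>k. G k q (\<phi> q x))" if "q < m" for q
      by (rule summable_comparison_test'[OF summ]) (use Gb[OF that] phi01(1)[OF that x] in auto)
    have "(\<lambda>n. \<Sum>q<m. \<Sum>k<n. G k q (\<phi> q x)) \<longlonglongrightarrow> (\<Sum>q<m. g q (\<phi> q x))"
      unfolding g_def by (intro tendsto_sum summable_LIMSEQ sm) auto
    then have 1: "(\<lambda>n. f x - H n x) \<longlonglongrightarrow> (\<Sum>q<m. g q (\<phi> q x))"
      by (subst (asm) sum.swap) (simp add: part)
    have "(\<lambda>n. H n x) \<longlonglongrightarrow> 0"
    proof (rule Lim_null_comparison)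
      show "\<forall>\<^sub>F n in sequentially. norm (H n x) \<le> \<theta> ^ n * C" using okH x by (auto simp: ok_def)
      show "(\<lambda>n. \<theta> ^ n * C) \<longlonglongrightarrow> 0"
        by (intro tendsto_mult_left_zero LIMSEQ_realpow_zero) (use th in auto)
    qed
    then have "(\<lambda>n. f x - H n x) \<longlonglongrightarrow> f x - 0" by (intro tendsto_intros)
    then show "f x = (\<Sum>q<m. g q (\<phi> q x))" using LIMSEQ_unique[OF 1] by simp
  qed
qed

section \<open>Separating and proper functions on metrizable spaces\<close>

lemma continuous_map_realI:
  assumes "\<And>x \<epsilon>. x \<in> topspace X \<Longrightarrow> \<epsilon> > 0 \<Longrightarrow> \<exists>U. openin X U \<and> x \<in> U \<and> (\<forall>y\<in>U. \<bar>f y - f x\<bar> < \<epsilon>)"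
  shows "continuous_map X euclideanreal f"
  using assms
  by (simp add: Met_TC.continuous_map_to_metric dist_real_def abs_minus_commute flip: mtopology_is_euclidean)

lemma (in Metric_space) continuous_map_mdist_left:
  assumes "a \<in> M"
  shows "continuous_map mtopology euclideanreal (d a)"
proof (rule continuous_map_realI)
  fix x and \<epsilon> :: real assume x: "x \<in> topspace mtopology" and e: "\<epsilon> > 0"
  have "\<bar>d a y - d a x\<bar> < \<epsilon>" if "y \<in> mball x \<epsilon>" for y
  proof -
    have y: "y \<in> M" "d x y < \<epsilon>" using that by auto
    show ?thesis
      using triangle[of a x y] triangle[of a y x] x y assms commute[of x y] by auto
  qed
  then show "\<exists>U. openin mtopology U \<and> x \<in> U \<and> (\<forall>y\<in>U. \<bar>d a y - d a x\<bar> < \<epsilon>)"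
    using x e by (intro exI[of _ "mball x \<epsilon>"]) auto
qed

lemma continuous_map_real_suminf:
  assumes cont: "\<And>k. continuous_map X euclideanreal (u k)"
    and bound: "\<And>k x. x \<in> topspace X \<Longrightarrow> \<bar>u k x\<bar> \<le> w k" and w: "summable w"
  shows "continuous_map X euclideanreal (\<lambda>x. \<Sum>k. u k x)"
proof -
  have "uniform_limit (topspace X) (\<lambda>n x. \<Sum>k<n. u k x) (\<lambda>x. \<Sum>k. u k x) sequentially"
    by (rule Weierstrass_m_test[OF _ w]) (use bound in auto)
  then have "\<forall>\<^sub>F n in sequentially. \<forall>x\<in>topspace X. dist (\<Sum>k<n. u k x) (\<Sum>k. u k x) < \<epsilon>" if "\<epsilon> > 0" for \<epsilon>
    using that by (simp add: uniform_limit_iff)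
  moreover have "continuous_map X euclideanreal (\<lambda>x. \<Sum>k<n. u k x)" for n
    by (intro continuous_intros cont) auto
  ultimately show ?thesis
    using Met_TC.continuous_map_uniform_limit[of X "\<lambda>n x. \<Sum>k<n. u k x" sequentially "\<lambda>x. \<Sum>k. u k x"] by simp
qed

text \<open>Truncated distances to the points of a countable dense set.\<close>
lemma separating_sequence:
  assumes "separable_space X" "metrizable_space X"
  obtains e :: "nat \<Rightarrow> 'a \<Rightarrow> real" where "\<And>k. continuous_map X euclideanreal (e k)"
    "\<And>k x. x \<in> topspace X \<Longrightarrow> 0 \<le> e k x \<and> e k x \<le> 1"
    "\<And>x y. x \<in> topspace X \<Longrightarrow> y \<in> topspace X \<Longrightarrow> (\<And>k. e k x = e k y) \<Longrightarrow> x = y"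
proof -
  obtain M d where "Metric_space M d" and X: "X = Metric_space.mtopology M d"
    using assms(2) by (auto simp: metrizable_space_def)
  then interpret Metric_space M d by simp
  obtain C where C: "countable C" "C \<subseteq> M" "mtopology closure_of C = M"
    using assms(1) by (auto simp: separable_space_def X)
  show thesis
  proof (cases "M = {}")
    case True
    then have "topspace X = {}" using topspace_mtopology unfolding X by (simp only:)
    then show thesis using that[of "\<lambda>_ _. 0"] by auto
  next
    case False
    then have "C \<noteq> {}" using C(3) by auto
    define c where "c = from_nat_into C"
    have cM: "c k \<in> M" for k using from_nat_into[OF \<open>C \<noteq> {}\<close>] C(2) by (auto simp: c_def)
    show thesis
    proof (rule that[of "\<lambda>k x. min 1 (d (c k) x)"])
      show "continuous_map X euclideanreal (\<lambda>x. min 1 (d (c k) x))" for k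
        unfolding X by (intro continuous_intros continuous_map_mdist_left cM) auto
      fix x y assume xy: "x \<in> topspace X" "y \<in> topspace X" and eq: "\<And>k. min 1 (d (c k) x) = min 1 (d (c k) y)"
      then have M: "x \<in> M" "y \<in> M" by (auto simp: X)
      show "x = y"
      proof (rule ccontr)
        assume "x \<noteq> y"
        then have r: "min 1 (d x y) / 2 > 0" using M by auto
        have "x \<in> mtopology closure_of C" using C(3) M by simp
        with r have "\<exists>z\<in>C. z \<in> mball x (min 1 (d x y) / 2)" unfolding metric_closure_of by blast
        then obtain z where "z \<in> C" "d x z < min 1 (d x y) / 2" by auto
        moreover then obtain k where "z = c k" using from_nat_into_surj[OF C(1)] unfolding c_def by metis
        ultimately have k: "d (c k) x < min 1 (d x y) / 2" by (simp add: commute)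
        have "d x y \<le> d x (c k) + d (c k) y" using triangle M cM by blast
        then show False using k eq[of k] commute[of x "c k"] by (auto simp: min_def split: if_splits)
      qed
    qed auto
  qed
qed

text \<open>
  Countably many compact balls with centres in a countable dense set have interiors covering the space.  A weighted sum \<open>S\<close> of bump
  functions on these balls is positive everywhere, and the set where it is at least a given positive number lies in finitely many of the balls.
  Hence \<open>1 / S\<close> is proper.
\<close>
lemma proper_function_exists:
  assumes "separable_space X" "metrizable_space X" "locally_compact_space X"
  obtains \<rho> where "continuous_map X euclideanreal \<rho>" "\<And>r. compactin X {x\<in>topspace X. \<rho> x \<le> r}"
proof -
  obtain M d where "Metric_space M d" and X: "X = Metric_space.mtopology M d"
    using assms(2) by (auto simp: metrizable_space_def)
  then interpret Metric_space M d by simp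
  obtain C where C: "countable C" "C \<subseteq> M" "mtopology closure_of C = M"
    using assms(1) by (auto simp: separable_space_def X)
  define P where "P = {(c, q). c \<in> C \<and> q > (0::rat) \<and> compactin mtopology (mcball c (of_rat q))}"
  have P: "countable P"
    by (rule countable_subset[of _ "C \<times> UNIV"]) (use C(1) in \<open>auto simp: P_def\<close>)
  have cover: "\<exists>(c, q)\<in>P. d c y < of_rat q" if y: "y \<in> M" for y
  proof -
    obtain U K where UK: "openin mtopology U" "compactin mtopology K" "y \<in> U" "U \<subseteq> K"
      using assms(3) y by (auto simp: locally_compact_space_def X)
    then obtain r where r: "r > 0" "mball y r \<subseteq> U" by (auto simp: openin_mtopology)
    have "y \<in> mtopology closure_of C" "r / 4 > 0" using C(3) y r by auto
    then have "\<exists>c\<in>C. c \<in> mball y (r / 4)" unfolding metric_closure_of by blast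
    then obtain c where c: "c \<in> C" "d y c < r / 4" by auto
    obtain q where q: "r / 4 < of_rat q" "of_rat q < r / 2"
      using of_rat_dense[of "r/4" "r/2"] r by auto
    have "mcball c (of_rat q) \<subseteq> K"
    proof
      fix z assume "z \<in> mcball c (of_rat q)"
      then have z: "z \<in> M" "c \<in> M" "d c z \<le> of_rat q" by auto
      then have "d y z < r" using triangle[OF y z(2,1)] c q by linarith
      then show "z \<in> K" using UK r y z by auto
    qed
    then have "compactin mtopology (mcball c (of_rat q))" using closed_compactin[OF UK(2)] by simp
    moreover have "(0::real) < of_rat q" using q r by linarith
    ultimately have "(c, q) \<in> P" using c by (auto simp: P_def)
    moreover have "d c y < of_rat q" using c q by (simp add: commute)
    ultimately show ?thesis by blast
  qed
  show thesis
  proof (cases "M = {}")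
    case True
    then have "topspace X = {}" using topspace_mtopology unfolding X by (simp only:)
    then show thesis using that[of "\<lambda>_. 0"] by auto
  next
    case False
    then have ne: "P \<noteq> {}" using cover by auto
    define p where "p = from_nat_into P"
    have pP: "p i \<in> P" for i unfolding p_def by (rule from_nat_into[OF ne])
    define c where "c i = fst (p i)" for i
    define q where "q i = (of_rat (snd (p i)) :: real)" for i
    have cq: "c i \<in> M" "q i > 0" "compactin mtopology (mcball (c i) (q i))" for i
      using pP[of i] C(2) by (auto simp: P_def c_def q_def)
    \<comment> \<open>bumps, positive exactly on the open balls\<close>
    define u where "u i x = (1/2) ^ i * max 0 (1 - d (c i) x / q i)" for i x
    have u_nonneg: "u i x \<ge> 0" for i x by (simp add: u_def)
    have u_le: "u i x \<le> (1/2) ^ i" if "x \<in> M" for i x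
    proof -
      have "max 0 (1 - d (c i) x / q i) \<le> 1" using cq(2)[of i] by auto
      then show ?thesis by (simp add: u_def mult_left_le)
    qed
    have summ: "summable (\<lambda>i. (1/2::real) ^ i)" by (rule summable_geometric) simp
    have sum_u: "summable (\<lambda>i. u i x)" if "x \<in> M" for x
      by (rule summable_comparison_test'[OF summ]) (use u_le[OF that] u_nonneg in auto)
    define S where "S x = (\<Sum>i. u i x)" for x
    have S_cont: "continuous_map mtopology euclideanreal S"
      unfolding S_def
    proof (rule continuous_map_real_suminf[OF _ _ summ])
      show "continuous_map mtopology euclideanreal (u i)" for i
        unfolding u_def using cq(2)[of i]
        by (intro continuous_intros continuous_map_mdist_left cq) auto
    qed (use u_le u_nonneg in auto)
    have S_pos: "S x > 0" if x: "x \<in> M" for x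
    proof -
      obtain i where "d (c i) x < q i"
      proof -
        obtain a b where "(a, b) \<in> P" "d a x < of_rat b" using cover[OF x] by blast
        moreover then obtain i where "(a, b) = p i" using from_nat_into_surj[OF P] unfolding p_def by metis
        ultimately show thesis using that[of i] by (metis c_def q_def fst_conv snd_conv)
      qed
      then have "u i x > 0" using cq(2)[of i] by (auto simp: u_def less_max_iff_disj)
      then show ?thesis unfolding S_def using suminf_pos2[OF sum_u[OF x]] u_nonneg by blast
    qed
    have rho_cont: "continuous_map mtopology euclideanreal (\<lambda>x. 1 / S x)"
      by (intro continuous_intros S_cont) (use S_pos in force)+
    have "compactin mtopology {x\<in>M. 1 / S x \<le> r}" for r
    proof (cases "r > 0")
      case False
      have "r < 1 / S x" if "x \<in> M" for x
      proof -
        have "1 / S x > 0" using S_pos[OF that] by simp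
        then show ?thesis using False by linarith
      qed
      then have empty: "{x\<in>M. 1 / S x \<le> r} = {}" unfolding Collect_empty_eq using not_le by blast
      show ?thesis unfolding empty by simp
    next
      case True
      obtain N where N: "(1/2::real) ^ N < 1 / (2 * r)"
        using real_arch_pow_inv[of "1 / (2 * r)" "1/2"] True by auto
      let ?K = "\<Union>i\<in>{..<N}. mcball (c i) (q i)"
      have "compactin mtopology ?K" using cq(3) by (intro compactin_Union) auto
      moreover have "{x\<in>M. 1 / S x \<le> r} \<subseteq> ?K"
      proof clarsimp
        fix x assume x: "x \<in> M" "1 / S x \<le> r"
        show "\<exists>i\<in>{..<N}. c i \<in> M \<and> d (c i) x \<le> q i"
        proof (rule ccontr)
          assume "\<not> ?thesis"
          then have 0: "u i x = 0" if "i < N" for i using that cq[of i] by (force simp: u_def not_le max_def)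
          have "S x = (\<Sum>i. u (i + N) x) + (\<Sum>i<N. u i x)"
            unfolding S_def by (rule suminf_split_initial_segment[OF sum_u[OF x(1)]])
          also have "\<dots> = (\<Sum>i. u (i + N) x)" using 0 by simp
          also have "\<dots> \<le> (\<Sum>i. (1/2) ^ N * (1/2::real) ^ i)"
          proof (rule suminf_le)
            show "u (i + N) x \<le> (1/2) ^ N * (1/2) ^ i" for i
              using u_le[OF x(1), of "i + N"] by (simp add: power_add mult.commute)
            show "summable (\<lambda>i. u (i + N) x)" using sum_u[OF x(1)] by (rule summable_ignore_initial_segment)
            show "summable (\<lambda>i. (1/2) ^ N * (1/2::real) ^ i)" by (intro summable_mult summ)
          qed
          also have "\<dots> = (1/2) ^ N * 2" by (subst suminf_mult[OF summ]) (simp add: suminf_geometric)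
          also have "\<dots> < 1 / r" using N by (simp add: field_simps)
          finally have "S x * r < 1" using True by (simp add: field_simps)
          moreover have "1 \<le> r * S x" using x(2) S_pos[OF x(1)] by (simp add: field_simps)
          ultimately show False by (simp add: mult.commute)
        qed
      qed
      moreover have "closedin mtopology {x\<in>topspace mtopology. 1 / S x \<in> {..r}}"
        by (rule closedin_continuous_map_preimage[OF rho_cont]) simp
      ultimately show ?thesis using closed_compactin by fastforce
    qed
    then show thesis using that[of "\<lambda>x. 1 / S x"] rho_cont by (simp add: X)
  qed
qed

section \<open>Covering dimension of closed subspaces and homeomorphic images\<close>

lemma covering_dim_le_closed_subspace:
  assumes dim: "covering_dim_le X n" and Y: "closedin X Y"
  shows "covering_dim_le (subtopology X Y) n"
  unfolding covering_dim_le_def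
proof (intro allI impI)
  fix \<U> assume \<U>: "finite \<U> \<and> open_cover (subtopology X Y) \<U>"
  have YX: "Y \<subseteq> topspace X" using Y by (rule closedin_subset)
  have "\<forall>U\<in>\<U>. \<exists>W. openin X W \<and> U = W \<inter> Y"
    using \<U> by (auto simp: open_cover_def openin_subtopology)
  from bchoice[OF this] obtain W where W: "\<And>U. U \<in> \<U> \<Longrightarrow> openin X (W U) \<and> U = W U \<inter> Y" by blast
  have UY: "\<Union>\<U> = Y" using \<U> YX by (auto simp: open_cover_def)
  let ?U = "insert (topspace X - Y) (W ` \<U>)"
  have "open_cover X ?U"
    unfolding open_cover_def
  proof
    show "\<forall>U\<in>?U. openin X U" using W Y by auto
    have "\<Union>(W ` \<U>) \<subseteq> topspace X" using W openin_subset by (metis UN_least)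
    moreover have "Y \<subseteq> \<Union>(W ` \<U>)" unfolding UY[symmetric] using W by (intro Union_least) auto
    moreover have "\<Union>?U = (topspace X - Y) \<union> \<Union>(W ` \<U>)" by simp
    moreover have "(topspace X - Y) \<union> A = topspace X" if "A \<subseteq> topspace X" "Y \<subseteq> A" for A
      using that by blast
    ultimately show "\<Union>?U = topspace X" by simp
  qed
  then obtain \<V> where \<V>: "finite \<V>" "open_cover X \<V>" "\<forall>V\<in>\<V>. \<exists>U\<in>?U. V \<subseteq> U"
    "\<forall>x\<in>topspace X. card {V\<in>\<V>. x \<in> V} \<le> n + 1"
    using dim[unfolded covering_dim_le_def, rule_format, of ?U] \<U> by auto
  let ?V = "(\<lambda>V. V \<inter> Y) ` {V\<in>\<V>. V \<inter> Y \<noteq> {}}"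
  show "\<exists>\<V>. finite \<V> \<and> open_cover (subtopology X Y) \<V> \<and> (\<forall>V\<in>\<V>. \<exists>U\<in>\<U>. V \<subseteq> U) \<and>
          (\<forall>x\<in>topspace (subtopology X Y). card {V\<in>\<V>. x \<in> V} \<le> n + 1)"
  proof (intro exI[of _ ?V] conjI ballI)
    show "finite ?V" using \<V>(1) by auto
    have "\<Union>\<V> = topspace X" using \<V>(2) by (simp add: open_cover_def)
    then have "\<Union>?V = Y" using YX by blast
    moreover have "\<forall>V\<in>?V. openin (subtopology X Y) V"
      using \<V>(2) by (auto simp: open_cover_def openin_subtopology)
    ultimately show "open_cover (subtopology X Y) ?V"
      using YX by (simp add: open_cover_def Int_absorb1)
    fix V assume "V \<in> ?V"
    then obtain V' where V': "V' \<in> \<V>" "V = V' \<inter> Y" "V \<noteq> {}" by blast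
    from bspec[OF \<V>(3) V'(1)] obtain U where U: "U \<in> ?U" "V' \<subseteq> U" by (rule bexE)
    then have "U \<noteq> topspace X - Y" using V' by blast
    then obtain U' where "U' \<in> \<U>" "U = W U'" using U by blast
    then show "\<exists>U\<in>\<U>. V \<subseteq> U" using U V' W[of U'] by blast
  next
    fix x assume "x \<in> topspace (subtopology X Y)"
    then have x: "x \<in> topspace X" "x \<in> Y" by auto
    have "{V\<in>?V. x \<in> V} \<subseteq> (\<lambda>V. V \<inter> Y) ` {V\<in>\<V>. x \<in> V}" by auto
    then have "card {V\<in>?V. x \<in> V} \<le> card {V\<in>\<V>. x \<in> V}"
      using \<V>(1) surj_card_le[of "{V\<in>\<V>. x \<in> V}"] by auto
    then show "card {V\<in>?V. x \<in> V} \<le> n + 1" using \<V>(4) x by force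
  qed
qed

lemma covering_dim_le_homeomorphic_image:
  assumes dim: "covering_dim_le X n" and h: "homeomorphic_map X Y h"
  shows "covering_dim_le Y n"
proof -
  obtain k where hk: "homeomorphic_maps X Y h k" using h homeomorphic_map_maps by blast
  then have k: "homeomorphic_map Y X k" using homeomorphic_maps_map homeomorphic_maps_sym by blast
  have inv: "\<And>x. x \<in> topspace X \<Longrightarrow> k (h x) = x" "\<And>y. y \<in> topspace Y \<Longrightarrow> h (k y) = y"
    using hk by (auto simp: homeomorphic_maps_def)
  have onto: "h ` topspace X = topspace Y" "k ` topspace Y = topspace X"
    using h k homeomorphic_imp_surjective_map by blast+
  have push: "open_cover Q ((`) f ` \<U>)" if "open_cover P \<U>" "homeomorphic_map P Q f" for P :: "'c topology" and Q :: "'d topology" and f \<U>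
  proof -
    have "openin Q (f ` U)" if "U \<in> \<U>" for U
    proof -
      have "openin P U" using that \<open>open_cover P \<U>\<close> by (auto simp: open_cover_def)
      then show ?thesis using homeomorphic_map_openness[OF \<open>homeomorphic_map P Q f\<close> openin_subset] by blast
    qed
    moreover have "\<Union>\<U> = topspace P" using that(1) by (simp add: open_cover_def)
    then have "\<Union>((`) f ` \<U>) = f ` topspace P" by blast
    ultimately show ?thesis using homeomorphic_imp_surjective_map[OF that(2)] by (auto simp: open_cover_def)
  qed
  show ?thesis
    unfolding covering_dim_le_def
  proof (intro allI impI)
    fix \<U> assume \<U>: "finite \<U> \<and> open_cover Y \<U>"
    then have "finite ((`) k ` \<U>) \<and> open_cover X ((`) k ` \<U>)" using push[OF _ k] by simp
    from dim[unfolded covering_dim_le_def, rule_format, OF this]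
    obtain \<V> where \<V>': "finite \<V> \<and> open_cover X \<V> \<and> (\<forall>V\<in>\<V>. \<exists>U\<in>(`) k ` \<U>. V \<subseteq> U) \<and>
      (\<forall>x\<in>topspace X. card {V\<in>\<V>. x \<in> V} \<le> n + 1)" by (rule exE)
    note \<V> = \<V>'[THEN conjunct1] \<V>'[THEN conjunct2, THEN conjunct1]
      \<V>'[THEN conjunct2, THEN conjunct2, THEN conjunct1] \<V>'[THEN conjunct2, THEN conjunct2, THEN conjunct2]
    have VX: "V \<subseteq> topspace X" if "V \<in> \<V>" for V using \<V>(2) that by (auto simp: open_cover_def)
    have UY: "U \<subseteq> topspace Y" if "U \<in> \<U>" for U using \<U> that by (auto simp: open_cover_def)
    show "\<exists>\<V>. finite \<V> \<and> open_cover Y \<V> \<and> (\<forall>V\<in>\<V>. \<exists>U\<in>\<U>. V \<subseteq> U) \<and>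
          (\<forall>x\<in>topspace Y. card {V\<in>\<V>. x \<in> V} \<le> n + 1)"
    proof (intro exI[of _ "(`) h ` \<V>"] conjI ballI)
      show "finite ((`) h ` \<V>)" using \<V>(1) by simp
      show "open_cover Y ((`) h ` \<V>)" by (rule push[OF \<V>(2) h])
      fix V assume "V \<in> (`) h ` \<V>"
      then obtain V' where V': "V = h ` V'" "V' \<in> \<V>" by (rule imageE)
      from bspec[OF \<V>(3) V'(2)] obtain W where W: "W \<in> (`) k ` \<U>" "V' \<subseteq> W" by (rule bexE)
      from W(1) obtain U where U: "W = k ` U" "U \<in> \<U>" by (rule imageE)
      have "h ` V' \<subseteq> h ` k ` U" using W(2) U(1) by (simp add: image_mono)
      moreover have "h ` k ` U = U" using inv(2) UY[OF U(2)] by (force simp: image_image)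
      ultimately show "\<exists>U\<in>\<U>. V \<subseteq> U" using V' U by auto
    next
      fix y assume y: "y \<in> topspace Y"
      have "{V\<in>(`) h ` \<V>. y \<in> V} \<subseteq> (`) h ` {V\<in>\<V>. k y \<in> V}" using inv(1) VX by fastforce
      then have "card {V\<in>(`) h ` \<V>. y \<in> V} \<le> card {V\<in>\<V>. k y \<in> V}"
        using \<V>(1) surj_card_le[of "{V\<in>\<V>. k y \<in> V}"] by auto
      then show "card {V\<in>(`) h ` \<V>. y \<in> V} \<le> n + 1" using \<V>(4) y onto by force
    qed
  qed
qed

section \<open>Finite basic families\<close>

definition hilbert_map :: "(nat \<Rightarrow> 'a \<Rightarrow> real) \<Rightarrow> 'a \<Rightarrow> nat \<Rightarrow> real" where
  "hilbert_map e x = (\<lambda>k. e k x)"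

text \<open>
  A separating sequence embeds the compact set \<open>Y\<close> into the metric space of real sequences, to which the
  results on compact slices apply.
\<close>
lemma superposition_on_compact_subspace:
  fixes X :: "'a topology"
  assumes sep: "separable_space X" and met: "metrizable_space X"
    and Y: "compactin X Y" and dim: "covering_dim_le (subtopology X Y) n"
    and rho: "continuous_map (subtopology X Y) euclideanreal \<rho>"
    and r01: "\<And>x. x \<in> Y \<Longrightarrow> 0 \<le> \<rho> x \<and> \<rho> x \<le> 1" and m: "2 * (n + 1) < m"
  obtains \<phi> where "\<And>q. q < m \<Longrightarrow> continuous_map (subtopology X Y) euclideanreal (\<phi> q)"
    "\<And>q x. q < m \<Longrightarrow> x \<in> Y \<Longrightarrow> 0 \<le> \<phi> q x \<and> \<phi> q x \<le> 1 \<and> (\<rho> x = 0 \<longrightarrow> \<phi> q x = 0) \<and> (\<rho> x = 1 \<longrightarrow> \<phi> q x = 1)"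
    "\<And>f. continuous_map (subtopology X Y) euclideanreal f \<Longrightarrow>
         (\<And>x. x \<in> Y \<Longrightarrow> \<rho> x = 0 \<or> \<rho> x = 1 \<Longrightarrow> f x = 0) \<Longrightarrow>
         \<exists>g. (\<forall>q<m. continuous_on {0..1} (g q) \<and> g q 0 = (0::real) \<and> g q 1 = 0) \<and>
             (\<forall>x\<in>Y. f x = (\<Sum>q<m. g q (\<phi> q x)))"
proof -
  obtain e :: "nat \<Rightarrow> 'a \<Rightarrow> real" where e: "\<And>k. continuous_map X euclideanreal (e k)"
    "\<And>x y. x \<in> topspace X \<Longrightarrow> y \<in> topspace X \<Longrightarrow> (\<And>k. e k x = e k y) \<Longrightarrow> x = y"
    using separating_sequence[OF sep met] by metis
  let ?Y = "subtopology X Y" and ?h = "hilbert_map e"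
  have YX: "Y \<subseteq> topspace X" using Y by (rule compactin_subset_topspace)
  then have topY: "topspace ?Y = Y" by auto
  have "continuous_map X euclidean ?h"
    using e(1) by (simp add: hilbert_map_def continuous_map_componentwise_UNIV flip: euclidean_product_topology)
  then have cont: "continuous_map ?Y euclidean ?h" by (rule continuous_map_from_subtopology)
  define K where "K = ?h ` Y"
  have "compactin euclidean K"
    unfolding K_def by (rule image_compactin[OF _ cont]) (use Y in simp)
  then have K: "compact K" by simp
  have inj: "inj_on ?h Y"
    using e(2) YX by (auto simp: inj_on_def hilbert_map_def fun_eq_iff subset_iff)
  have hom: "homeomorphic_map ?Y (top_of_set K) ?h"
    using Y cont inj YX
    by (intro continuous_imp_homeomorphic_map)
      (auto simp: continuous_map_in_subtopology compactin_subspace K_def Hausdorff_space_subtopology Int_absorb1)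
  obtain k where hk: "homeomorphic_maps ?Y (top_of_set K) ?h k" using hom homeomorphic_map_maps by blast
  then have k_cont: "continuous_map (top_of_set K) ?Y k" and h_cont: "continuous_map ?Y (top_of_set K) ?h"
    and kh: "\<And>x. x \<in> Y \<Longrightarrow> k (?h x) = x" and hk': "\<And>z. z \<in> K \<Longrightarrow> ?h (k z) = z"
    using topY by (auto simp: homeomorphic_maps_def)
  have hY: "?h x \<in> K" if "x \<in> Y" for x using that by (simp add: K_def)
  have kK: "k z \<in> Y" if "z \<in> K" for z using that kh by (auto simp: K_def)
  have pull: "continuous_on K (\<lambda>z. f (k z))" if "continuous_map ?Y euclideanreal f" for f
    using continuous_map_compose[OF k_cont that] by (simp add: o_def)
  have "covering_dim_le (top_of_set K) n" by (rule covering_dim_le_homeomorphic_image[OF dim hom])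
  then obtain \<psi> where \<psi>: "\<And>q. q < m \<Longrightarrow> compatible K (\<lambda>z. \<rho> (k z)) (\<psi> q)"
    "\<And>\<epsilon>. \<epsilon> > 0 \<Longrightarrow> \<exists>\<gamma>>0. resolves K (\<lambda>z. \<rho> (k z)) m (n + 1) \<epsilon> \<psi> \<gamma>"
    using exists_resolving_functions[OF K _ pull[OF rho], of n m] r01 kK by blast
  show thesis
  proof (rule that[of "\<lambda>q x. \<psi> q (?h x)"])
    fix q assume q: "q < m"
    show "continuous_map ?Y euclideanreal (\<lambda>x. \<psi> q (?h x))"
      using continuous_map_compose[OF h_cont, of euclideanreal "\<psi> q"] \<psi>(1)[OF q]
      by (simp add: o_def compatible_def)
    show "0 \<le> \<psi> q (?h x) \<and> \<psi> q (?h x) \<le> 1 \<and> (\<rho> x = 0 \<longrightarrow> \<psi> q (?h x) = 0) \<and> (\<rho> x = 1 \<longrightarrow> \<psi> q (?h x) = 1)"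
      if "x \<in> Y" for x
      using \<psi>(1)[OF q] hY[OF that] kh[OF that] by (auto simp: compatible_def)
  next
    fix f assume f: "continuous_map ?Y euclideanreal f"
      and ends: "\<And>x. x \<in> Y \<Longrightarrow> \<rho> x = 0 \<or> \<rho> x = 1 \<Longrightarrow> f x = 0"
    have "\<exists>g. (\<forall>q<m. continuous_on {0..1} (g q) \<and> g q 0 = 0 \<and> g q 1 = 0) \<and>
             (\<forall>z\<in>K. f (k z) = (\<Sum>q<m. g q (\<psi> q z)))"
      by (rule superposition_on_compact_slice[OF K pull[OF rho] _ \<psi> _ pull[OF f]])
        (use r01 kK ends m in auto)
    then obtain g where g: "\<forall>q<m. continuous_on {0..1} (g q) \<and> g q 0 = 0 \<and> g q 1 = 0"
      "\<And>z. z \<in> K \<Longrightarrow> f (k z) = (\<Sum>q<m. g q (\<psi> q z))" by blast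
    have "f x = (\<Sum>q<m. g q (\<psi> q (?h x)))" if "x \<in> Y" for x
      using g(2)[OF hY[OF that]] kh[OF that] by simp
    with g(1) show "\<exists>g. (\<forall>q<m. continuous_on {0..1} (g q) \<and> g q 0 = (0::real) \<and> g q 1 = 0) \<and>
             (\<forall>x\<in>Y. f x = (\<Sum>q<m. g q (\<psi> q (?h x))))" by blast
  qed
qed

lemma continuous_map_by_slices:
  fixes F :: "int \<Rightarrow> 'a \<Rightarrow> real" and \<rho> :: "'a \<Rightarrow> real"
  assumes r: "continuous_map X euclideanreal \<rho>"
    and cont: "\<And>j::int. continuous_map (subtopology X {x\<in>topspace X. real_of_int j \<le> \<rho> x \<and> \<rho> x \<le> real_of_int j + 1}) euclideanreal (F j)"
    and agree: "\<And>j x. x \<in> topspace X \<Longrightarrow> \<rho> x = of_int (j + 1) \<Longrightarrow> F j x = F (j + 1) x"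
  shows "continuous_map X euclideanreal (\<lambda>x. F \<lfloor>\<rho> x\<rfloor> x)"
    and "\<And>j x. x \<in> topspace X \<Longrightarrow> real_of_int j \<le> \<rho> x \<Longrightarrow> \<rho> x \<le> real_of_int j + 1 \<Longrightarrow> F \<lfloor>\<rho> x\<rfloor> x = F j x"
proof -
  show eq: "F \<lfloor>\<rho> x\<rfloor> x = F j x" if "x \<in> topspace X" "real_of_int j \<le> \<rho> x" "\<rho> x \<le> real_of_int j + 1" for j x
  proof (cases "\<rho> x = real_of_int j + 1")
    case True
    then have "\<lfloor>\<rho> x\<rfloor> = j + 1" by linarith
    then show ?thesis using agree[OF that(1), of j] True by simp
  next
    case False
    then have "\<lfloor>\<rho> x\<rfloor> = j" using that by linarith
    then show ?thesis by simp
  qed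
  let ?T = "\<lambda>j::int. {x\<in>topspace X. real_of_int j \<le> \<rho> x \<and> \<rho> x \<le> real_of_int j + 1}"
  show "continuous_map X euclideanreal (\<lambda>x. F \<lfloor>\<rho> x\<rfloor> x)"
  proof (rule pasting_lemma_locally_finite[of X UNIV ?T _ F])
    fix x assume x: "x \<in> topspace X"
    let ?V = "{y\<in>topspace X. \<rho> y \<in> {\<rho> x - 1 <..< \<rho> x + 1}}"
    have "openin X ?V" by (rule openin_continuous_map_preimage[OF r]) simp
    moreover have "{j\<in>UNIV. ?T j \<inter> ?V \<noteq> {}} \<subseteq> {\<lfloor>\<rho> x\<rfloor> - 3 .. \<lfloor>\<rho> x\<rfloor> + 3}"
      by (auto simp: le_floor_iff) linarith+
    then have "finite {j\<in>UNIV. ?T j \<inter> ?V \<noteq> {}}" by (rule finite_subset) simp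
    ultimately show "\<exists>V. openin X V \<and> x \<in> V \<and> finite {j\<in>UNIV. ?T j \<inter> V \<noteq> {}}"
      using x by (intro exI[of _ ?V]) auto
    show "\<exists>j. j \<in> UNIV \<and> x \<in> ?T j \<and> F \<lfloor>\<rho> x\<rfloor> x = F j x"
      using x by (intro exI[of _ "\<lfloor>\<rho> x\<rfloor>"]) (simp add: floor_correct less_imp_le)
  next
    fix j :: int
    have "?T j = {x\<in>topspace X. \<rho> x \<in> {of_int j .. of_int j + 1}}" by auto
    then show "closedin X (?T j)" using closedin_continuous_map_preimage[OF r, of "{of_int j .. of_int j + 1}"] by simp
    show "continuous_map (subtopology X (?T j)) euclideanreal (F j)" by (rule cont)
  next
    fix i j x assume "x \<in> topspace X \<inter> ?T i \<inter> ?T j"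
    then show "F i x = F j x" using eq[of x i] eq[of x j] by simp
  qed
qed

text \<open>
  The function \<open>\<Phi> q\<close> is \<open>j + \<phi> j q\<close> on the slice between the levels \<open>j\<close> and \<open>j + 1\<close>.  The slices use disjoint parts
  of the real line up to endpoints, and all outer functions vanish at the endpoints, so the outer functions of the
  slices fit together to continuous functions on the whole line.
\<close>
lemma superposition_vanishing_on_integer_levels:
  fixes X :: "'a topology"
  assumes sep: "separable_space X" and met: "metrizable_space X"
    and dim: "covering_dim_le X n" and rho: "continuous_map X euclideanreal \<rho>"
    and proper: "\<And>r. compactin X {x\<in>topspace X. \<rho> x \<le> r}" and m: "2 * (n + 1) < m"
  obtains \<Phi> where "\<And>q. q < m \<Longrightarrow> continuous_map X euclideanreal (\<Phi> q)"
    "\<And>f. continuous_map X euclideanreal f \<Longrightarrow> (\<And>x. x \<in> topspace X \<Longrightarrow> \<rho> x \<in> \<int> \<Longrightarrow> f x = 0) \<Longrightarrow>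
         \<exists>g. (\<forall>q<m. continuous_on UNIV (g q)) \<and> (\<forall>x\<in>topspace X. f x = (\<Sum>q<m. g q (\<Phi> q x) :: real))"
proof -
  define Y where "Y j = {x\<in>topspace X. real_of_int j \<le> \<rho> x \<and> \<rho> x \<le> real_of_int j + 1}" for j
  have Y_closed: "closedin X (Y j)" for j
    using closedin_continuous_map_preimage[OF rho, of "{of_int j .. of_int j + 1}"] by (simp add: Y_def)
  have Y_compact: "compactin X (Y j)" for j
    by (rule closed_compactin[OF proper[of "of_int j + 1"] _ Y_closed]) (auto simp: Y_def)
  have YX: "Y j \<subseteq> topspace X" for j by (auto simp: Y_def)
  define good where "good j \<phi> \<longleftrightarrow> (\<forall>q<m. continuous_map (subtopology X (Y j)) euclideanreal (\<phi> q)) \<and>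
      (\<forall>q<m. \<forall>x\<in>Y j. 0 \<le> \<phi> q x \<and> \<phi> q x \<le> 1 \<and> (\<rho> x = j \<longrightarrow> \<phi> q x = 0) \<and> (\<rho> x = j + 1 \<longrightarrow> \<phi> q x = 1)) \<and>
      (\<forall>f. continuous_map (subtopology X (Y j)) euclideanreal f \<and> (\<forall>x\<in>Y j. \<rho> x = j \<or> \<rho> x = j + 1 \<longrightarrow> f x = 0) \<longrightarrow>
         (\<exists>g. (\<forall>q<m. continuous_on {0..1} (g q) \<and> g q 0 = (0::real) \<and> g q 1 = 0) \<and>
             (\<forall>x\<in>Y j. f x = (\<Sum>q<m. g q (\<phi> q x)))))" for j :: int and \<phi>
  have "\<exists>\<phi>. good j \<phi>" for j
  proof -
    obtain \<phi> where \<phi>: "\<And>q. q < m \<Longrightarrow> continuous_map (subtopology X (Y j)) euclideanreal (\<phi> q)"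
      "\<And>q x. q < m \<Longrightarrow> x \<in> Y j \<Longrightarrow> 0 \<le> \<phi> q x \<and> \<phi> q x \<le> 1 \<and> (\<rho> x - j = 0 \<longrightarrow> \<phi> q x = 0) \<and> (\<rho> x - j = 1 \<longrightarrow> \<phi> q x = 1)"
      "\<And>f. continuous_map (subtopology X (Y j)) euclideanreal f \<Longrightarrow>
         (\<And>x. x \<in> Y j \<Longrightarrow> \<rho> x - j = 0 \<or> \<rho> x - j = 1 \<Longrightarrow> f x = 0) \<Longrightarrow>
         \<exists>g. (\<forall>q<m. continuous_on {0..1} (g q) \<and> g q 0 = (0::real) \<and> g q 1 = 0) \<and>
             (\<forall>x\<in>Y j. f x = (\<Sum>q<m. g q (\<phi> q x)))"
    proof (rule superposition_on_compact_subspace[OF sep met Y_compact[of j] _ _ _ m])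
      show "covering_dim_le (subtopology X (Y j)) n"
        by (rule covering_dim_le_closed_subspace[OF dim Y_closed])
      show "continuous_map (subtopology X (Y j)) euclideanreal (\<lambda>x. \<rho> x - j)"
        by (intro continuous_intros continuous_map_from_subtopology rho) auto
    qed (auto simp: Y_def)
    show ?thesis
      unfolding good_def
    proof (intro exI[of _ \<phi>] conjI allI impI ballI)
      fix f assume f: "continuous_map (subtopology X (Y j)) euclideanreal f \<and> (\<forall>x\<in>Y j. \<rho> x = j \<or> \<rho> x = j + 1 \<longrightarrow> f x = 0)"
      show "\<exists>g. (\<forall>q<m. continuous_on {0..1} (g q) \<and> g q 0 = (0::real) \<and> g q 1 = 0) \<and>
             (\<forall>x\<in>Y j. f x = (\<Sum>q<m. g q (\<phi> q x)))"
      proof (rule \<phi>(3))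
        fix x assume "x \<in> Y j" "\<rho> x - j = 0 \<or> \<rho> x - j = 1"
        then have "\<rho> x = j \<or> \<rho> x = j + 1" by linarith
        then show "f x = 0" using f \<open>x \<in> Y j\<close> by blast
      qed (use f in blast)
    qed (use \<phi>(1,2) in auto)
  qed
  then obtain \<phi> where "\<And>j. good j (\<phi> j)" by metis
  then have \<phi>: "\<And>j q. q < m \<Longrightarrow> continuous_map (subtopology X (Y j)) euclideanreal (\<phi> j q)"
      "\<And>j q x. q < m \<Longrightarrow> x \<in> Y j \<Longrightarrow> 0 \<le> \<phi> j q x \<and> \<phi> j q x \<le> 1 \<and> (\<rho> x = j \<longrightarrow> \<phi> j q x = 0) \<and> (\<rho> x = j + 1 \<longrightarrow> \<phi> j q x = 1)"
      "\<And>j f. continuous_map (subtopology X (Y j)) euclideanreal f \<Longrightarrow> (\<forall>x\<in>Y j. \<rho> x = j \<or> \<rho> x = j + 1 \<longrightarrow> f x = 0) \<Longrightarrow>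
         (\<exists>g. (\<forall>q<m. continuous_on {0..1} (g q) \<and> g q 0 = (0::real) \<and> g q 1 = 0) \<and>
             (\<forall>x\<in>Y j. f x = (\<Sum>q<m. g q (\<phi> j q x))))"
    unfolding good_def by blast+
  define F where "F q j x = real_of_int j + \<phi> j q x" for q j x
  define \<Phi> where "\<Phi> q x = F q \<lfloor>\<rho> x\<rfloor> x" for q x
  have F_cont: "continuous_map (subtopology X (Y j)) euclideanreal (F q j)" if "q < m" for q j
    unfolding F_def by (intro continuous_intros \<phi>(1) that) auto
  have F_agree: "F q j x = F q (j + 1) x" if "q < m" "x \<in> topspace X" "\<rho> x = of_int (j + 1)" for q j x
  proof -
    have "x \<in> Y j" "x \<in> Y (j + 1)" using that by (auto simp: Y_def)
    then show ?thesis using \<phi>(2)[OF that(1), of x j] \<phi>(2)[OF that(1), of x "j+1"] that(3) by (simp add: F_def)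
  qed
  have Phi: "continuous_map X euclideanreal (\<Phi> q)" "\<And>j x. x \<in> Y j \<Longrightarrow> \<Phi> q x = F q j x" if "q < m" for q
    using continuous_map_by_slices[OF rho F_cont[OF that, unfolded Y_def] F_agree[OF that]]
    by (auto simp: \<Phi>_def[abs_def] Y_def)
  show thesis
  proof (rule that[of \<Phi>])
    fix f assume f: "continuous_map X euclideanreal f" and zero: "\<And>x. x \<in> topspace X \<Longrightarrow> \<rho> x \<in> \<int> \<Longrightarrow> f x = 0"
    have "\<exists>g. (\<forall>q<m. continuous_on {0..1} (g q) \<and> g q 0 = (0::real) \<and> g q 1 = 0) \<and>
             (\<forall>x\<in>Y j. f x = (\<Sum>q<m. g q (\<phi> j q x)))" for j
    proof (rule \<phi>(3))
      show "continuous_map (subtopology X (Y j)) euclideanreal f"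
        by (rule continuous_map_from_subtopology[OF f])
      have "\<rho> x \<in> \<int>" if "\<rho> x = j \<or> \<rho> x = j + 1" for x using that by auto
      then show "\<forall>x\<in>Y j. \<rho> x = j \<or> \<rho> x = j + 1 \<longrightarrow> f x = 0" using zero YX by blast
    qed
    then have "\<exists>g. \<forall>j. (\<forall>q<m. continuous_on {0..1} (g j q) \<and> g j q 0 = (0::real) \<and> g j q 1 = 0) \<and>
             (\<forall>x\<in>Y j. f x = (\<Sum>q<m. g j q (\<phi> j q x)))" by (intro choice allI)
    then obtain g where g: "\<And>j q. q < m \<Longrightarrow> continuous_on {0..1} (g j q) \<and> g j q 0 = (0::real) \<and> g j q 1 = 0"
      "\<And>j x. x \<in> Y j \<Longrightarrow> f x = (\<Sum>q<m. g j q (\<phi> j q x))"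
      by blast
    define G where "G q t = g \<lfloor>t\<rfloor> q (t - \<lfloor>t\<rfloor>)" for q and t :: real
    have G: "continuous_map euclideanreal euclideanreal (G q)"
      "\<And>j t. real_of_int j \<le> t \<Longrightarrow> t \<le> j + 1 \<Longrightarrow> G q t = g j q (t - j)" if q: "q < m" for q
    proof -
      have c: "continuous_map (subtopology euclideanreal {x \<in> topspace euclideanreal. real_of_int j \<le> x \<and> x \<le> real_of_int j + 1})
           euclideanreal (\<lambda>t. g j q (t - j))" for j
      proof -
        have "continuous_on {x. real_of_int j \<le> x \<and> x \<le> real_of_int j + 1} (\<lambda>t. g j q (t - real_of_int j))"
          by (rule continuous_on_compose2[OF g(1)[OF q, THEN conjunct1]])
            (auto intro!: continuous_on_diff continuous_on_id continuous_on_const)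
        then show ?thesis by simp
      qed
      have a: "g j q (t - j) = g (j + 1) q (t - (j + 1))" if "t = of_int (j + 1)" for j :: int and t :: real
        using g(1)[OF q] that by simp
      have i: "continuous_map euclideanreal euclideanreal (\<lambda>t::real. t)" by simp
      show "continuous_map euclideanreal euclideanreal (G q)"
        using continuous_map_by_slices(1)[OF i c a] by (simp add: G_def[abs_def])
      show "G q t = g j q (t - j)" if "real_of_int j \<le> t" "t \<le> j + 1" for j t
        using continuous_map_by_slices(2)[OF i c a, of t j] that by (simp add: G_def)
    qed
    show "\<exists>g. (\<forall>q<m. continuous_on UNIV (g q)) \<and> (\<forall>x\<in>topspace X. f x = (\<Sum>q<m. g q (\<Phi> q x)))"
    proof (intro exI[of _ G] conjI allI impI ballI)
      show "continuous_on UNIV (G q)" if "q < m" for q using G(1)[OF that] by simp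
      fix x assume x: "x \<in> topspace X"
      define j where "j = \<lfloor>\<rho> x\<rfloor>"
      have "real_of_int j \<le> \<rho> x \<and> \<rho> x \<le> real_of_int j + 1" unfolding j_def by linarith
      then have xY: "x \<in> Y j" using x by (simp add: Y_def)
      have "G q (\<Phi> q x) = g j q (\<phi> j q x)" if "q < m" for q
        using Phi(2)[OF that xY] G(2)[OF that, of j "\<Phi> q x"] \<phi>(2)[OF that xY] by (simp add: F_def)
      then show "f x = (\<Sum>q<m. G q (\<Phi> q x))" using g(2)[OF xY] by simp
    qed
  qed (rule Phi(1))
qed

lemma finite_basic_family_exists:
  fixes X :: "'a topology"
  assumes sep: "separable_space X" and met: "metrizable_space X"
    and lc: "locally_compact_space X" and fd: "finite_dimensional X"
  shows "\<exists>\<Phi>. finite \<Phi> \<and> basic_family X \<Phi>"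
proof -
  obtain n where dim: "covering_dim_le X n" using fd by (auto simp: finite_dimensional_def)
  obtain \<rho> where rho: "continuous_map X euclideanreal \<rho>" "\<And>r. compactin X {x\<in>topspace X. \<rho> x \<le> r}"
    using proper_function_exists[OF sep met lc] by blast
  define m where "m = 2 * n + 3"
  have m: "2 * (n + 1) < m" by (simp add: m_def)
  obtain P where P: "\<And>q. q < m \<Longrightarrow> continuous_map X euclideanreal (P q)"
    "\<And>f. continuous_map X euclideanreal f \<Longrightarrow> (\<And>x. x \<in> topspace X \<Longrightarrow> \<rho> x \<in> \<int> \<Longrightarrow> f x = 0) \<Longrightarrow>
         \<exists>g. (\<forall>q<m. continuous_on UNIV (g q)) \<and> (\<forall>x\<in>topspace X. f x = (\<Sum>q<m. g q (P q x) :: real))"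
    using superposition_vanishing_on_integer_levels[OF sep met dim rho m] by blast
  have rho2: "continuous_map X euclideanreal (\<lambda>x. \<rho> x + 1/2)" by (intro continuous_intros rho(1)) auto
  have "compactin X {x\<in>topspace X. \<rho> x + 1/2 \<le> r}" for r
    using rho(2)[of "r - 1/2"] by (simp add: le_diff_eq)
  then obtain Q where Q: "\<And>q. q < m \<Longrightarrow> continuous_map X euclideanreal (Q q)"
    "\<And>f. continuous_map X euclideanreal f \<Longrightarrow> (\<And>x. x \<in> topspace X \<Longrightarrow> \<rho> x + 1/2 \<in> \<int> \<Longrightarrow> f x = 0) \<Longrightarrow>
         \<exists>g. (\<forall>q<m. continuous_on UNIV (g q)) \<and> (\<forall>x\<in>topspace X. f x = (\<Sum>q<m. g q (Q q x) :: real))"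
    using superposition_vanishing_on_integer_levels[OF sep met dim rho2 _ m] by blast
  define \<psi> where "\<psi> i = restrict (if i \<le> m then P (i - 1) else Q (i - 1 - m)) (topspace X)" for i
  have psi: "\<psi> i \<in> cont_real X" if "i \<in> {1..m + m}" for i
  proof -
    have "continuous_map X euclideanreal (if i \<le> m then P (i - 1) else Q (i - 1 - m))"
      using that P(1)[of "i - 1"] Q(1)[of "i - 1 - m"] by auto
    then show ?thesis
      unfolding cont_real_def \<psi>_def
      by (auto intro: continuous_map_eq[of X euclideanreal "if i \<le> m then P (i - 1) else Q (i - 1 - m)"])
  qed
  have "basic_family X (\<psi> ` {1..m + m})"
    unfolding basic_family_def
  proof (intro conjI ballI)
    show "\<psi> ` {1..m + m} \<subseteq> cont_real X" using psi by blast
    fix f assume "f \<in> cont_real X"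
    then have f: "continuous_map X euclideanreal f" by (simp add: cont_real_def)
    have "continuous_map X euclideanreal (\<lambda>x. sin (pi * \<rho> x))" "continuous_map X euclideanreal (\<lambda>x. cos (pi * \<rho> x))"
      using continuous_map_compose[OF rho(1), of euclideanreal "\<lambda>t. sin (pi * t)"]
        continuous_map_compose[OF rho(1), of euclideanreal "\<lambda>t. cos (pi * t)"]
      by (simp_all add: o_def continuous_intros)
    then have f12: "continuous_map X euclideanreal (\<lambda>x. f x * sin (pi * \<rho> x) ^ 2)"
      "continuous_map X euclideanreal (\<lambda>x. f x * cos (pi * \<rho> x) ^ 2)"
      by (intro continuous_intros f; simp)+
    have z1: "f x * sin (pi * \<rho> x) ^ 2 = 0" if "\<rho> x \<in> \<int>" for x
      using sin_integer_2pi[of "\<rho> x / 2"] that sin_zero_iff_int2[of "pi * \<rho> x"]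
      by (auto elim!: Ints_cases simp: mult.commute)
    have z2: "f x * cos (pi * \<rho> x) ^ 2 = 0" if "\<rho> x + 1/2 \<in> \<int>" for x
    proof -
      from that obtain k where "\<rho> x + 1/2 = of_int k" by (rule Ints_cases)
      then have "pi * \<rho> x + pi / 2 = of_int k * pi" by (metis distrib_left mult.commute mult.right_neutral times_divide_eq_right)
      then have "sin (pi * \<rho> x + pi / 2) = 0" using sin_zero_iff_int2 by blast
      then show ?thesis by (simp add: sin_add)
    qed
    obtain g where g: "\<And>q. q < m \<Longrightarrow> continuous_on UNIV (g q)"
      "\<And>x. x \<in> topspace X \<Longrightarrow> f x * sin (pi * \<rho> x) ^ 2 = (\<Sum>q<m. g q (P q x))"
      using P(2)[OF f12(1) z1] by blast
    obtain h where h: "\<And>q. q < m \<Longrightarrow> continuous_on UNIV (h q)"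
      "\<And>x. x \<in> topspace X \<Longrightarrow> f x * cos (pi * \<rho> x) ^ 2 = (\<Sum>q<m. h q (Q q x))"
      using Q(2)[OF f12(2) z2] by blast
    let ?G = "\<lambda>i. if i \<le> m then g (i - 1) else h (i - 1 - m)"
    have cG: "?G i \<in> cont_real euclideanreal" if "i \<in> {1..m + m}" for i
      using that g(1)[of "i - 1"] h(1)[of "i - 1 - m"] by (auto simp: cont_real_def)
    have "f x = (\<Sum>i=1..m + m. ?G i (\<psi> i x))" if x: "x \<in> topspace X" for x
    proof -
      have "f x = f x * (sin (pi * \<rho> x) ^ 2 + cos (pi * \<rho> x) ^ 2)" by simp
      also have "\<dots> = (\<Sum>q<m. g q (P q x)) + (\<Sum>q<m. h q (Q q x))"
        by (simp only: distrib_left g(2)[OF x] h(2)[OF x])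
      also have "(\<Sum>q<m. g q (P q x)) = (\<Sum>i=1..m. ?G i (\<psi> i x))"
        by (rule sum.reindex_bij_witness[of _ "\<lambda>i. i - 1" Suc]) (auto simp: \<psi>_def x)
      also have "(\<Sum>q<m. h q (Q q x)) = (\<Sum>i=m + 1..m + m. ?G i (\<psi> i x))"
        by (rule sum.reindex_bij_witness[of _ "\<lambda>i. i - 1 - m" "\<lambda>q. q + m + 1"]) (auto simp: \<psi>_def x)
      also have "(\<Sum>i=1..m. ?G i (\<psi> i x)) + (\<Sum>i=m + 1..m + m. ?G i (\<psi> i x)) = (\<Sum>i=1..m + m. ?G i (\<psi> i x))"
        by (rule sum.ub_add_nat[symmetric]) simp
      finally show ?thesis .
    qed
    then show "\<exists>n::nat. \<exists>\<phi> g. (\<forall>i\<in>{1..n}. \<phi> i \<in> \<psi> ` {1..m + m} \<and> g i \<in> cont_real euclideanreal) \<and>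
        (\<forall>x\<in>topspace X. f x = (\<Sum>i=1..n. g i (\<phi> i x)))"
      using cG by (intro exI[of _ "m + m"] exI[of _ \<psi>] exI[of _ ?G]) auto
  qed
  then show ?thesis by blast
qed

section \<open>Small basic families share inner functions\<close>

lemma continuum_nat_sets: "|UNIV :: nat set set| =o continuum"
  using card_of_Pow_Func[of "UNIV :: nat set"] unfolding cexp_def by (simp add: Field_natLeq ctwo_def Field_card_of)

lemma infinite_continuum: "infinite (Field continuum)"
proof -
  have "infinite (UNIV :: nat set set)" by (simp add: Finite_Set.finite_set)
  then have "infinite (Func (Field natLeq) (Field ctwo))"
    using card_of_ordIso_finite[OF continuum_nat_sets[unfolded cexp_def]] by simp
  then show ?thesis unfolding cexp_def by (simp add: Field_card_of)
qed

lemma Card_order_continuum: "Card_order continuum"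
  by (rule Card_order_cexp)

lemma nat_less_continuum: "|UNIV :: nat set| <o continuum"
  using card_of_Pow[of "UNIV :: nat set"] continuum_nat_sets by (simp add: ordLess_ordIso_trans)

lemma card_of_lists_le:
  fixes \<Phi> :: "'c set"
  shows "|lists \<Phi>| \<le>o |\<Phi> <+> (UNIV :: nat set)|"
proof -
  let ?B = "\<Phi> <+> (UNIV :: nat set)"
  have inf: "infinite ?B" by simp
  have \<Phi>B: "|\<Phi>| \<le>o |?B|" by (rule card_of_Plus1)
  have len: "|{l\<in>lists \<Phi>. length l = n}| \<le>o |?B|" for n
  proof (induction n)
    case 0
    have "{l\<in>lists \<Phi>. length l = 0} = {[]}" by auto
    then show ?case using inf by (simp add: card_of_singl_ordLeq Plus_eq_empty_conv)
  next
    case (Suc n)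
    have eq: "{l\<in>lists \<Phi>. length l = Suc n} = (\<lambda>(x, l). x # l) ` (\<Phi> \<times> {l\<in>lists \<Phi>. length l = n})"
      by (auto simp: length_Suc_conv image_iff)
    have "|(\<lambda>(x, l). x # l) ` (\<Phi> \<times> {l\<in>lists \<Phi>. length l = n})| \<le>o |\<Phi> \<times> {l\<in>lists \<Phi>. length l = n}|"
      by (rule card_of_image)
    moreover have "|\<Phi> \<times> {l\<in>lists \<Phi>. length l = n}| \<le>o |?B|"
      by (rule card_of_Times_ordLeq_infinite_Field) (use inf \<Phi>B Suc in \<open>simp_all add: Field_card_of card_of_card_order_on\<close>)
    ultimately show ?case unfolding eq by (rule ordLeq_transitive)
  qed
  have "lists \<Phi> = (\<Union>n. {l\<in>lists \<Phi>. length l = n})" by auto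
  moreover have "|\<Union>n. {l\<in>lists \<Phi>. length l = n}| \<le>o |?B|"
    by (rule card_of_UNION_ordLeq_infinite[OF inf]) (use len in \<open>auto intro: card_of_Plus2\<close>)
  ultimately show ?thesis by simp
qed

text \<open>
  Were all fibres countable, the continuum many sets of natural numbers would be covered by too few countable sets.  Adding the
  natural numbers to \<open>\<Phi>\<close> treats finite and infinite \<open>\<Phi>\<close> at once.
\<close>
lemma uncountable_fibre:
  fixes L :: "nat set \<Rightarrow> 'c list"
  assumes less: "|\<Phi>| <o continuum" and L: "\<And>A. L A \<in> lists \<Phi>"
  obtains l where "l \<in> lists \<Phi>" "uncountable {A. L A = l}"
proof -
  let ?B = "\<Phi> <+> (UNIV :: nat set)"
  have inf: "infinite ?B" by simp
  have "\<exists>l\<in>lists \<Phi>. uncountable {A. L A = l}"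
  proof (rule ccontr)
    assume "\<not> ?thesis"
    then have "|{A. L A = l}| \<le>o |?B|" if "l \<in> lists \<Phi>" for l
      using that countable_card_of_nat[of "{A. L A = l}"] ordLeq_transitive card_of_Plus2 by blast
    then have "|\<Union>l\<in>lists \<Phi>. {A. L A = l}| \<le>o |?B|"
      by (intro card_of_UNION_ordLeq_infinite[OF inf card_of_lists_le]) auto
    moreover have "(\<Union>l\<in>lists \<Phi>. {A. L A = l}) = UNIV" using L by auto
    ultimately have "|UNIV :: nat set set| \<le>o |?B|" by simp
    moreover have "|?B| <o continuum"
      by (rule card_of_Plus_ordLess_infinite_Field[OF infinite_continuum Card_order_continuum less nat_less_continuum])
    ultimately show False
      using continuum_nat_sets by (meson not_ordLess_ordIso ordLeq_ordLess_trans)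
  qed
  then show thesis using that by blast
qed

text \<open>
  Only the inner functions can be shared; the outer functions \<open>h A i\<close> still depend on \<open>A\<close>.
\<close>
lemma representation_sharing_inner_functions:
  fixes X :: "'a topology" and f :: "nat set \<Rightarrow> 'a \<Rightarrow> real"
  assumes basic: "basic_family X \<Phi>" and less: "|\<Phi>| <o continuum"
    and f: "\<And>A. continuous_map X euclideanreal (f A)"
  obtains l \<A> h where "set l \<subseteq> cont_real X" "uncountable \<A>"
    "\<And>A i. A \<in> \<A> \<Longrightarrow> i < length l \<Longrightarrow> continuous_on UNIV (h A i :: real \<Rightarrow> real)"
    "\<And>A x. A \<in> \<A> \<Longrightarrow> x \<in> topspace X \<Longrightarrow> f A x = (\<Sum>i<length l. h A i ((l ! i) x))"
proof -
  define good where "good A p \<longleftrightarrow> fst p \<in> lists \<Phi> \<and> (\<forall>i<length (fst p). continuous_on UNIV (snd p i)) \<and>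
      (\<forall>x\<in>topspace X. f A x = (\<Sum>i<length (fst p). snd p i ((fst p ! i) x)))"
    for A and p :: "('a \<Rightarrow> real) list \<times> (nat \<Rightarrow> real \<Rightarrow> real)"
  have "\<exists>p. good A p" for A
  proof -
    have "restrict (f A) (topspace X) \<in> cont_real X"
      using f[of A] by (auto simp: cont_real_def intro: continuous_map_eq[of X euclideanreal "f A"])
    from basic[unfolded basic_family_def, THEN conjunct2, rule_format, OF this]
    obtain n :: nat and \<phi> g where "(\<forall>i\<in>{1..n}. \<phi> i \<in> \<Phi> \<and> g i \<in> cont_real euclideanreal) \<and>
        (\<forall>x\<in>topspace X. restrict (f A) (topspace X) x = (\<Sum>i=1..n. g i (\<phi> i x)))" by (elim exE)
    then have n: "\<And>i. i \<in> {1..n} \<Longrightarrow> \<phi> i \<in> \<Phi> \<and> g i \<in> cont_real euclideanreal"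
      "\<And>x. x \<in> topspace X \<Longrightarrow> restrict (f A) (topspace X) x = (\<Sum>i=1..n. g i (\<phi> i x))"
      by blast+
    let ?l = "map (\<lambda>i. \<phi> (Suc i)) [0..<n]"
    have "f A x = (\<Sum>i<n. g (Suc i) (\<phi> (Suc i) x))" if "x \<in> topspace X" for x
      using n(2)[OF that] that by (simp add: sum.atLeast1_atMost_eq)
    moreover have "continuous_on UNIV (g (Suc i))" if "i < n" for i
      using n(1)[of "Suc i"] that by (simp add: cont_real_def)
    ultimately show ?thesis
      using n(1) unfolding good_def by (intro exI[of _ "(?l, \<lambda>i. g (Suc i))"]) auto
  qed
  then obtain P where P: "\<And>A. good A (P A)" by metis
  define L where "L A = fst (P A)" for A
  define h where "h A = snd (P A)" for A
  note P' = P[unfolded good_def, folded L_def h_def]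
  have Lh: "\<And>A. L A \<in> lists \<Phi>" "\<And>A i. i < length (L A) \<Longrightarrow> continuous_on UNIV (h A i)"
      "\<And>A x. x \<in> topspace X \<Longrightarrow> f A x = (\<Sum>i<length (L A). h A i ((L A ! i) x))"
    using P' by simp_all
  obtain l where l: "l \<in> lists \<Phi>" "uncountable {A. L A = l}"
    by (rule uncountable_fibre[where L = L, OF less Lh(1)])
  show thesis
    by (rule that[of l "{A. L A = l}" h]) (use l Lh basic in \<open>auto simp: basic_family_def\<close>)
qed

section \<open>Local compactness\<close>

text \<open>
  Separability of the space of \<open>n\<close>-tuples of continuous functions on a compact interval, in the form that is needed: a tuple is
  determined up to \<open>\<eta>\<close> by a grid width and by rounded values on the grid, and there are
  only countably many such codes.
\<close>
lemma two_close_among_uncountably_many: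
  fixes h :: "'i \<Rightarrow> nat \<Rightarrow> real \<Rightarrow> real"
  assumes unc: "uncountable \<A>" and cont: "\<And>A i. A \<in> \<A> \<Longrightarrow> i < n \<Longrightarrow> continuous_on {-R..R} (h A i)"
    and "\<eta> > 0"
  shows "\<exists>A\<in>\<A>. \<exists>B\<in>\<A>. A \<noteq> B \<and> (\<forall>i<n. \<forall>t\<in>{-R..R}. \<bar>h A i t - h B i t\<bar> < \<eta>)"
proof -
  have ev: "\<forall>\<^sub>F N in sequentially. \<forall>s\<in>{-R..R}. \<forall>t\<in>{-R..R}. \<bar>s - t\<bar> \<le> 1 / (real N + 1) \<longrightarrow> \<bar>h A i s - h A i t\<bar> < \<eta> / 3"
    if "A \<in> \<A>" "i < n" for A i
  proof -
    have "\<eta> / 3 > 0" using \<open>\<eta> > 0\<close> by simp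
    from compact_uniformly_continuous[OF cont[OF that] compact_Icc, unfolded uniformly_continuous_on_def, rule_format, OF this]
    obtain e where e: "e > 0" "\<And>s t. s \<in> {-R..R} \<Longrightarrow> t \<in> {-R..R} \<Longrightarrow> dist s t < e \<Longrightarrow> dist (h A i s) (h A i t) < \<eta> / 3"
      by blast
    have "(\<lambda>N. 1 / (real N + 1)) \<longlonglongrightarrow> 0" by real_asymp
    then have "\<forall>\<^sub>F N in sequentially. 1 / (real N + 1) < e" using e(1) by (rule order_tendstoD)
    then show ?thesis
    proof eventually_elim
      case (elim N)
      show ?case using e(2) elim by (auto simp: dist_real_def)
    qed
  qed
  have "\<exists>N. \<forall>i<n. \<forall>s\<in>{-R..R}. \<forall>t\<in>{-R..R}. \<bar>s - t\<bar> \<le> 1 / (real N + 1) \<longrightarrow> \<bar>h A i s - h A i t\<bar> < \<eta> / 3"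
    if "A \<in> \<A>" for A
  proof -
    have "\<forall>\<^sub>F N in sequentially. \<forall>i\<in>{..<n}. \<forall>s\<in>{-R..R}. \<forall>t\<in>{-R..R}. \<bar>s - t\<bar> \<le> 1 / (real N + 1) \<longrightarrow> \<bar>h A i s - h A i t\<bar> < \<eta> / 3"
      by (rule eventually_ball_finite) (use ev[OF that] in auto)
    then show ?thesis by (auto dest!: eventually_happens)
  qed
  then obtain N where N: "\<And>A i s t. A \<in> \<A> \<Longrightarrow> i < n \<Longrightarrow> s \<in> {-R..R} \<Longrightarrow> t \<in> {-R..R} \<Longrightarrow>
      \<bar>s - t\<bar> \<le> 1 / (real (N A) + 1) \<Longrightarrow> \<bar>h A i s - h A i t\<bar> < \<eta> / 3" by metis
  define node where "node A j = real j / (real (N A) + 1) - R" for A j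
  define len where "len A = nat \<lfloor>2 * R * (real (N A) + 1)\<rfloor> + 1" for A
  \<comment> \<open>a grid of width \<open>1 / (N A + 1)\<close>, and the values at its nodes in multiples of \<open>\<eta> / 3\<close>\<close>
  define code where "code A = (N A, map (\<lambda>i. map (\<lambda>j. \<lfloor>h A i (node A j) * 3 / \<eta>\<rfloor>) [0..<len A]) [0..<n])" for A
  have "\<not> inj_on code \<A>"
    using unc countableI_type[of "code ` \<A>"] countable_image_inj_on by blast
  then obtain A B where AB: "A \<in> \<A>" "B \<in> \<A>" "A \<noteq> B" "code A = code B" by (auto simp: inj_on_def)
  have NAB: "N A = N B" using AB(4) by (simp add: code_def)
  then have nodeAB: "node A = node B" "len A = len B" by (auto simp: node_def len_def fun_eq_iff)
  have fl: "\<lfloor>h A i (node A j) * 3 / \<eta>\<rfloor> = \<lfloor>h B i (node A j) * 3 / \<eta>\<rfloor>" if "i < n" "j < len A" for i j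
    using AB(4) that unfolding code_def nodeAB by (auto simp: nodeAB)
  have "\<bar>h A i t - h B i t\<bar> < \<eta>" if i: "i < n" and t: "t \<in> {-R..R}" for i t
  proof -
    define M where "M = real (N A) + 1"
    have M: "M > 0" by (simp add: M_def)
    define j where "j = nat \<lfloor>(t + R) * M\<rfloor>"
    have tR: "0 \<le> (t + R) * M" "(t + R) * M \<le> 2 * R * M"
      using t M by (auto intro!: mult_right_mono)
    have j: "real j \<le> (t + R) * M" "(t + R) * M < real j + 1"
      using tR(1) unfolding j_def by linarith+
    have "j < len A" using tR unfolding j_def len_def M_def[symmetric] by linarith
    have s: "node A j = real j / M - R" by (simp add: node_def M_def)
    have jM: "real j / M \<le> t + R" "t + R < real j / M + 1 / M"
      using j M by (simp_all add: field_simps)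
    have sR: "node A j \<in> {-R..R}" using jM t M by (auto simp: s)
    have st: "\<bar>t - node A j\<bar> \<le> 1 / M" using jM by (auto simp: s)
    have "\<bar>h A i t - h A i (node A j)\<bar> < \<eta> / 3" using N[OF AB(1) i t sR] st by (simp add: M_def)
    moreover have "\<bar>h B i t - h B i (node A j)\<bar> < \<eta> / 3" using N[OF AB(2) i t sR] st by (simp add: M_def NAB)
    moreover have "\<bar>h A i (node A j) * 3 / \<eta> - h B i (node A j) * 3 / \<eta>\<bar> < 1"
      using fl[OF i \<open>j < len A\<close>] by linarith
    then have "\<bar>(h A i (node A j) - h B i (node A j)) * 3 / \<eta>\<bar> < 1" by (simp add: left_diff_distrib diff_divide_distrib)
    then have "\<bar>h A i (node A j) - h B i (node A j)\<bar> * 3 / \<eta> < 1"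
      using \<open>\<eta> > 0\<close> by (simp only: abs_mult abs_divide abs_numeral abs_of_pos)
    then have "\<bar>h A i (node A j) - h B i (node A j)\<bar> < \<eta> / 3"
      using \<open>\<eta> > 0\<close> by (simp add: divide_less_eq_1_pos)
    ultimately show ?thesis by linarith
  qed
  then show ?thesis using AB by blast
qed

text \<open>
  A ball that is not compact contains an infinite set without accumulation point.  As \<open>x0\<close> is not an accumulation point either, the set
  without \<open>x0\<close> keeps a positive distance from \<open>x0\<close>.
\<close>
lemma (in Metric_space) closed_discrete_sequence_in_annulus:
  assumes x0: "x0 \<in> M" and nlc: "\<not> compactin mtopology (mcball x0 r)" and r: "r > 0"
  shows "\<exists>\<epsilon> y. 0 < \<epsilon> \<and> \<epsilon> \<le> r \<and> inj (y :: nat \<Rightarrow> 'a) \<and> (\<forall>i. y i \<in> M \<and> \<epsilon> \<le> d x0 (y i) \<and> d x0 (y i) \<le> r) \<and>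
           mtopology derived_set_of (range y) = {}"
proof -
  have "mcball x0 r \<subseteq> M" by auto
  with nlc obtain T where T: "T \<subseteq> mcball x0 r" "infinite T" "mcball x0 r \<inter> mtopology derived_set_of T = {}"
    unfolding compactin_eq_Bolzano_Weierstrass by blast
  have "mtopology derived_set_of T \<subseteq> mtopology derived_set_of (mcball x0 r)"
    using T(1) by (rule derived_set_of_mono)
  also have "\<dots> \<subseteq> mcball x0 r" using closedin_contains_derived_set[of mtopology "mcball x0 r"] by simp
  finally have der: "mtopology derived_set_of T = {}" using T(3) by blast
  then have "x0 \<notin> mtopology derived_set_of T" by simp
  then obtain e where e: "e > 0" "\<And>y. y \<in> T \<Longrightarrow> y \<noteq> x0 \<Longrightarrow> y \<notin> mball x0 e"
    using x0 unfolding metric_derived_set_of by auto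
  have "infinite (T - {x0})" using T(2) by simp
  then obtain y :: "nat \<Rightarrow> 'a" where y: "inj y" "range y \<subseteq> T - {x0}"
    using infinite_countable_subset by blast
  have yi: "y i \<in> M" "e \<le> d x0 (y i)" "d x0 (y i) \<le> r" for i
  proof -
    have "y i \<in> T" "y i \<noteq> x0" using y(2) by auto
    then show "y i \<in> M" "e \<le> d x0 (y i)" "d x0 (y i) \<le> r" using e(2)[of "y i"] T(1) x0 by auto
  qed
  have "mtopology derived_set_of (range y) \<subseteq> mtopology derived_set_of T"
    using y(2) by (intro derived_set_of_mono) auto
  then have "mtopology derived_set_of (range y) = {}" using der by simp
  moreover have "e \<le> r" using yi(2,3)[of 0] by linarith
  ultimately show ?thesis using e(1) y(1) yi by blast
qed

text \<open>
  Choose closed discrete sequences in disjoint annuli that shrink to \<open>x0\<close>, as in a metric fan.  The function for a set \<open>A\<close> of indices takes on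
  each sequence the value \<open>d x0 x\<close> at the indices in \<open>A\<close> and 0 at the others; it is continuous at \<open>x0\<close> because
  \<open>d x0\<close> tends to 0 there.  On every annulus, different sets \<open>A\<close> give functions that differ by
  at least the inner radius.
\<close>
lemma separated_family_if_not_locally_compact:
  fixes X :: "'a topology"
  assumes met: "metrizable_space X" and nlc: "\<not> locally_compact_space X"
  obtains x0 and f :: "nat set \<Rightarrow> 'a \<Rightarrow> real" where "x0 \<in> topspace X" "\<And>A. continuous_map X euclideanreal (f A)"
    "\<And>U. openin X U \<Longrightarrow> x0 \<in> U \<Longrightarrow> \<exists>\<delta>>0. \<forall>A B. A \<noteq> B \<longrightarrow> (\<exists>x\<in>U. \<delta> \<le> \<bar>f A x - f B x\<bar>)"
proof -
  obtain M d where "Metric_space M d" and X: "X = Metric_space.mtopology M d"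
    using met by (auto simp: metrizable_space_def)
  then interpret Metric_space M d by simp
  obtain x0 where x0: "x0 \<in> M" and no: "\<And>U K. openin mtopology U \<Longrightarrow> compactin mtopology K \<Longrightarrow> x0 \<in> U \<Longrightarrow> \<not> U \<subseteq> K"
    using nlc by (auto simp: locally_compact_space_def X)
  have ncpt: "\<not> compactin mtopology (mcball x0 r)" if "r > 0" for r
    using no[of "mball x0 r" "mcball x0 r"] that x0 mball_subset_mcball by auto
  have "\<exists>p. \<forall>r>0. 0 < fst (p r) \<and> fst (p r) \<le> r \<and> inj (snd (p r) :: nat \<Rightarrow> 'a) \<and>
      (\<forall>i. snd (p r) i \<in> M \<and> fst (p r) \<le> d x0 (snd (p r) i) \<and> d x0 (snd (p r) i) \<le> r) \<and>
      mtopology derived_set_of (range (snd (p r))) = {}"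
    by (rule choice) (use closed_discrete_sequence_in_annulus[OF x0 ncpt] in force)
  then obtain p where p: "\<And>r. r > 0 \<Longrightarrow> 0 < fst (p r) \<and> fst (p r) \<le> r \<and> inj (snd (p r) :: nat \<Rightarrow> 'a) \<and>
      (\<forall>i. snd (p r) i \<in> M \<and> fst (p r) \<le> d x0 (snd (p r) i) \<and> d x0 (snd (p r) i) \<le> r) \<and>
      mtopology derived_set_of (range (snd (p r))) = {}" by blast
  \<comment> \<open>the outer radius of the next annulus is half the inner radius of the current one\<close>
  define r where "r = rec_nat 1 (\<lambda>_ r. fst (p r) / 2)"
  define \<epsilon> where "\<epsilon> k = fst (p (r k))" for k
  define z where "z k = snd (p (r k))" for k
  have r0: "r 0 = 1" and rS: "r (Suc k) = \<epsilon> k / 2" for k by (simp_all add: r_def \<epsilon>_def)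
  have rpos: "r k > 0" for k
  proof (induction k)
    case (Suc k)
    then show ?case using p[of "r k"] by (simp add: rS \<epsilon>_def)
  qed (simp add: r0)
  have eps: "0 < \<epsilon> k" "\<epsilon> k \<le> r k" for k using p[OF rpos[of k]] by (auto simp: \<epsilon>_def)
  have z: "inj (z k)" "z k i \<in> M" "\<epsilon> k \<le> d x0 (z k i)" "d x0 (z k i) \<le> r k"
    "mtopology derived_set_of (range (z k)) = {}" for k i
    using p[OF rpos[of k]] by (auto simp: \<epsilon>_def z_def)
  have rdec: "r (k + j) \<le> r k / 2 ^ j" for k j
  proof (induction j)
    case (Suc j)
    then show ?case using eps(2)[of "k + j"] by (simp add: rS)
  qed simp
  have rlim: "\<exists>k. r k < e" if "e > 0" for e
  proof -
    obtain k where "(1/2::real) ^ k < e" using real_arch_pow_inv[of e "1/2"] \<open>e > 0\<close> by auto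
    then show ?thesis using rdec[of 0 k] by (intro exI[of _ k]) (simp add: r0 power_one_over)
  qed
  have r_eps: "r l < \<epsilon> k" if "k < l" for k l
  proof -
    have "r l \<le> r (Suc k) / 2 ^ (l - Suc k)" using rdec[of "Suc k" "l - Suc k"] that by simp
    also have "\<dots> \<le> r (Suc k)" using rpos[of "Suc k"] by (simp add: divide_le_eq_1_pos field_simps)
    also have "\<dots> < \<epsilon> k" using eps(1)[of k] by (simp add: rS)
    finally show ?thesis .
  qed
  have r_mono: "r l \<le> r k" if "k \<le> l" for k l
    using r_eps[of k l] eps(2)[of k] that by (cases "k = l") auto
  have inj2: "k = l \<and> i = j" if "z k i = z l j" for k l i j
  proof -
    have "\<not> k < l" using r_eps[of k l] z(3)[of k i] z(4)[of l j] that by fastforce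
    moreover have "\<not> l < k" using r_eps[of l k] z(3)[of l j] z(4)[of k i] that by fastforce
    ultimately have "k = l" by simp
    then show ?thesis using z(1)[of k] that by (auto simp: inj_on_def)
  qed
  define Z where "Z = range (\<lambda>(k, i). z k i)"
  have ZM: "Z \<subseteq> M" using z(2) by (auto simp: Z_def)
  have closed: "closedin mtopology (insert x0 Z')" if "Z' \<subseteq> Z" for Z'
    unfolding closedin_def
  proof
    show "insert x0 Z' \<subseteq> topspace mtopology" using that ZM x0 by auto
    show "openin mtopology (topspace mtopology - insert x0 Z')"
    proof (subst openin_subopen, intro ballI)
      fix x assume "x \<in> topspace mtopology - insert x0 Z'"
      then have x: "x \<in> M" "x \<noteq> x0" "x \<notin> Z'" by auto
      define s where "s = d x0 x / 2"
      have s: "s > 0" using x x0 by (simp add: s_def)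
      obtain K where K: "r K < s" using rlim[OF s] by blast
      have cl: "closedin mtopology (Z' \<inter> range (z k))" for k
      proof -
        have "mtopology derived_set_of (Z' \<inter> range (z k)) \<subseteq> mtopology derived_set_of range (z k)"
          by (intro derived_set_of_mono) auto
        then show ?thesis using z(2,5)[of k] by (auto simp: closedin_contains_derived_set)
      qed
      let ?O = "mball x s - (\<Union>k\<in>{..<K}. Z' \<inter> range (z k))"
      have "openin mtopology ?O" by (intro openin_diff closedin_Union) (use cl in auto)
      moreover have "x \<in> ?O" using x s by auto
      moreover have "x0 \<notin> ?O"
        using s x0 x by (auto simp: s_def commute)
      moreover have "y \<notin> ?O" if y: "y \<in> Z'" for y
      proof
        assume O: "y \<in> ?O"
        obtain k i where ki: "y = z k i" using y \<open>Z' \<subseteq> Z\<close> by (auto simp: Z_def)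
        then have "k \<ge> K" using O y by (auto simp: not_less[symmetric])
        then have "d x0 y < s" using z(4)[of k i] r_mono[of K k] K ki by simp
        moreover have "d x y < s" "y \<in> M" using O by auto
        ultimately have "d x0 x < s + s" using triangle[of x0 y x] x0 x(1) commute[of x y] by simp
        then show False by (simp add: s_def)
      qed
      ultimately show "\<exists>T. openin mtopology T \<and> x \<in> T \<and> T \<subseteq> topspace mtopology - insert x0 Z'"
        by (intro exI[of _ ?O]) auto
    qed
  qed
  define S where "S = insert x0 Z"
  \<comment> \<open>continuous on \<open>S\<close>: all points of \<open>S\<close> other than \<open>x0\<close> are isolated in \<open>S\<close>\<close>
  define F where "F A x = (if \<exists>k. \<exists>i\<in>A. x = z k i then d x0 x else 0)" for A x
  have F_abs: "\<bar>F A x\<bar> \<le> d x0 x" for A x by (simp add: F_def)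
  have F_x0: "F A x0 = 0" for A using x0 by (simp add: F_def)
  have F_cont: "continuous_map (subtopology mtopology S) euclideanreal (F A)" for A
  proof (rule continuous_map_realI)
    fix x and e :: real assume x: "x \<in> topspace (subtopology mtopology S)" and e: "e > 0"
    then have xS: "x \<in> S" "x \<in> M" by auto
    show "\<exists>U. openin (subtopology mtopology S) U \<and> x \<in> U \<and> (\<forall>y\<in>U. \<bar>F A y - F A x\<bar> < e)"
    proof (cases "x = x0")
      case True
      have "openin (subtopology mtopology S) (mball x0 e \<inter> S)" by (auto simp: openin_subtopology)
      moreover have "\<bar>F A y - F A x\<bar> < e" if "y \<in> mball x0 e \<inter> S" for y
        using F_abs[of A y] F_x0 that True by auto
      ultimately show ?thesis using True e xS by (intro exI[of _ "mball x0 e \<inter> S"]) auto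
    next
      case False
      have "openin mtopology (M - insert x0 (Z - {x}))"
        using closed[of "Z - {x}"] by (auto simp: closedin_def)
      then have "openin (subtopology mtopology S) ((M - insert x0 (Z - {x})) \<inter> S)" by (auto simp: openin_subtopology)
      moreover have "(M - insert x0 (Z - {x})) \<inter> S = {x}" using False xS by (auto simp: S_def)
      ultimately show ?thesis using e by (intro exI[of _ "{x}"]) auto
    qed
  qed
  have "\<exists>g. continuous_map X euclideanreal g \<and> (\<forall>x\<in>S. g x = F A x)" for A
  proof -
    have "closedin X S" using closed[of Z] by (simp add: S_def X)
    moreover have "continuous_map (subtopology X S) euclideanreal (F A)" using F_cont by (simp add: X)
    ultimately show ?thesis
      using Tietze_extension_realinterval[OF metrizable_imp_normal_space[OF met], of S UNIV "F A"]
      by (metis UNIV_not_empty is_interval_univ subset_UNIV)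
  qed
  then obtain f where f: "\<And>A. continuous_map X euclideanreal (f A)" "\<And>A x. x \<in> S \<Longrightarrow> f A x = F A x" by metis
  show thesis
  proof (rule that[of x0 f])
    show "x0 \<in> topspace X" using x0 by (simp add: X)
    fix U assume "openin X U" "x0 \<in> U"
    then obtain e where e: "e > 0" "mball x0 e \<subseteq> U" by (auto simp: X openin_mtopology)
    obtain k where k: "r k < e" using rlim[OF e(1)] by blast
    have zU: "z k i \<in> U" for i using z(2,4)[of k i] k x0 e(2) by (auto simp: subset_iff)
    have Fz: "F A (z k i) = (if i \<in> A then d x0 (z k i) else 0)" for A i
    proof -
      have "(\<exists>l. \<exists>j\<in>A. z k i = z l j) \<longleftrightarrow> i \<in> A" using inj2 by blast
      then show ?thesis by (simp add: F_def)
    qed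
    have "\<exists>x\<in>U. \<epsilon> k \<le> \<bar>f A x - f B x\<bar>" if AB: "A \<noteq> B" for A B
    proof -
      obtain i where i: "i \<in> A \<longleftrightarrow> i \<notin> B" using AB by blast
      have "z k i \<in> S" by (auto simp: S_def Z_def)
      then have "\<epsilon> k \<le> \<bar>f A (z k i) - f B (z k i)\<bar>"
        using i z(3)[of k i] eps(1)[of k] by (auto simp: f(2) Fz)
      then show ?thesis using zU by blast
    qed
    then show "\<exists>\<delta>>0. \<forall>A B. A \<noteq> B \<longrightarrow> (\<exists>x\<in>U. \<delta> \<le> \<bar>f A x - f B x\<bar>)" using eps(1) by blast
  qed (rule f(1))
qed

text \<open>
  Uncountably many functions of the separated family would be represented through one tuple \<open>l\<close>.  Near \<open>x0\<close> the members of \<open>l\<close>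
  take values in a compact interval, on which two of the tuples of outer functions are closer than the separation allows.
\<close>
lemma locally_compact_if_small_basic_family:
  fixes X :: "'a topology"
  assumes met: "metrizable_space X" and basic: "basic_family X \<Phi>" and less: "|\<Phi>| <o continuum"
  shows "locally_compact_space X"
proof (rule ccontr)
  assume "\<not> locally_compact_space X"
  then obtain x0 and f :: "nat set \<Rightarrow> 'a \<Rightarrow> real" where x0: "x0 \<in> topspace X"
    and f: "\<And>A. continuous_map X euclideanreal (f A)"
    and sep: "\<And>U. openin X U \<Longrightarrow> x0 \<in> U \<Longrightarrow> \<exists>\<delta>>0. \<forall>A B. A \<noteq> B \<longrightarrow> (\<exists>x\<in>U. \<delta> \<le> \<bar>f A x - f B x\<bar>)"
    using separated_family_if_not_locally_compact[OF met] by metis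
  obtain l \<A> h where l: "set l \<subseteq> cont_real X" and unc: "uncountable \<A>"
    and h: "\<And>A i. A \<in> \<A> \<Longrightarrow> i < length l \<Longrightarrow> continuous_on UNIV (h A i :: real \<Rightarrow> real)"
    and rep: "\<And>A x. A \<in> \<A> \<Longrightarrow> x \<in> topspace X \<Longrightarrow> f A x = (\<Sum>i<length l. h A i ((l ! i) x))"
    by (rule representation_sharing_inner_functions[where f = f, OF basic less f]) (rule that)
  have cl: "continuous_map X euclideanreal (l ! i)" if "i < length l" for i
    using subsetD[OF l nth_mem[OF that]] by (simp add: cont_real_def)
  define U where "U = (\<Inter>i\<in>{..<length l}. {x\<in>topspace X. (l ! i) x \<in> {(l ! i) x0 - 1<..<(l ! i) x0 + 1}}) \<inter> topspace X"
  have "openin X {x\<in>topspace X. (l ! i) x \<in> {(l ! i) x0 - 1<..<(l ! i) x0 + 1}}" if "i < length l" for i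
    by (rule openin_continuous_map_preimage[OF cl[OF that]]) simp
  then have "openin X U" unfolding U_def by (intro openin_INT) auto
  moreover have "x0 \<in> U" using x0 by (auto simp: U_def)
  ultimately have "\<exists>\<delta>>0. \<forall>A B. A \<noteq> B \<longrightarrow> (\<exists>x\<in>U. \<delta> \<le> \<bar>f A x - f B x\<bar>)" by (rule sep)
  then obtain \<delta> where "\<delta> > 0 \<and> (\<forall>A B. A \<noteq> B \<longrightarrow> (\<exists>x\<in>U. \<delta> \<le> \<bar>f A x - f B x\<bar>))"
    by (rule exE)
  then have \<delta>: "\<delta> > 0" "\<And>A B. A \<noteq> B \<Longrightarrow> \<exists>x\<in>U. \<delta> \<le> \<bar>f A x - f B x\<bar>" by simp_all
  define R where "R = (\<Sum>i<length l. \<bar>(l ! i) x0\<bar>) + 1"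
  have inR: "(l ! i) x \<in> {-R..R}" if "x \<in> U" "i < length l" for x i
  proof -
    have "\<bar>(l ! i) x0\<bar> \<le> (\<Sum>i<length l. \<bar>(l ! i) x0\<bar>)" using that by (intro member_le_sum) auto
    moreover have "(l ! i) x \<in> {(l ! i) x0 - 1<..<(l ! i) x0 + 1}" using that unfolding U_def by blast
    ultimately show ?thesis by (auto simp: R_def)
  qed
  define \<eta> where "\<eta> = \<delta> / (real (length l) + 1)"
  have eta: "\<eta> > 0" using \<delta>(1) by (simp add: \<eta>_def)
  have "continuous_on {-R..R} (h A i)" if "A \<in> \<A>" "i < length l" for A i
    by (rule continuous_on_subset[OF h[OF that]]) simp
  then have "\<exists>A\<in>\<A>. \<exists>B\<in>\<A>. A \<noteq> B \<and> (\<forall>i<length l. \<forall>t\<in>{-R..R}. \<bar>h A i t - h B i t\<bar> < \<eta>)"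
    by (rule two_close_among_uncountably_many[where h = h, OF unc _ eta])
  then obtain A B where AB': "A \<in> \<A>" "B \<in> \<A>"
    "A \<noteq> B \<and> (\<forall>i<length l. \<forall>t\<in>{-R..R}. \<bar>h A i t - h B i t\<bar> < \<eta>)" by (elim bexE)
  then have AB: "A \<in> \<A>" "B \<in> \<A>" "A \<noteq> B"
    "\<And>i t. i < length l \<Longrightarrow> t \<in> {-R..R} \<Longrightarrow> \<bar>h A i t - h B i t\<bar> < \<eta>" by simp_all
  obtain x where x: "x \<in> U" "\<delta> \<le> \<bar>f A x - f B x\<bar>" using \<delta>(2)[OF AB(3)] by blast
  have "x \<in> topspace X" using x(1) by (simp add: U_def)
  then have "f A x - f B x = (\<Sum>i<length l. h A i ((l ! i) x) - h B i ((l ! i) x))"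
    using rep AB by (simp add: sum_subtractf)
  also have "\<bar>\<dots>\<bar> \<le> (\<Sum>i<length l. \<bar>h A i ((l ! i) x) - h B i ((l ! i) x)\<bar>)" by (rule sum_abs)
  also have "\<dots> \<le> (\<Sum>i<length l. \<eta>)" by (intro sum_mono less_imp_le AB(4) inR x(1)) auto
  also have "\<dots> = real (length l) * \<eta>" by simp
  also have "\<dots> < \<delta>" using \<delta>(1) by (simp add: \<eta>_def field_simps)
  finally show False using x(2) by simp
qed

section \<open>Finite dimension\<close>

text \<open>
  The zeros accumulate in the closed interval from 0 to 1/2, inside the disc of convergence, so the identity theorem applies.
\<close>
lemma power_series_coefficients_zero:
  fixes c :: "nat \<Rightarrow> real"
  assumes bound: "\<And>k. \<bar>c k\<bar> \<le> 1" and S: "infinite S" "S \<subseteq> {0<..<1/2}"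
    and zero: "\<And>s. s \<in> S \<Longrightarrow> (\<Sum>k. c k * s ^ k) = 0"
  shows "c k = 0"
proof (rule ccontr)
  assume "c k \<noteq> 0"
  define F where "F z = (\<Sum>k. complex_of_real (c k) * z ^ k)" for z
  have summ: "summable (\<lambda>k. complex_of_real (c k) * z ^ k)" if "norm z < 1" for z
  proof (rule summable_comparison_test'[of "\<lambda>k. norm z ^ k"])
    show "summable (\<lambda>k. norm z ^ k)" using that by (intro summable_geometric) simp
    show "norm (complex_of_real (c k) * z ^ k) \<le> norm z ^ k" for k
      using bound[of k] by (simp add: norm_mult norm_power mult_left_le_one_le)
  qed
  have sums: "(\<lambda>k. complex_of_real (c k) * (z - 0) ^ k) sums F z" if "z \<in> ball 0 1" for z
    using summ[of z] that by (simp add: F_def summable_sums)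
  have holo: "F holomorphic_on ball 0 1" by (rule power_series_holomorphic[OF sums])
  obtain x where x: "x \<in> {0..1/2::real}" "x islimpt S"
  proof -
    have "S \<subseteq> {0..1/2}" using S(2) by (auto simp: subset_iff less_imp_le)
    then show thesis
      using that S(1) compact_Icc[of 0 "1/2::real"] unfolding compact_eq_Bolzano_Weierstrass by blast
  qed
  have lim: "complex_of_real x islimpt complex_of_real ` S"
    unfolding islimpt_approachable
  proof (intro allI impI)
    fix e :: real assume "e > 0"
    then obtain s where "s \<in> S" "s \<noteq> x" "dist s x < e" using x(2) unfolding islimpt_approachable by blast
    then show "\<exists>z\<in>complex_of_real ` S. z \<noteq> complex_of_real x \<and> dist z (complex_of_real x) < e"
      by (intro bexI[of _ "of_real s"]) auto
  qed
  have F0: "F z = 0" if "z \<in> ball 0 1" for z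
  proof (rule analytic_continuation[OF holo open_ball connected_ball _ _ lim _ that])
    show "complex_of_real ` S \<subseteq> ball 0 1" using S(2) by (auto simp: subset_iff abs_if)
    show "complex_of_real x \<in> ball 0 1" using x(1) by auto
    fix z assume "z \<in> complex_of_real ` S"
    then obtain s where s: "s \<in> S" "z = of_real s" by blast
    have "norm s < 1" using s(1) S(2) by (auto simp: subset_iff abs_if)
    then have "summable (\<lambda>k. c k * s ^ k)"
      using summable_Re[OF summ[of "of_real s"]] by (simp flip: of_real_power of_real_mult)
    then have "F z = of_real (\<Sum>k. c k * s ^ k)"
      by (simp add: F_def s(2) suminf_of_real)
    then show "F z = 0" using zero[OF s(1)] by simp
  qed
  have c0: "c 0 = 0" using F0[of 0] by (simp add: F_def)
  then have "k > 0" using \<open>c k \<noteq> 0\<close> by (cases k) auto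
  obtain s where s: "0 < s" "\<And>z. z \<in> cball 0 s - {0} \<Longrightarrow> F z \<noteq> 0"
    by (rule powser_0_nonzero[of 1 0 "\<lambda>k. complex_of_real (c k)" F k])
      (use sums F0[of 0] \<open>c k \<noteq> 0\<close> \<open>k > 0\<close> in auto)
  define t where "t = min s (1/2)"
  have "of_real t \<in> cball 0 s - {0::complex}" "of_real t \<in> ball (0::complex) 1"
    using s(1) by (auto simp: t_def min_def)
  then show False using s(2) F0 by blast
qed

text \<open>
  If the tuple takes the same values at \<open>x\<close> and \<open>y\<close>, so do the infinitely many power series \<open>\<Sum>\<^sub>k a\<^sup>k e\<^sub>k\<close> that are represented through it.
  Hence all coefficients \<open>e\<^sub>k x - e\<^sub>k y\<close> vanish.
\<close>
lemma jointly_injective_tuple: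
  fixes X :: "'a topology"
  assumes sep: "separable_space X" and met: "metrizable_space X"
    and basic: "basic_family X \<Phi>" and less: "|\<Phi>| <o continuum"
  obtains l where "set l \<subseteq> cont_real X"
    "\<forall>x\<in>topspace X. \<forall>y\<in>topspace X. (\<forall>i<length l. (l ! i) x = (l ! i) y) \<longrightarrow> x = y"
proof -
  obtain e :: "nat \<Rightarrow> 'a \<Rightarrow> real" where e: "\<And>k. continuous_map X euclideanreal (e k)"
    "\<And>k x. x \<in> topspace X \<Longrightarrow> 0 \<le> e k x \<and> e k x \<le> 1"
    "\<And>x y. x \<in> topspace X \<Longrightarrow> y \<in> topspace X \<Longrightarrow> (\<And>k. e k x = e k y) \<Longrightarrow> x = y"
    using separating_sequence[OF sep met] by metis
  have "{0<..<1/2::real} \<approx> (UNIV :: real set)" by (simp add: open_interval_eqpoll_reals)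
  then have "(UNIV :: nat set set) \<approx> {0<..<1/2::real}"
    using nat_sets_eqpoll_reals eqpoll_sym eqpoll_trans by blast
  then obtain a :: "nat set \<Rightarrow> real" where a: "bij_betw a UNIV {0<..<1/2}" by (auto simp: eqpoll_def)
  have a_in: "0 < a A" "a A < 1/2" for A using bij_betwE[OF a] by auto
  have summ: "summable (\<lambda>k. (1/2::real) ^ k)" by (rule summable_geometric) simp
  have term_le: "\<bar>e k x * a A ^ k\<bar> \<le> (1/2) ^ k" if "x \<in> topspace X" for k x A
  proof -
    have "a A ^ k \<le> (1/2) ^ k" using a_in[of A] by (intro power_mono) auto
    then have "e k x * a A ^ k \<le> 1 * (1/2) ^ k" using e(2)[OF that, of k] a_in[of A] by (intro mult_mono) auto
    then show ?thesis using e(2)[OF that, of k] a_in[of A] by (simp add: abs_mult)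
  qed
  define f where "f A x = (\<Sum>k. e k x * a A ^ k)" for A x
  have f: "continuous_map X euclideanreal (f A)" for A
    unfolding f_def
    by (rule continuous_map_real_suminf[OF _ term_le summ]) (auto intro!: continuous_intros e(1))
  obtain l \<A> h where l: "set l \<subseteq> cont_real X" and unc: "uncountable \<A>"
    and h: "\<And>A i. A \<in> \<A> \<Longrightarrow> i < length l \<Longrightarrow> continuous_on UNIV (h A i :: real \<Rightarrow> real)"
    and rep: "\<And>A x. A \<in> \<A> \<Longrightarrow> x \<in> topspace X \<Longrightarrow> f A x = (\<Sum>i<length l. h A i ((l ! i) x))"
    by (rule representation_sharing_inner_functions[where f = f, OF basic less f]) (rule that)
  show thesis
  proof (rule that[OF l], intro ballI impI)
    fix x y assume x: "x \<in> topspace X" and y: "y \<in> topspace X"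
      and eq: "\<forall>i<length l. (l ! i) x = (l ! i) y"
    have "e k x - e k y = 0" for k
    proof (rule power_series_coefficients_zero[where S = "a ` \<A>" and c = "\<lambda>k. e k x - e k y"])
      show "\<bar>e k x - e k y\<bar> \<le> 1" for k using e(2)[OF x, of k] e(2)[OF y, of k] by (simp add: abs_le_iff)
      have "inj_on a \<A>" using a by (auto simp: bij_betw_def inj_on_def)
      then show "infinite (a ` \<A>)" using unc by (auto simp: finite_image_iff countable_finite)
      show "a ` \<A> \<subseteq> {0<..<1/2}" using a_in by auto
      fix s assume "s \<in> a ` \<A>"
      then obtain A where A: "A \<in> \<A>" "s = a A" by blast
      have sm: "summable (\<lambda>k. e k z * a A ^ k)" if "z \<in> topspace X" for z
        by (rule summable_comparison_test'[OF summ]) (use term_le[OF that] in auto)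
      have "f A x = f A y" using rep A(1) x y eq by simp
      then show "(\<Sum>k. (e k x - e k y) * s ^ k) = 0"
        using suminf_diff[OF sm[OF x] sm[OF y]] by (simp add: f_def A(2) left_diff_distrib)
    qed
    then show "x = y" using e(3)[OF x y] by simp
  qed
qed

text \<open>
  Lebesgue's covering lemma for the compact image of \<open>Y\<close> under the injective tuple of the functions \<open>\<phi> i\<close>, phrased on \<open>Y\<close> itself.
\<close>
lemma joint_Lebesgue_number:
  fixes X :: "'a topology" and \<phi> :: "nat \<Rightarrow> 'a \<Rightarrow> real"
  assumes Y: "compactin X Y" and phi: "\<And>i. i < n \<Longrightarrow> continuous_map X euclideanreal (\<phi> i)"
    and inj: "\<And>x y. x \<in> Y \<Longrightarrow> y \<in> Y \<Longrightarrow> (\<And>i. i < n \<Longrightarrow> \<phi> i x = \<phi> i y) \<Longrightarrow> x = y"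
    and op: "\<And>U. U \<in> \<U> \<Longrightarrow> openin X U" and cov: "Y \<subseteq> \<Union>\<U>"
  shows "\<exists>r>0. \<forall>y\<in>Y. \<exists>U\<in>\<U>. \<forall>z\<in>Y. (\<forall>i<n. \<bar>\<phi> i z - \<phi> i y\<bar> < r) \<longrightarrow> z \<in> U"
proof -
  have YX: "Y \<subseteq> topspace X" using Y by (rule compactin_subset_topspace)
  have "\<exists>r>0. \<exists>U\<in>\<U>. \<forall>z\<in>Y. (\<forall>i<n. \<bar>\<phi> i z - \<phi> i x\<bar> < r) \<longrightarrow> z \<in> U" if x: "x \<in> Y" for x
  proof -
    obtain U where U: "U \<in> \<U>" "x \<in> U" using cov x by blast
    let ?D = "\<lambda>z. \<Sum>i<n. \<bar>\<phi> i z - \<phi> i x\<bar>"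
    have D: "continuous_map X euclideanreal ?D" using phi by (intro continuous_intros) auto
    have "closedin X (topspace X - U)" using op[OF U(1)] by blast
    then have "compactin X (Y \<inter> (topspace X - U))" using Y by (simp add: compact_Int_closedin)
    then have "compactin euclideanreal (?D ` (Y \<inter> (topspace X - U)))" using D by (rule image_compactin)
    then have cl: "closed (?D ` (Y \<inter> (topspace X - U)))" by (simp add: compact_imp_closed)
    have "0 \<notin> ?D ` (Y \<inter> (topspace X - U))"
    proof
      assume "0 \<in> ?D ` (Y \<inter> (topspace X - U))"
      then obtain z where z: "z \<in> Y" "z \<notin> U" "?D z = 0" by auto
      then have "\<forall>i\<in>{..<n}. \<bar>\<phi> i z - \<phi> i x\<bar> = 0" by (subst (asm) sum_nonneg_eq_0_iff) auto
      then have "z = x" using inj[OF z(1) x] by auto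
      then show False using z(2) U(2) by simp
    qed
    then have "open (- (?D ` (Y \<inter> (topspace X - U))))" "0 \<in> - (?D ` (Y \<inter> (topspace X - U)))" using cl by auto
    then obtain e where e: "e > 0" "ball 0 e \<subseteq> - (?D ` (Y \<inter> (topspace X - U)))" unfolding open_contains_ball by blast
    have "z \<in> U" if z: "z \<in> Y" "\<forall>i<n. \<bar>\<phi> i z - \<phi> i x\<bar> < e / (real n + 1)" for z
    proof (rule ccontr)
      assume "z \<notin> U"
      then have "?D z \<notin> ball 0 e" using e(2) z(1) YX by blast
      moreover have "?D z \<ge> 0" by (intro sum_nonneg) auto
      moreover have "?D z \<le> (\<Sum>i<n. e / (real n + 1))" using z(2) by (intro sum_mono less_imp_le) auto
      moreover have "(\<Sum>i<n. e / (real n + 1)) < e" using e(1) by (simp add: field_simps)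
      ultimately show False by simp
    qed
    then show ?thesis using e(1) U(1) by (intro exI[of _ "e / (real n + 1)"]) auto
  qed
  then obtain r W where rW: "\<And>x. x \<in> Y \<Longrightarrow> r x > 0" "\<And>x. x \<in> Y \<Longrightarrow> W x \<in> \<U>"
    "\<And>x z. x \<in> Y \<Longrightarrow> z \<in> Y \<Longrightarrow> (\<forall>i<n. \<bar>\<phi> i z - \<phi> i x\<bar> < r x) \<Longrightarrow> z \<in> W x" by metis
  define O' where "O' x = (\<Inter>i\<in>{..<n}. {z\<in>topspace X. \<phi> i z \<in> {\<phi> i x - r x / 2 <..< \<phi> i x + r x / 2}}) \<inter> topspace X" for x
  have "openin X {z\<in>topspace X. \<phi> i z \<in> {\<phi> i x - r x / 2 <..< \<phi> i x + r x / 2}}" if "i < n" for i x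
    by (rule openin_continuous_map_preimage[OF phi[OF that]]) simp
  then have opO: "openin X (O' x)" for x unfolding O'_def by (intro openin_INT) auto
  have "x \<in> O' x" if "x \<in> Y" for x using rW(1)[OF that] that YX by (auto simp: O'_def)
  then have "Y \<subseteq> \<Union>(O' ` Y)" by blast
  then obtain \<F> where \<F>: "finite \<F>" "\<F> \<subseteq> O' ` Y" "Y \<subseteq> \<Union>\<F>"
    using Y opO unfolding compactin_def by (metis (mono_tags, lifting) imageE)
  then obtain T where T: "finite T" "T \<subseteq> Y" "\<F> = O' ` T" by (metis finite_subset_image)
  define \<rho> where "\<rho> = Min (insert 1 ((\<lambda>x. r x / 2) ` T))"
  have "\<rho> > 0" unfolding \<rho>_def using T(1,2) rW(1) by (subst Min_gr_iff) (auto simp: subset_iff)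
  moreover have "\<exists>U\<in>\<U>. \<forall>z\<in>Y. (\<forall>i<n. \<bar>\<phi> i z - \<phi> i y\<bar> < \<rho>) \<longrightarrow> z \<in> U" if y: "y \<in> Y" for y
  proof -
    obtain x where x: "x \<in> T" "y \<in> O' x" using \<F>(3) T(3) y by blast
    have rx: "\<rho> \<le> r x / 2" unfolding \<rho>_def using T(1) x(1) by (intro Min_le) auto
    have "z \<in> W x" if z: "z \<in> Y" "\<forall>i<n. \<bar>\<phi> i z - \<phi> i y\<bar> < \<rho>" for z
    proof (rule rW(3))
      show "x \<in> Y" "z \<in> Y" using x T z by auto
      show "\<forall>i<n. \<bar>\<phi> i z - \<phi> i x\<bar> < r x"
      proof (intro allI impI)
        fix i assume i: "i < n"
        have "\<phi> i y \<in> {\<phi> i x - r x / 2 <..< \<phi> i x + r x / 2}" using x(2) i unfolding O'_def by blast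
        then show "\<bar>\<phi> i z - \<phi> i x\<bar> < r x" using z(2)[rule_format, OF i] rx by auto
      qed
    qed
    then show ?thesis using rW(2) x(1) T(2) by blast
  qed
  ultimately show ?thesis by blast
qed

lemma card_integers_near:
  fixes a :: real
  shows "finite {z::int. \<bar>a - of_int z\<bar> < 1}" "card {z::int. \<bar>a - of_int z\<bar> < 1} \<le> 2"
proof -
  have sub: "{z::int. \<bar>a - of_int z\<bar> < 1} \<subseteq> {\<lfloor>a\<rfloor>, \<lfloor>a\<rfloor> + 1}" by (auto simp: abs_if) linarith+
  then show "finite {z::int. \<bar>a - of_int z\<bar> < 1}" by (rule finite_subset) simp
  have "card {z::int. \<bar>a - of_int z\<bar> < 1} \<le> card {\<lfloor>a\<rfloor>, \<lfloor>a\<rfloor> + 1}" using sub by (intro card_mono) auto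
  then show "card {z::int. \<bar>a - of_int z\<bar> < 1} \<le> 2" by simp
qed

text \<open>
  The cells \<open>W\<close> are preimages of overlapping grid cubes; the mesh of the grid may depend on the integer \<open>j\<close> near
  \<open>\<rho> x\<close>, which is what lets a cover of a noncompact space be refined.  A point lies in at most two slabs and, within a slab, in at most \<open>2 ^ n\<close>
  cubes.  Uniting the cells assigned to the same member of the finite cover \<open>\<U>\<close> makes the refinement finite and does not increase the order.
\<close>
lemma finite_dimensional_if_jointly_injective:
  fixes X :: "'a topology" and \<phi> :: "nat \<Rightarrow> 'a \<Rightarrow> real"
  assumes sep: "separable_space X" and met: "metrizable_space X" and lc: "locally_compact_space X"
    and phi: "\<And>i. i < n \<Longrightarrow> continuous_map X euclideanreal (\<phi> i)"
    and inj: "\<And>x y. x \<in> topspace X \<Longrightarrow> y \<in> topspace X \<Longrightarrow> (\<And>i. i < n \<Longrightarrow> \<phi> i x = \<phi> i y) \<Longrightarrow> x = y"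
  shows "covering_dim_le X (2 * 2 ^ n)"
  unfolding covering_dim_le_def
proof (intro allI impI)
  fix \<U> assume \<U>: "finite \<U> \<and> open_cover X \<U>"
  then have op: "\<And>U. U \<in> \<U> \<Longrightarrow> openin X U" and UX: "\<Union>\<U> = topspace X" by (auto simp: open_cover_def)
  obtain \<rho> where rho: "continuous_map X euclideanreal \<rho>" "\<And>r. compactin X {x\<in>topspace X. \<rho> x \<le> r}"
    using proper_function_exists[OF sep met lc] by blast
  define Y where "Y j = {x\<in>topspace X. \<rho> x \<le> real_of_int j + 1}" for j
  have "\<exists>r>0. \<forall>y\<in>Y j. \<exists>U\<in>\<U>. \<forall>z\<in>Y j. (\<forall>i<n. \<bar>\<phi> i z - \<phi> i y\<bar> < r) \<longrightarrow> z \<in> U" for j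
    by (rule joint_Lebesgue_number[OF _ phi _ op]) (use rho(2) inj UX in \<open>auto simp: Y_def\<close>)
  then obtain r where r: "\<And>j. r j > 0"
    "\<And>j y. y \<in> Y j \<Longrightarrow> \<exists>U\<in>\<U>. \<forall>z\<in>Y j. (\<forall>i<n. \<bar>\<phi> i z - \<phi> i y\<bar> < r j) \<longrightarrow> z \<in> U" by metis
  define N where "N j = 2 / r j" for j
  have N: "N j > 0" "2 / N j = r j" for j using r(1)[of j] by (auto simp: N_def)
  define W where "W p = {x\<in>topspace X. \<bar>\<rho> x - real_of_int (fst p)\<bar> < 1 \<and>
      (\<forall>i<n. \<bar>N (fst p) * \<phi> i x - real_of_int (snd p i)\<bar> < 1)}" for p :: "int \<times> (nat \<Rightarrow> int)"
  define P where "P = (UNIV :: int set) \<times> ({..<n} \<rightarrow>\<^sub>E (UNIV :: int set))"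
  have W_open: "openin X (W p)" for p
  proof -
    have 1: "openin X {x\<in>topspace X. \<bar>g x - c\<bar> < 1}" if "continuous_map X euclideanreal g" for g and c :: real
    proof -
      have "{x\<in>topspace X. \<bar>g x - c\<bar> < 1} = {x\<in>topspace X. g x \<in> {c - 1<..<c + 1}}" by auto
      then show ?thesis using openin_continuous_map_preimage[OF that, of "{c - 1<..<c + 1}"] by simp
    qed
    have eq: "W p = {x\<in>topspace X. \<bar>\<rho> x - real_of_int (fst p)\<bar> < 1} \<inter>
        ((\<Inter>i\<in>{..<n}. {x\<in>topspace X. \<bar>N (fst p) * \<phi> i x - real_of_int (snd p i)\<bar> < 1}) \<inter> topspace X)"
      by (auto simp: W_def)
    show ?thesis
      unfolding eq by (intro openin_Int openin_INT 1 rho(1) continuous_map_real_mult_left phi) auto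
  qed
  have W_small: "\<exists>U\<in>\<U>. W p \<subseteq> U" if "W p \<noteq> {}" for p
  proof -
    from that obtain y where y: "y \<in> W p" by blast
    let ?j = "fst p"
    have WY: "x \<in> Y ?j" if "x \<in> W p" for x using that by (auto simp: W_def Y_def abs_less_iff)
    obtain U where U: "U \<in> \<U>" "\<And>z. z \<in> Y ?j \<Longrightarrow> (\<forall>i<n. \<bar>\<phi> i z - \<phi> i y\<bar> < r ?j) \<Longrightarrow> z \<in> U"
      using r(2)[OF WY[OF y]] by blast
    have "z \<in> U" if z: "z \<in> W p" for z
    proof (rule U(2)[OF WY[OF z]], intro allI impI)
      fix i assume "i < n"
      then have "\<bar>N ?j * \<phi> i z - real_of_int (snd p i)\<bar> < 1" "\<bar>N ?j * \<phi> i y - real_of_int (snd p i)\<bar> < 1"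
        using y z by (auto simp: W_def)
      then have "\<bar>N ?j * \<phi> i z - N ?j * \<phi> i y\<bar> < 2" by linarith
      moreover have "\<bar>N ?j * \<phi> i z - N ?j * \<phi> i y\<bar> = N ?j * \<bar>\<phi> i z - \<phi> i y\<bar>"
        using N(1)[of ?j] by (simp add: abs_mult flip: right_diff_distrib)
      ultimately have "\<bar>\<phi> i z - \<phi> i y\<bar> < 2 / N ?j" using N(1)[of ?j] by (simp add: field_simps)
      then show "\<bar>\<phi> i z - \<phi> i y\<bar> < r ?j" by (simp only: N(2))
    qed
    then show ?thesis using U(1) by blast
  qed
  define u where "u p = (SOME U. U \<in> \<U> \<and> W p \<subseteq> U)" for p
  have u: "u p \<in> \<U>" "W p \<subseteq> u p" if "W p \<noteq> {}" for p
    using someI_ex[of "\<lambda>U. U \<in> \<U> \<and> W p \<subseteq> U"] W_small[OF that] unfolding u_def by blast+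
  define V where "V U = (\<Union>p\<in>{p\<in>P. W p \<noteq> {} \<and> u p = U}. W p)" for U
  have V_sub: "V U \<subseteq> U" for U using u(2) by (auto simp: V_def)
  have V_open: "openin X (V U)" for U unfolding V_def by (rule openin_Union) (use W_open in auto)
  define idx where "idx x = {p\<in>P. x \<in> W p}" for x
  have idx_ne: "\<exists>p\<in>P. x \<in> W p" if "x \<in> topspace X" for x
  proof -
    let ?p = "(\<lfloor>\<rho> x\<rfloor>, \<lambda>i\<in>{..<n}. \<lfloor>N \<lfloor>\<rho> x\<rfloor> * \<phi> i x\<rfloor>)"
    have "\<bar>t - real_of_int \<lfloor>t\<rfloor>\<bar> < 1" for t :: real by linarith
    then have "x \<in> W ?p" using that by (auto simp: W_def)
    moreover have "?p \<in> P" by (auto simp: P_def)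
    ultimately show ?thesis by blast
  qed
  have idx_card: "finite (idx x)" "card (idx x) \<le> 2 * 2 ^ n" for x
  proof -
    let ?J = "{j::int. \<bar>\<rho> x - of_int j\<bar> < 1}"
    let ?Z = "\<lambda>j. \<Pi>\<^sub>E i\<in>{..<n}. {z::int. \<bar>N j * \<phi> i x - of_int z\<bar> < 1}"
    have sub: "idx x \<subseteq> Sigma ?J ?Z" by (auto simp: idx_def P_def W_def PiE_iff)
    have finZ: "finite (?Z j)" for j by (intro finite_PiE card_integers_near) auto
    have cardZ: "card (?Z j) \<le> 2 ^ n" for j
    proof -
      have "card (?Z j) = (\<Prod>i<n. card {z::int. \<bar>N j * \<phi> i x - of_int z\<bar> < 1})" by (simp add: card_PiE)
      also have "\<dots> \<le> (\<Prod>i<n. 2)" by (intro prod_mono) (use card_integers_near in auto)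
      finally show ?thesis by simp
    qed
    have fin: "finite (Sigma ?J ?Z)" using card_integers_near(1) finZ by (intro finite_SigmaI)
    then show "finite (idx x)" using sub finite_subset by blast
    have "card (idx x) \<le> card (Sigma ?J ?Z)" using fin sub by (rule card_mono)
    also have "\<dots> = (\<Sum>j\<in>?J. card (?Z j))" using card_integers_near(1) finZ by (intro card_SigmaI) auto
    also have "\<dots> \<le> (\<Sum>j\<in>?J. 2 ^ n)" by (intro sum_mono cardZ)
    also have "\<dots> \<le> 2 * 2 ^ n" using card_integers_near(2)[of "\<rho> x"] by simp
    finally show "card (idx x) \<le> 2 * 2 ^ n" .
  qed
  show "\<exists>\<V>. finite \<V> \<and> open_cover X \<V> \<and> (\<forall>V\<in>\<V>. \<exists>U\<in>\<U>. V \<subseteq> U) \<and>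
      (\<forall>x\<in>topspace X. card {V\<in>\<V>. x \<in> V} \<le> 2 * 2 ^ n + 1)"
  proof (intro exI[of _ "V ` \<U>"] conjI ballI)
    show "finite (V ` \<U>)" using \<U> by simp
    have "x \<in> \<Union>(V ` \<U>)" if "x \<in> topspace X" for x
    proof -
      from idx_ne[OF that] obtain p where p: "p \<in> P" "x \<in> W p" by blast
      then have "x \<in> V (u p)" unfolding V_def by (intro UN_I[of p]) auto
      moreover have "u p \<in> \<U>" using u(1) p by blast
      ultimately show ?thesis by blast
    qed
    then show "open_cover X (V ` \<U>)"
      using V_open openin_subset[OF V_open] by (auto simp: open_cover_def)
    fix V' assume "V' \<in> V ` \<U>"
    then show "\<exists>U\<in>\<U>. V' \<subseteq> U" using V_sub by blast
  next
    fix x assume "x \<in> topspace X"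
    have "{V'\<in>V ` \<U>. x \<in> V'} \<subseteq> (\<lambda>p. V (u p)) ` idx x"
    proof clarify
      fix U assume "U \<in> \<U>" "x \<in> V U"
      then obtain p where "p \<in> P" "x \<in> W p" "u p = U" by (auto simp: V_def)
      then show "V U \<in> (\<lambda>p. V (u p)) ` idx x" by (auto simp: idx_def)
    qed
    then have "card {V'\<in>V ` \<U>. x \<in> V'} \<le> card (idx x)" using idx_card(1) by (intro surj_card_le)
    then show "card {V'\<in>V ` \<U>. x \<in> V'} \<le> 2 * 2 ^ n + 1" using idx_card(2)[of x] by linarith
  qed
qed

section \<open>The size of basic families\<close>

text \<open>
  A continuous function is determined by the rational numbers below its values on a countable dense set, hence by a set of natural numbers.
\<close>
lemma card_cont_real_le:
  fixes X :: "'a topology"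
  assumes "separable_space X"
  shows "|cont_real X| \<le>o continuum"
proof -
  obtain C where C: "countable C" "C \<subseteq> topspace X" "X closure_of C = topspace X"
    using assms by (auto simp: separable_space_def)
  define c where "c = from_nat_into C"
  have cC: "\<exists>k. c k = x" if "x \<in> C" for x using from_nat_into_surj[OF C(1) that] by (simp add: c_def)
  define code :: "('a \<Rightarrow> real) \<Rightarrow> nat set" where "code f = {to_nat (k, q :: rat) |k q. real_of_rat q < f (c k)}" for f
  have mem: "to_nat (k :: nat, q :: rat) \<in> code f \<longleftrightarrow> real_of_rat q < f (c k)" for k q f
    by (auto simp: code_def)
  have "inj_on code (cont_real X)"
  proof (rule inj_onI)
    fix f g assume f: "f \<in> cont_real X" and g: "g \<in> cont_real X" and eq: "code f = code g"
    have rat: "real_of_rat q < f (c k) \<longleftrightarrow> real_of_rat q < g (c k)" for k q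
      using mem[of k q f] mem[of k q g] eq by simp
    have "f (c k) = g (c k)" for k
    proof (rule ccontr)
      assume "f (c k) \<noteq> g (c k)"
      then consider "f (c k) < g (c k)" | "g (c k) < f (c k)" by linarith
      then show False by cases (metis of_rat_dense rat not_less_iff_gr_or_eq)+
    qed
    then have "f x = g x" if "x \<in> C" for x using cC[OF that] by metis
    then have "f x = g x" if "x \<in> topspace X" for x
      using forall_in_closure_of_eq[of x X C euclideanreal f g] that f g C(3) by (simp add: cont_real_def)
    then show "f = g" using f g by (intro extensionalityI[of _ "topspace X"]) (auto simp: cont_real_def)
  qed
  then have "|cont_real X| \<le>o |UNIV :: nat set set|" using card_of_ordLeq by blast
  then show ?thesis using continuum_nat_sets by (rule ordLeq_ordIso_trans)
qed

theorem theorem3: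
  fixes X :: "'a topology"
  assumes "separable_space X" and "metrizable_space X"
  shows "(basic X <o natLeq \<or> basic X =o continuum) \<and>
         (basic X <o natLeq \<longleftrightarrow> locally_compact_space X \<and> finite_dimensional X)"
proof -
  obtain \<Phi> where \<Phi>: "basic_family X \<Phi>" "basic X = |\<Phi>|" using basic_is_minimum(1) by blast
  have small: "locally_compact_space X \<and> finite_dimensional X" if less: "|\<Phi>| <o continuum"
  proof
    show lc: "locally_compact_space X"
      by (rule locally_compact_if_small_basic_family[OF assms(2) \<Phi>(1) less])
    obtain l where l: "set l \<subseteq> cont_real X"
      "\<forall>x\<in>topspace X. \<forall>y\<in>topspace X. (\<forall>i<length l. (l ! i) x = (l ! i) y) \<longrightarrow> x = y"
      by (rule jointly_injective_tuple[OF assms \<Phi>(1) less]) (rule that)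
    have "continuous_map X euclideanreal (l ! i)" if "i < length l" for i
      using subsetD[OF l(1) nth_mem[OF that]] by (simp add: cont_real_def)
    then have "covering_dim_le X (2 * 2 ^ length l)"
      by (rule finite_dimensional_if_jointly_injective[OF assms lc _ l(2)[rule_format]])
    then show "finite_dimensional X" by (auto simp: finite_dimensional_def)
  qed
  have finite_iff: "basic X <o natLeq \<longleftrightarrow> finite \<Phi>"
    unfolding \<Phi>(2) by (rule finite_iff_ordLess_natLeq[symmetric])
  have large: "finite \<Phi>" if "locally_compact_space X \<and> finite_dimensional X"
  proof -
    obtain \<Psi> where \<Psi>: "finite \<Psi>" "basic_family X \<Psi>"
      using finite_basic_family_exists[OF assms] \<open>locally_compact_space X \<and> finite_dimensional X\<close> by blast
    then have "|\<Phi>| \<le>o |\<Psi>|" using basic_is_minimum(2) \<Phi>(2) by metis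
    then show ?thesis using \<Psi>(1) card_of_ordLeq_finite by blast
  qed
  have finite_less: "|\<Phi>| <o continuum" if "finite \<Phi>"
    by (rule finite_ordLess_infinite[OF card_of_Well_order
          card_order_on_well_order_on[OF Card_order_continuum] _ infinite_continuum])
      (use that in \<open>simp add: Field_card_of\<close>)
  have upper: "|\<Phi>| \<le>o continuum"
  proof -
    have "\<Phi> \<subseteq> cont_real X" using \<Phi>(1) by (simp add: basic_family_def)
    then show ?thesis using card_of_mono1 card_cont_real_le[OF assms(1)] ordLeq_transitive by blast
  qed
  then consider "|\<Phi>| <o continuum" | "|\<Phi>| =o continuum" using ordLeq_iff_ordLess_or_ordIso by blast
  then show ?thesis
  proof cases
    case 1
    then show ?thesis using small large finite_iff by blast
  next
    case 2
    then have "\<not> |\<Phi>| <o continuum" using not_ordLess_ordIso by blast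
    then show ?thesis using 2 large finite_less finite_iff \<Phi>(2) by auto
  qed
qed

end
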